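(* Let $n\ge 2$ and let $(S_1,\dots,S_{n-1},P)$ be a c.n.u. $\Gamma_n$-contraction on a Hilbert space $\mathcal H$, with $(A_1,\dots,A_{n-1})$ and $(B_1,\dots,B_{n-1})$ being the $\mathcal F_O$-tuples of $(S_1,\dots,S_{n-1},P)$ and $(S_1^*,\dots,S_{n-1}^*,P^* )$ respectively. Suppose that $$\Sigma_1(z)=\Big(\tfrac{n-1}{n}(A_1+A_{n-1}^*z),\tfrac{n-2}{n}(A_2+A_{n-2}^*z),\dots,\tfrac1n(A_{n-1}+A_1^*z)\Big)$$ and $$\Sigma_2(z)=\Big(\tfrac{n-1}{n}(B_1^*+B_{n-1}z),\tfrac{n-2}{n}(B_2^*+B_{n-2}z),\dots,\tfrac1n(B_{n-1}^*+B_1z)\Big)$$ are $\Gamma_{n-1}$-contractions for all $z\in\mathbb D$. Let $G_1,\dots,G_{n-1}$, $U_1$ and $\widetilde S_{12},\dots,\widetilde S_{(n-1)2}$ be as described in the context, with $\mathcal H$ regarded as a subspace of $\widetilde{\mathbf K}_+=(H^2(\mathbb D)\otimes\mathcal D_{P^*})\oplus\overline{\Delta_P(L^2(\mathcal D_P))}$ through the dilation described there, and set $$C_i=P_{\mathcal H}\Big((I_{H^2(\mathbb D)}\otimes U_1^*G_i^*U_1)\oplus\tfrac{\widetilde S_{i2}}{2}\Big)\Big|_{\mathcal H},\qquad i=1,\dots,n-1.$$ Then $S_i=C_i+PC_{n-i}^*$ for $i=1,\dots,n-1$.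
   Context: All operators are bounded and act on complex Hilbert spaces. $\mathbb D$ is the open unit disc, $\mathbb T$ the unit circle. For $m\ge1$, $\Gamma_m=\{(\sum_i z_i,\sum_{i<j}z_iz_j,\dots,\prod_i z_i):|z_i|\le1,\ 1\le i\le m\}\subset\mathbb C^m$ (so $\Gamma_1=\overline{\mathbb D}$). A commuting $m$-tuple $T$ is a $\Gamma_m$-contraction if $\Gamma_m$ is a spectral set for it: its Taylor joint spectrum lies in $\Gamma_m$ and $\|r(T)\|\le\sup_{\Gamma_m}|r|$ for all rational functions $r$ with poles off $\Gamma_m$. A commuting tuple $(S_1,\dots,S_{n-1},P)$ is a $\Gamma_n$-unitary if all entries are normal and the Taylor joint spectrum lies in $b\Gamma_n=\{(s_1,\dots,s_{n-1},p)\in\Gamma_n:|p|=1\}$; a $\Gamma_n$-isometry if it is the restriction of a $\Gamma_n$-unitary to a common invariant subspace; a pure $\Gamma_n$-isometry if it is a $\Gamma_n$-isometry whose last entry is a pure isometry (i.e. $P^{*k}\to0$ strongly). A contraction is c.n.u. (completely non-unitary) if it has no nonzero reducing subspace on which it is unitary; a $\Gamma_n$-contraction $(S_1,\dots,S_{n-1},P)$ is c.n.u. if the contraction $P$ is c.n.u. For a contraction $P$, $D_P=(I-P^*P)^{1/2}$ and $\mathcal D_P=\overline{\mathrm{Ran}}\,D_P$. For every $\Gamma_n$-contraction $(S_1,\dots,S_{n-1},P)$ there are unique $A_1,\dots,A_{n-1}\in\mathcal B(\mathcal D_P)$ with $S_i-S_{n-i}^*P=D_PA_iD_P$ for $1\le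 i\le n-1$; $(A_1,\dots,A_{n-1})$ is its $\mathcal F_O$-tuple. The adjoint tuple is also a $\Gamma_n$-contraction, so its $\mathcal F_O$-tuple consists of operators on $\mathcal D_{P^*}$. The characteristic function is $\Theta_P(z)=[-P+zD_{P^*}(I-zP^* )^{-1}D_P]|_{\mathcal D_P}:\mathcal D_P\to\mathcal D_{P^*}$, $z\in\mathbb D$, with boundary values $\Theta_P(e^{it})$ a.e.; $\Delta_P(t)=(I_{\mathcal D_P}-\Theta_P(e^{it})^*\Theta_P(e^{it}))^{1/2}$ acts by pointwise multiplication on $L^2(\mathcal D_P)=L^2(\mathbb T,\mathcal D_P)$. $M_z$ is multiplication by $z$ on the Hardy space $H^2(\mathbb D)$, and $M_{e^{it}}$ is multiplication by $e^{it}$. $P_{\mathcal H}$ is the orthogonal projection onto $\mathcal H$. A $\Gamma_n$-isometric dilation of a $\Gamma_n$-contraction $(S_1,\dots,S_{n-1},P)$ on $\mathcal H$ is a $\Gamma_n$-isometry $(Q_1,\dots,Q_{n-1},W)$ on a Hilbert space $\mathcal L$ containing $\mathcal H$ (up to an isometric embedding) with $P_{\mathcal H}Q_1^{m_1}\cdots Q_{n-1}^{m_{n-1}}W^m|_{\mathcal H}=S_1^{m_1}\cdots S_{n-1}^{m_{n-1}}P^m$ for all nonnegative integers $m_1,\dots,m_{n-1},m$; it is minimal if $\mathcal L=\overline{\mathrm{span}}\{Q_1^{m_1}\cdots Q_{n-1}^{m_{n-1}}W^mh:h\in\mathcal H,\ m_1,\dots,m_{n-1},m\ge0\}$. The objects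 in the claim: on $\mathcal K=\mathcal H\oplus\mathcal D_P\oplus\mathcal D_P\oplus\cdots$ let $$R_i(h_0,h_1,h_2,\dots)=(S_ih_0,\ A_{n-i}^*D_Ph_0+A_ih_1,\ A_{n-i}^*h_1+A_ih_2,\ \dots),\qquad V(h_0,h_1,h_2,\dots)=(Ph_0,D_Ph_0,h_1,h_2,\dots).$$ Under the hypotheses on $\Sigma_1,\Sigma_2$ it is known that $(R_1,\dots,R_{n-1},V)$ is a minimal $\Gamma_n$-isometric dilation of $(S_1,\dots,S_{n-1},P)$. By the Wold decomposition of $\Gamma_n$-isometries, $\mathcal K=\mathcal K_1\oplus\mathcal K_2$ with $\mathcal K_1,\mathcal K_2$ reducing all $R_i$ and $V$, such that $(R_{11},\dots,R_{1(n-1)},V_1)=(R_1,\dots,R_{n-1},V)|_{\mathcal K_1}$ is a pure $\Gamma_n$-isometry and $(R_{21},\dots,R_{2(n-1)},V_2)=(R_1,\dots,R_{n-1},V)|_{\mathcal K_2}$ is a $\Gamma_n$-unitary; moreover $\mathcal D_{V_1^*}=\mathcal D_{V^*}$. $(G_1,\dots,G_{n-1})$ is the $\mathcal F_O$-tuple of $(R_{11}^*,\dots,R_{1(n-1)}^*,V_1^* )$. The unitaries $U_1:\mathcal D_{P^*}\to\mathcal D_{V^*}$ and $U_2:\overline{\Delta_P(L^2(\mathcal D_P))}\to\mathcal K_2$ are such that, with $$\widetilde S_{i1}=I_{H^2(\mathbb D)}\otimes U_1^*G_i^*U_1+M_z\otimes U_1^*G_{n-i}U_1,\quad \widetilde P_1=M_z\otimes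 I_{\mathcal D_{P^*}},\quad \widetilde S_{i2}=U_2^*R_{2i}U_2,\quad \widetilde P_2=M_{e^{it}}|_{\overline{\Delta_P(L^2(\mathcal D_P))}},$$ the tuple $(\widetilde S_{11}\oplus\widetilde S_{12},\dots,\widetilde S_{(n-1)1}\oplus\widetilde S_{(n-1)2},\widetilde P_1\oplus\widetilde P_2)$ on $\widetilde{\mathbf K}_+$ is a minimal $\Gamma_n$-isometric dilation of $(S_1,\dots,S_{n-1},P)$ (such unitaries exist by another theorem of the paper). $\mathcal H$ is regarded as a subspace of $\widetilde{\mathbf K}_+$ via this dilation. *)

theory Defs
  imports "HOL-Analysis.Analysis" "HOL-Library.Poly_Mapping"
begin

(* avoids ambiguity with the notation for suminf *)
no_syntax "_Sum_any" :: "pttrn \<Rightarrow> 'a \<Rightarrow> 'a::comm_monoid_add"  (\<open>(\<open>indent=2 notation=\<open>binder \<Sum>\<close>\<close>\<Sum>_. _)\<close> [0, 10] 10)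

section \<open>Complex Hilbert spaces\<close>

text \<open>The library's \<^class>\<open>real_inner\<close> provides the real part of the inner product; a complex
  structure for which multiplication by \<open>\<i>\<close> is isometric determines the complex one, which is
  linear in the first argument.\<close>

class complex_inner = real_inner +
  fixes scaleC :: "complex \<Rightarrow> 'a \<Rightarrow> 'a"  (infixr \<open>*\<^sub>C\<close> 75)
  assumes scaleC_add_right: "c *\<^sub>C (x + y) = c *\<^sub>C x + c *\<^sub>C y"
    and scaleC_add_left: "(c + d) *\<^sub>C x = c *\<^sub>C x + d *\<^sub>C x"
    and scaleC_scaleC: "c *\<^sub>C d *\<^sub>C x = (c * d) *\<^sub>C x"
    and scaleC_of_real: "complex_of_real r *\<^sub>C x = r *\<^sub>R x"
    and inner_scaleC_ii: "inner (\<i> *\<^sub>C x) (\<i> *\<^sub>C y) = inner x y"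

class chilbert_space = complex_inner + complete_space

instance chilbert_space \<subseteq> banach ..

definition cinner :: "'a::complex_inner \<Rightarrow> 'a \<Rightarrow> complex"
  where "cinner x y = Complex (inner x y) (inner x (\<i> *\<^sub>C y))"

lemma scaleC_one [simp]: "1 *\<^sub>C x = (x::'a::complex_inner)"
  using scaleC_of_real[of 1 x] by simp

lemma scaleC_ii_ii: "\<i> *\<^sub>C \<i> *\<^sub>C x = - (x::'a::complex_inner)"
  using scaleC_of_real[of "-1" x] by (simp add: scaleC_scaleC)

lemma scaleC_zero [simp]: "0 *\<^sub>C x = (0::'a::complex_inner)"
  using scaleC_of_real[of 0 x] by simp

lemma scaleC_zero_right [simp]: "c *\<^sub>C 0 = (0::'a::complex_inner)"
  using scaleC_add_right[of c 0 0] by simp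

lemma scaleC_minus_right: "c *\<^sub>C (- x) = - (c *\<^sub>C (x::'a::complex_inner))"
  using scaleC_add_right[of c x "-x"] by (simp add: eq_neg_iff_add_eq_0 add.commute)

lemma scaleC_diff_right: "c *\<^sub>C (x - y) = c *\<^sub>C x - c *\<^sub>C (y::'a::complex_inner)"
  using scaleC_add_right[of c x "- y"] by (simp add: scaleC_minus_right)

lemma scaleC_decomp: "c *\<^sub>C x = Re c *\<^sub>R x + Im c *\<^sub>R \<i> *\<^sub>C (x::'a::complex_inner)"
proof -
  have "c *\<^sub>C x = (of_real (Re c) + of_real (Im c) * \<i>) *\<^sub>C x"
    using complex_eq[of c] by (simp add: mult.commute)
  then show ?thesis
    by (simp only: scaleC_add_left scaleC_scaleC[symmetric] scaleC_of_real)
qed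

lemma inner_ii_left: "inner (\<i> *\<^sub>C x) y = - inner x (\<i> *\<^sub>C (y::'a::complex_inner))"
proof -
  have "inner (\<i> *\<^sub>C x) (\<i> *\<^sub>C \<i> *\<^sub>C y) = inner x (\<i> *\<^sub>C y)"
    by (rule inner_scaleC_ii)
  then show ?thesis by (simp add: scaleC_ii_ii)
qed

lemma inner_ii_self: "inner x (\<i> *\<^sub>C x) = 0" for x :: "'a::complex_inner"
  using inner_ii_left[of x x] by (simp add: inner_commute)

lemma Re_cinner: "Re (cinner x y) = inner x y"
  by (simp add: cinner_def)

lemma cinner_commute: "cinner x y = cnj (cinner y x)"
  using inner_ii_left[of x y] by (simp add: cinner_def complex_eq_iff inner_commute)

lemma cinner_add_left: "cinner (x + y) z = cinner x z + cinner y z"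
  by (simp add: cinner_def complex_eq_iff inner_add_left)

lemma cinner_scaleC_left: "cinner (c *\<^sub>C x) y = c * cinner x y"
  by (simp add: cinner_def complex_eq_iff scaleC_decomp[of c x] inner_add_left
      inner_ii_left scaleC_ii_ii algebra_simps)

lemma cinner_self: "cinner x x = complex_of_real ((norm x)\<^sup>2)"
  by (simp add: cinner_def complex_eq_iff inner_ii_self power2_norm_eq_inner)

lemma norm_scaleC: "norm (c *\<^sub>C x) = cmod c * norm (x::'a::complex_inner)"
proof -
  have "complex_of_real ((norm (c *\<^sub>C x))\<^sup>2) = c * cnj c * of_real ((norm x)\<^sup>2)"
    unfolding cinner_self[symmetric]
    by (subst cinner_scaleC_left, subst cinner_commute, subst cinner_scaleC_left)
      (simp add: cinner_self)
  also have "\<dots> = of_real ((cmod c * norm x)\<^sup>2)"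
    by (simp only: power_mult_distrib of_real_mult complex_norm_square)
  finally have "(norm (c *\<^sub>C x))\<^sup>2 = (cmod c * norm x)\<^sup>2"
    by (simp only: of_real_eq_iff)
  then show ?thesis
    by (simp add: power2_eq_iff_nonneg)
qed

lemma norm_scaleC_ii: "norm (\<i> *\<^sub>C x) = norm (x::'a::complex_inner)"
  by (simp add: norm_scaleC)

lemma bounded_linear_scaleC: "bounded_linear (\<lambda>x::'a::complex_inner. c *\<^sub>C x)"
  by (rule bounded_linear_intro[where K = "cmod c"])
    (simp_all add: scaleC_add_right scaleC_scaleC scaleC_of_real[symmetric] norm_scaleC mult.commute)

instantiation complex :: chilbert_space
begin
definition "scaleC_complex (c::complex) (x::complex) = c * x"
instance
  by standard (simp_all add: scaleC_complex_def algebra_simps inner_complex_def scaleR_conv_of_real)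
end

instantiation prod :: (complex_inner, complex_inner) complex_inner
begin
definition "scaleC_prod c (x :: 'a \<times> 'b) = (c *\<^sub>C fst x, c *\<^sub>C snd x)"
instance
  by standard (simp_all add: scaleC_prod_def prod_eq_iff inner_prod_def scaleC_add_right
      scaleC_add_left scaleC_scaleC scaleC_of_real inner_scaleC_ii)
end

instance prod :: (chilbert_space, chilbert_space) chilbert_space ..

section \<open>Square-summable sequences\<close>

typedef (overloaded) 'a ell2 = "{f::nat \<Rightarrow> 'a::chilbert_space. summable (\<lambda>n. (norm (f n))\<^sup>2)}"
  morphisms ell2_nth Abs_ell2
  by (rule exI[of _ "\<lambda>_. 0"]) simp

setup_lifting type_definition_ell2

lemma norm_add_sq: "(norm (x + y))\<^sup>2 \<le> 2 * (norm x)\<^sup>2 + 2 * (norm (y::'a::real_normed_vector))\<^sup>2"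
proof -
  have "(norm (x + y))\<^sup>2 \<le> (norm x + norm y)\<^sup>2"
    by (simp add: norm_triangle_ineq power_mono)
  also have "\<dots> \<le> 2 * (norm x)\<^sup>2 + 2 * (norm y)\<^sup>2"
    using zero_le_power2[of "norm x - norm y"] by (simp add: power2_eq_square algebra_simps)
  finally show ?thesis .
qed

lemma abs_inner_sq: "\<bar>inner x y\<bar> \<le> (norm x)\<^sup>2 + (norm (y::'a::real_inner))\<^sup>2"
proof -
  have "\<bar>inner x y\<bar> \<le> norm x * norm y" by (rule Cauchy_Schwarz_ineq2)
  moreover have "0 \<le> (norm x - norm y)\<^sup>2" by simp
  moreover have "0 \<le> (norm x)\<^sup>2 + (norm y)\<^sup>2" by simp
  ultimately show ?thesis by (simp add: power2_eq_square algebra_simps)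
qed

lemma summable_sq_add:
  fixes f g :: "nat \<Rightarrow> 'a::real_normed_vector"
  assumes "summable (\<lambda>n. (norm (f n))\<^sup>2)" "summable (\<lambda>n. (norm (g n))\<^sup>2)"
  shows "summable (\<lambda>n. (norm (f n + g n))\<^sup>2)"
  by (rule summable_comparison_test'[where g = "\<lambda>n. 2 * (norm (f n))\<^sup>2 + 2 * (norm (g n))\<^sup>2"])
    (use assms in \<open>auto intro!: summable_add summable_mult norm_add_sq\<close>)

lemma summable_inner:
  fixes f g :: "nat \<Rightarrow> 'a::real_inner"
  assumes "summable (\<lambda>n. (norm (f n))\<^sup>2)" "summable (\<lambda>n. (norm (g n))\<^sup>2)"
  shows "summable (\<lambda>n. inner (f n) (g n))"
  by (rule summable_comparison_test'[where g = "\<lambda>n. (norm (f n))\<^sup>2 + (norm (g n))\<^sup>2"])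
    (use assms in \<open>auto intro!: summable_add abs_inner_sq\<close>)

instantiation ell2 :: (chilbert_space) complex_inner
begin

lift_definition zero_ell2 :: "'a ell2" is "\<lambda>_. 0" by simp
lift_definition plus_ell2 :: "'a ell2 \<Rightarrow> 'a ell2 \<Rightarrow> 'a ell2" is "\<lambda>f g n. f n + g n"
  by (rule summable_sq_add)
lift_definition uminus_ell2 :: "'a ell2 \<Rightarrow> 'a ell2" is "\<lambda>f n. - f n" by simp
lift_definition minus_ell2 :: "'a ell2 \<Rightarrow> 'a ell2 \<Rightarrow> 'a ell2" is "\<lambda>f g n. f n - g n"
  using summable_sq_add[of _ "\<lambda>n. - _ n"] by simp
lift_definition scaleC_ell2 :: "complex \<Rightarrow> 'a ell2 \<Rightarrow> 'a ell2" is "\<lambda>c f n. c *\<^sub>C f n"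
  by (simp add: norm_scaleC power_mult_distrib summable_mult)
lift_definition scaleR_ell2 :: "real \<Rightarrow> 'a ell2 \<Rightarrow> 'a ell2" is "\<lambda>c f n. c *\<^sub>R f n"
  by (simp add: power_mult_distrib summable_mult)
lift_definition inner_ell2 :: "'a ell2 \<Rightarrow> 'a ell2 \<Rightarrow> real" is "\<lambda>f g. \<Sum>n. inner (f n) (g n)" .
definition norm_ell2 :: "'a ell2 \<Rightarrow> real" where "norm_ell2 x = sqrt (inner x x)"
definition dist_ell2 :: "'a ell2 \<Rightarrow> 'a ell2 \<Rightarrow> real" where "dist_ell2 x y = norm (x - y)"
definition sgn_ell2 :: "'a ell2 \<Rightarrow> 'a ell2" where "sgn_ell2 x = inverse (norm x) *\<^sub>R x"
definition uniformity_ell2 :: "('a ell2 \<times> 'a ell2) filter"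
  where "uniformity_ell2 = (INF e\<in>{0<..}. principal {(x, y). dist x y < e})"
definition open_ell2 :: "'a ell2 set \<Rightarrow> bool"
  where "open_ell2 U \<longleftrightarrow> (\<forall>x\<in>U. \<forall>\<^sub>F (x', y) in uniformity. x' = x \<longrightarrow> y \<in> U)"

instance
proof
  fix x y z :: "'a ell2" and a b :: real and c d :: complex
  show "x + y + z = x + (y + z)" "x + y = y + x" "0 + x = x" "- x + x = 0" "x - y = x + - y"
    "a *\<^sub>R (x + y) = a *\<^sub>R x + a *\<^sub>R y" "(a + b) *\<^sub>R x = a *\<^sub>R x + b *\<^sub>R x"
    "a *\<^sub>R b *\<^sub>R x = (a * b) *\<^sub>R x" "1 *\<^sub>R x = x"
    "c *\<^sub>C (x + y) = c *\<^sub>C x + c *\<^sub>C y" "(c + d) *\<^sub>C x = c *\<^sub>C x + d *\<^sub>C x"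
    "c *\<^sub>C d *\<^sub>C x = (c * d) *\<^sub>C x" "complex_of_real a *\<^sub>C x = a *\<^sub>R x"
    by (transfer; simp add: algebra_simps scaleC_add_right scaleC_add_left scaleC_scaleC scaleC_of_real)+
  show "inner x y = inner y x"
    by transfer (simp add: inner_commute)
  show "inner (x + y) z = inner x z + inner y z"
    by transfer (simp add: inner_add_left suminf_add summable_inner)
  show "inner (a *\<^sub>R x) y = a * inner x y"
    by transfer (simp add: suminf_mult summable_inner)
  show "inner (\<i> *\<^sub>C x) (\<i> *\<^sub>C y) = inner x y"
    by transfer (simp add: inner_scaleC_ii)
  show "0 \<le> inner x x"
    by transfer (simp add: suminf_nonneg summable_inner)
  show "(inner x x = 0) = (x = 0)"
    by transfer (auto simp: suminf_eq_zero_iff summable_inner)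
qed (simp_all add: norm_ell2_def dist_ell2_def sgn_ell2_def uniformity_ell2_def open_ell2_def)

end

lemma norm_ell2_sq: "(norm x)\<^sup>2 = (\<Sum>n. (norm (ell2_nth x n))\<^sup>2)"
  unfolding power2_norm_eq_inner by transfer simp

lemma summable_ell2: "summable (\<lambda>n. (norm (ell2_nth x n))\<^sup>2)"
  by transfer simp

lemma norm_ell2_nth_le: "norm (ell2_nth x n) \<le> norm x"
proof -
  have "(norm (ell2_nth x n))\<^sup>2 \<le> (norm x)\<^sup>2"
    unfolding norm_ell2_sq using sum_le_suminf[OF summable_ell2[of x], of "{n}"] by simp
  then show ?thesis by (simp add: power2_le_iff_abs_le)
qed

instance ell2 :: (chilbert_space) chilbert_space
proof
  fix X :: "nat \<Rightarrow> 'a ell2"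
  assume X: "Cauchy X"
  have C: "\<exists>N. \<forall>m\<ge>N. \<forall>n\<ge>N. norm (X m - X n) < e" if "e > 0" for e
    using X that unfolding Cauchy_def dist_norm by blast
  have nth_diff: "ell2_nth (x - y) k = ell2_nth x k - ell2_nth y k" for x y :: "'a ell2" and k
    by transfer simp
  have "convergent (\<lambda>m. ell2_nth (X m) k)" for k
  proof (rule Cauchy_convergent, rule CauchyI)
    fix e :: real assume "e > 0"
    from C[OF this] obtain N where "\<forall>m\<ge>N. \<forall>n\<ge>N. norm (X m - X n) < e" by blast
    then show "\<exists>N. \<forall>m\<ge>N. \<forall>n\<ge>N. norm (ell2_nth (X m) k - ell2_nth (X n) k) < e"
      by (metis nth_diff norm_ell2_nth_le order_le_less_trans)
  qed
  then obtain f where f: "\<And>k. (\<lambda>m. ell2_nth (X m) k) \<longlonglongrightarrow> f k"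
    unfolding convergent_def by metis
  have bound: "\<exists>N. \<forall>m\<ge>N. \<forall>K. (\<Sum>k<K. (norm (ell2_nth (X m) k - f k))\<^sup>2) \<le> e\<^sup>2" if "e > 0" for e
  proof -
    from C[OF that] obtain N where N: "\<And>m n. m \<ge> N \<Longrightarrow> n \<ge> N \<Longrightarrow> norm (X m - X n) < e" by blast
    have "(\<Sum>k<K. (norm (ell2_nth (X m) k - f k))\<^sup>2) \<le> e\<^sup>2" if "m \<ge> N" for m K
    proof (rule LIMSEQ_le_const2)
      show "(\<lambda>n. \<Sum>k<K. (norm (ell2_nth (X m) k - ell2_nth (X n) k))\<^sup>2)
          \<longlonglongrightarrow> (\<Sum>k<K. (norm (ell2_nth (X m) k - f k))\<^sup>2)"
        by (intro tendsto_intros f)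
      have "(\<Sum>k<K. (norm (ell2_nth (X m) k - ell2_nth (X n) k))\<^sup>2) \<le> e\<^sup>2" if "n \<ge> N" for n
      proof -
        have "(\<Sum>k<K. (norm (ell2_nth (X m - X n) k))\<^sup>2) \<le> (norm (X m - X n))\<^sup>2"
          unfolding norm_ell2_sq by (rule sum_le_suminf) (auto simp: summable_ell2)
        also have "\<dots> \<le> e\<^sup>2"
          using N[OF \<open>m \<ge> N\<close> that] by (intro power_mono) auto
        finally show ?thesis by (simp add: nth_diff)
      qed
      then show "\<exists>N. \<forall>n\<ge>N. (\<Sum>k<K. (norm (ell2_nth (X m) k - ell2_nth (X n) k))\<^sup>2) \<le> e\<^sup>2"
        by blast
    qed
    then show ?thesis by blast
  qed
  have sm: "summable (\<lambda>k. (norm (ell2_nth (X m) k - f k))\<^sup>2)"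
    if "\<And>K. (\<Sum>k<K. (norm (ell2_nth (X m) k - f k))\<^sup>2) \<le> e" for m e
    by (rule summableI_nonneg_bounded[where x = e]) (use that in auto)
  obtain N1 where "\<And>K. (\<Sum>k<K. (norm (ell2_nth (X N1) k - f k))\<^sup>2) \<le> 1\<^sup>2"
    using bound[of 1] by auto
  from summable_sq_add[OF summable_ell2[of "X N1"], of "\<lambda>k. - (ell2_nth (X N1) k - f k)"] sm[OF this]
  have sf: "summable (\<lambda>k. (norm (f k))\<^sup>2)"
    by (simp add: norm_minus_commute)
  define F where "F = Abs_ell2 f"
  have F: "ell2_nth F = f"
    unfolding F_def by (rule Abs_ell2_inverse) (simp add: sf)
  have "X \<longlonglongrightarrow> F"
  proof (rule LIMSEQ_I)
    fix r :: real assume "r > 0"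
    then obtain N where N: "\<And>m K. m \<ge> N \<Longrightarrow> (\<Sum>k<K. (norm (ell2_nth (X m) k - f k))\<^sup>2) \<le> (r/2)\<^sup>2"
      using bound[of "r/2"] by auto
    have "norm (X m - F) < r" if "m \<ge> N" for m
    proof -
      have "(norm (X m - F))\<^sup>2 \<le> (r/2)\<^sup>2"
        unfolding norm_ell2_sq nth_diff F
        by (rule suminf_le_const[OF sm N]) (use N that in auto)
      then have "norm (X m - F) \<le> r/2"
        using \<open>r > 0\<close> by (simp add: power2_le_iff_abs_le)
      then show ?thesis using \<open>r > 0\<close> by simp
    qed
    then show "\<exists>no. \<forall>n\<ge>no. norm (X n - F) < r" by blast
  qed
  then show "convergent X" by (rule convergentI)
qed

section \<open>Square-integrable functions on the circle\<close>

text \<open>The unit circle is parametrized by \<open>t \<in> [0, 2\<pi>)\<close>, with measure \<open>dt/2\<pi>\<close>.\<close>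

definition circle_measure :: "real measure"
  where "circle_measure = uniform_measure lborel {0..<2 * pi}"

lemma space_circle_measure [simp]: "space circle_measure = UNIV"
  and sets_circle_measure [simp, measurable_cong]: "sets circle_measure = sets borel"
  by (simp_all add: circle_measure_def)

lemma emeasure_circle_UNIV: "emeasure circle_measure UNIV = 1"
  by (simp add: circle_measure_def ennreal_divide_self)

interpretation circle: finite_measure circle_measure
  by standard (simp add: emeasure_circle_UNIV)

text \<open>Bochner measurability; unlike Borel measurability it is stable under sums also when the
  values lie in a nonseparable space.\<close>

definition strongly_measurable :: "'b measure \<Rightarrow> ('b \<Rightarrow> 'a::topological_space) \<Rightarrow> bool"
  where "strongly_measurable M f \<longleftrightarrow>
    (\<exists>s. (\<forall>n. simple_function M (s n)) \<and> (\<forall>x\<in>space M. (\<lambda>n. s n x) \<longlonglongrightarrow> f x))"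

definition square_integrable :: "(real \<Rightarrow> 'a::chilbert_space) \<Rightarrow> bool"
  where "square_integrable f \<longleftrightarrow> strongly_measurable circle_measure f \<and>
    integrable circle_measure (\<lambda>t. (norm (f t))\<^sup>2)"

lemma strongly_measurable_simple: "simple_function M f \<Longrightarrow> strongly_measurable M f"
  unfolding strongly_measurable_def by (rule exI[of _ "\<lambda>_. f"]) simp

lemma strongly_measurable_compose2:
  assumes "strongly_measurable M f" "strongly_measurable M g"
    and cont: "continuous_on UNIV (\<lambda>p. h (fst p) (snd p))"
  shows "strongly_measurable M (\<lambda>x. h (f x) (g x))"
proof -
  obtain s where s: "\<forall>n. simple_function M (s n)" "\<forall>x\<in>space M. (\<lambda>n. s n x) \<longlonglongrightarrow> f x"
    using assms(1) unfolding strongly_measurable_def by blast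
  obtain u where u: "\<forall>n. simple_function M (u n)" "\<forall>x\<in>space M. (\<lambda>n. u n x) \<longlonglongrightarrow> g x"
    using assms(2) unfolding strongly_measurable_def by blast
  have 1: "(\<lambda>n. h (s n x) (u n x)) \<longlonglongrightarrow> h (f x) (g x)" if "x \<in> space M" for x
  proof -
    have "(\<lambda>n. (s n x, u n x)) \<longlonglongrightarrow> (f x, g x)"
      using s(2) u(2) that by (intro tendsto_Pair) blast+
    from continuous_on_tendsto_compose[OF cont this] show ?thesis
      by simp
  qed
  have 2: "simple_function M (\<lambda>x. h (s n x) (u n x))" for n
    by (rule simple_function_compose2[OF s(1)[rule_format] u(1)[rule_format]])
  show ?thesis
    unfolding strongly_measurable_def using 1 2 by (intro exI[of _ "\<lambda>n x. h (s n x) (u n x)"]) blast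
qed

lemma strongly_measurable_borel:
  fixes f :: "'b \<Rightarrow> 'a::metric_space"
  assumes "strongly_measurable M f"
  shows "f \<in> borel_measurable M"
proof -
  obtain s where s: "\<forall>n. simple_function M (s n)" "\<forall>x\<in>space M. (\<lambda>n. s n x) \<longlonglongrightarrow> f x"
    using assms(1) unfolding strongly_measurable_def by blast
  show ?thesis
    by (rule borel_measurable_LIMSEQ_metric[OF borel_measurable_simple_function[OF s(1)[rule_format]] s(2)[rule_format]])
qed

lemma square_integrable_add:
  assumes "square_integrable f" "square_integrable g"
  shows "square_integrable (\<lambda>t. f t + g t)"
proof -
  have sm: "strongly_measurable circle_measure (\<lambda>t. f t + g t)"
    using assms unfolding square_integrable_def
    by (intro strongly_measurable_compose2[where h = "(+)"]) (auto intro!: continuous_intros)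
  have "integrable circle_measure (\<lambda>t. (norm (f t + g t))\<^sup>2)"
    by (rule Bochner_Integration.integrable_bound[where f = "\<lambda>t. 2 * (norm (f t))\<^sup>2 + 2 * (norm (g t))\<^sup>2"])
      (use assms strongly_measurable_borel[OF sm] in
        \<open>auto simp: square_integrable_def intro!: order_trans[OF norm_add_sq]\<close>)
  with sm show ?thesis by (simp add: square_integrable_def)
qed

lemma square_integrable_scaleC_fun:
  assumes "square_integrable f" and c: "\<And>t. cmod (c t) \<le> B"
    and cm: "strongly_measurable circle_measure c"
  shows "square_integrable (\<lambda>t::real. c t *\<^sub>C f t)"
proof -
  have cont: "continuous_on UNIV (\<lambda>p::complex \<times> 'a. fst p *\<^sub>C snd p)"
    by (subst scaleC_decomp)
      (intro continuous_intros bounded_linear.continuous_on[OF bounded_linear_scaleC])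
  have sm: "strongly_measurable circle_measure (\<lambda>t. c t *\<^sub>C f t)"
    using assms cont unfolding square_integrable_def
    by (intro strongly_measurable_compose2[where h = "(*\<^sub>C)"]) auto
  have "integrable circle_measure (\<lambda>t. (norm (c t *\<^sub>C f t))\<^sup>2)"
  proof (rule Bochner_Integration.integrable_bound[where f = "\<lambda>t. B\<^sup>2 * (norm (f t))\<^sup>2"])
    show "(\<lambda>t. (norm (c t *\<^sub>C f t))\<^sup>2) \<in> borel_measurable circle_measure"
      using strongly_measurable_borel[OF sm] by measurable
    show "AE t in circle_measure. norm ((norm (c t *\<^sub>C f t))\<^sup>2) \<le> norm (B\<^sup>2 * (norm (f t))\<^sup>2)"
      using c by (intro AE_I2) (auto simp: norm_scaleC power_mult_distrib intro!: mult_right_mono power_mono)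
  qed (use assms in \<open>auto simp: square_integrable_def\<close>)
  with sm show ?thesis by (simp add: square_integrable_def)
qed

lemma square_integrable_scaleC:
  "square_integrable f \<Longrightarrow> square_integrable (\<lambda>t. c *\<^sub>C f t)"
  by (rule square_integrable_scaleC_fun[where B = "cmod c"]) (auto intro: strongly_measurable_simple)

lemma square_integrable_scaleR:
  "square_integrable f \<Longrightarrow> square_integrable (\<lambda>t. c *\<^sub>R f t)"
  using square_integrable_scaleC[of f "complex_of_real c"] by (simp add: scaleC_of_real)

lemma square_integrable_minus: "square_integrable f \<Longrightarrow> square_integrable (\<lambda>t. - f t)"
  using square_integrable_scaleR[of f "-1"] by simp

lemma square_integrable_diff:
  "square_integrable f \<Longrightarrow> square_integrable g \<Longrightarrow> square_integrable (\<lambda>t. f t - g t)"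
  using square_integrable_add[of f "\<lambda>t. - g t"] square_integrable_minus[of g] by simp

lemma integrable_inner:
  assumes "square_integrable f" "square_integrable g"
  shows "integrable circle_measure (\<lambda>t. inner (f t) (g t))"
proof (rule Bochner_Integration.integrable_bound[where f = "\<lambda>t. (norm (f t))\<^sup>2 + (norm (g t))\<^sup>2"])
  have "strongly_measurable circle_measure (\<lambda>t. inner (f t) (g t))"
    using assms unfolding square_integrable_def
    by (intro strongly_measurable_compose2[where h = inner]) (auto intro!: continuous_intros)
  then show "(\<lambda>t. inner (f t) (g t)) \<in> borel_measurable circle_measure"
    by (rule strongly_measurable_borel)
  show "AE t in circle_measure. norm (inner (f t) (g t)) \<le> norm ((norm (f t))\<^sup>2 + (norm (g t))\<^sup>2)"
    by (simp add: abs_inner_sq)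
qed (use assms in \<open>simp add: square_integrable_def\<close>)

definition L2_eq :: "(real \<Rightarrow> 'a::chilbert_space) \<Rightarrow> (real \<Rightarrow> 'a) \<Rightarrow> bool"
  where "L2_eq f g \<longleftrightarrow> square_integrable f \<and> square_integrable g \<and>
    (AE t in circle_measure. f t = g t)"

lemma L2_eq_inner:
  assumes "L2_eq f f'" "L2_eq g g'"
  shows "(LINT t|circle_measure. inner (f t) (g t)) = (LINT t|circle_measure. inner (f' t) (g' t))"
proof (rule integral_cong_AE)
  show "AE t in circle_measure. inner (f t) (g t) = inner (f' t) (g' t)"
    using assms unfolding L2_eq_def by (auto elim!: AE_mp)
qed (use assms in \<open>auto simp only: L2_eq_def intro!: borel_measurable_integrable integrable_inner\<close>)

lemma square_integrable_zero: "square_integrable (\<lambda>_. 0)"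
  by (simp add: square_integrable_def strongly_measurable_simple)

quotient_type (overloaded) 'a L2circle = "real \<Rightarrow> 'a::chilbert_space" / partial: L2_eq
proof (rule part_equivpI)
  show "\<exists>f::real \<Rightarrow> 'a. L2_eq f f"
    by (rule exI[of _ "\<lambda>_. 0"]) (simp add: L2_eq_def square_integrable_zero)
  show "symp (L2_eq :: (real \<Rightarrow> 'a) \<Rightarrow> _)"
    by (rule sympI) (auto simp: L2_eq_def)
  show "transp (L2_eq :: (real \<Rightarrow> 'a) \<Rightarrow> _)"
    by (rule transpI) (auto simp: L2_eq_def elim: AE_mp)
qed

instantiation L2circle :: (chilbert_space) complex_inner
begin

lift_definition zero_L2circle :: "'a L2circle" is "\<lambda>_. 0"
  by (simp add: L2_eq_def square_integrable_zero)
lift_definition plus_L2circle :: "'a L2circle \<Rightarrow> 'a L2circle \<Rightarrow> 'a L2circle" is "\<lambda>f g t. f t + g t"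
  by (auto simp: L2_eq_def square_integrable_add)
lift_definition uminus_L2circle :: "'a L2circle \<Rightarrow> 'a L2circle" is "\<lambda>f t. - f t"
  by (auto simp: L2_eq_def square_integrable_minus)
lift_definition minus_L2circle :: "'a L2circle \<Rightarrow> 'a L2circle \<Rightarrow> 'a L2circle" is "\<lambda>f g t. f t - g t"
  by (auto simp: L2_eq_def square_integrable_diff)
lift_definition scaleC_L2circle :: "complex \<Rightarrow> 'a L2circle \<Rightarrow> 'a L2circle" is "\<lambda>c f t. c *\<^sub>C f t"
  by (auto simp: L2_eq_def square_integrable_scaleC)
lift_definition scaleR_L2circle :: "real \<Rightarrow> 'a L2circle \<Rightarrow> 'a L2circle" is "\<lambda>c f t. c *\<^sub>R f t"
  by (auto simp: L2_eq_def square_integrable_scaleR)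
lift_definition inner_L2circle :: "'a L2circle \<Rightarrow> 'a L2circle \<Rightarrow> real"
  is "\<lambda>f g. integral\<^sup>L circle_measure (\<lambda>t. inner (f t) (g t))"
  by (rule L2_eq_inner)
definition norm_L2circle :: "'a L2circle \<Rightarrow> real" where "norm_L2circle x = sqrt (inner x x)"
definition dist_L2circle :: "'a L2circle \<Rightarrow> 'a L2circle \<Rightarrow> real" where "dist_L2circle x y = norm (x - y)"
definition sgn_L2circle :: "'a L2circle \<Rightarrow> 'a L2circle" where "sgn_L2circle x = inverse (norm x) *\<^sub>R x"
definition uniformity_L2circle :: "('a L2circle \<times> 'a L2circle) filter"
  where "uniformity_L2circle = (INF e\<in>{0<..}. principal {(x, y). dist x y < e})"
definition open_L2circle :: "'a L2circle set \<Rightarrow> bool"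
  where "open_L2circle U \<longleftrightarrow> (\<forall>x\<in>U. \<forall>\<^sub>F (x', y) in uniformity. x' = x \<longrightarrow> y \<in> U)"

instance
proof
  fix x y z :: "'a L2circle" and a b :: real and c d :: complex
  show "x + y + z = x + (y + z)" "x + y = y + x" "0 + x = x" "- x + x = 0" "x - y = x + - y"
    "a *\<^sub>R (x + y) = a *\<^sub>R x + a *\<^sub>R y" "(a + b) *\<^sub>R x = a *\<^sub>R x + b *\<^sub>R x"
    "a *\<^sub>R b *\<^sub>R x = (a * b) *\<^sub>R x" "1 *\<^sub>R x = x"
    "c *\<^sub>C (x + y) = c *\<^sub>C x + c *\<^sub>C y" "(c + d) *\<^sub>C x = c *\<^sub>C x + d *\<^sub>C x"
    "c *\<^sub>C d *\<^sub>C x = (c * d) *\<^sub>C x" "complex_of_real a *\<^sub>C x = a *\<^sub>R x"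
    by (transfer; simp add: L2_eq_def algebra_simps scaleC_add_right scaleC_add_left scaleC_scaleC scaleC_of_real
        square_integrable_add square_integrable_minus square_integrable_zero square_integrable_scaleR square_integrable_scaleC
        square_integrable_diff)+
  show "inner x y = inner y x"
    by transfer (simp add: inner_commute)
  show "inner (x + y) z = inner x z + inner y z"
    by transfer (simp add: L2_eq_def inner_add_left integrable_inner)
  show "inner (a *\<^sub>R x) y = a * inner x y"
    by transfer (simp add: L2_eq_def)
  show "inner (\<i> *\<^sub>C x) (\<i> *\<^sub>C y) = inner x y"
    by transfer (simp add: inner_scaleC_ii)
  show "0 \<le> inner x x"
    by transfer simp
  show "(inner x x = 0) = (x = 0)"
    by transfer (simp add: L2_eq_def square_integrable_zero integral_nonneg_eq_0_iff_AE integrable_inner)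
qed (simp_all add: norm_L2circle_def dist_L2circle_def sgn_L2circle_def uniformity_L2circle_def open_L2circle_def)

end

lemma norm_L2circle_abs:
  assumes "square_integrable f"
  shows "(norm (abs_L2circle f))\<^sup>2 = (LINT t|circle_measure. (norm (f t))\<^sup>2)"
proof -
  have "L2_eq f f" using assms by (simp add: L2_eq_def)
  then show ?thesis
    by (simp add: power2_norm_eq_inner inner_L2circle.abs_eq)
qed

lemma abs_L2circle_diff:
  assumes "square_integrable f" "square_integrable g"
  shows "abs_L2circle f - abs_L2circle g = abs_L2circle (\<lambda>t. f t - g t)"
  using assms by (simp add: L2_eq_def minus_L2circle.abs_eq)

lemma rep_L2circle_square_integrable: "square_integrable (rep_L2circle x)"
  using Quotient3_rep_reflp[OF Quotient3_L2circle, of x] by (simp add: L2_eq_def)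

lemma abs_rep_L2circle: "abs_L2circle (rep_L2circle x) = x"
  by (rule Quotient3_abs_rep[OF Quotient3_L2circle])

lemma rep_abs_L2circle:
  "square_integrable f \<Longrightarrow> AE t in circle_measure. rep_L2circle (abs_L2circle f) t = f t"
  using Quotient3_rep_abs[OF Quotient3_L2circle, of f] by (simp add: L2_eq_def)

lemma square_integrable_simple:
  assumes s: "simple_function circle_measure s"
  shows "square_integrable s"
proof -
  have fin: "finite (range (\<lambda>t. (norm (s t))\<^sup>2))"
    using simple_functionD(1)[OF simple_function_compose1[OF s, of "\<lambda>x. (norm x)\<^sup>2"]] by simp
  have "integrable circle_measure (\<lambda>t. (norm (s t))\<^sup>2)"
  proof (rule circle.integrable_const_bound)
    show "AE t in circle_measure. norm ((norm (s t))\<^sup>2) \<le> Max (range (\<lambda>t. (norm (s t))\<^sup>2))"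
      using fin by (intro AE_I2) (simp add: Max_ge)
    show "(\<lambda>t. (norm (s t))\<^sup>2) \<in> borel_measurable circle_measure"
      by (rule borel_measurable_simple_function[OF simple_function_compose1[OF s]])
  qed
  then show ?thesis
    by (simp add: square_integrable_def strongly_measurable_simple[OF s])
qed

lemma L2circle_simple_dense:
  assumes "e > 0"
  shows "\<exists>s. simple_function circle_measure s \<and> norm (x - abs_L2circle s) < e"
proof -
  define f where "f = rep_L2circle x"
  have f: "square_integrable f" unfolding f_def by (rule rep_L2circle_square_integrable)
  then have fi: "integrable circle_measure (\<lambda>t. (norm (f t))\<^sup>2)"
    by (simp add: square_integrable_def)
  have fm: "f \<in> borel_measurable circle_measure"
    using f by (auto simp: square_integrable_def intro: strongly_measurable_borel)
  obtain s where s: "\<And>n. simple_function circle_measure (s n)" and lim: "\<And>t. (\<lambda>n. s n t) \<longlonglongrightarrow> f t"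
    using f unfolding square_integrable_def strongly_measurable_def by auto
  define u where "u n t = (if norm (s n t) \<le> 2 * norm (f t) then s n t else 0)" for n t
  have sm: "s n \<in> borel_measurable circle_measure" for n
    by (rule borel_measurable_simple_function[OF s])
  have u: "simple_function circle_measure (u n)" for n
    unfolding u_def
  proof (rule simple_function_If[OF s simple_function_const])
    have "(\<lambda>t. norm (s n t) - 2 * norm (f t)) \<in> borel_measurable circle_measure"
      using sm[of n] fm by measurable
    then have "{t \<in> space circle_measure. norm (s n t) - 2 * norm (f t) \<le> 0} \<in> sets circle_measure"
      by (rule borel_measurable_le) simp
    then show "{t \<in> space circle_measure. norm (s n t) \<le> 2 * norm (f t)} \<in> sets circle_measure"
      by (simp add: algebra_simps)
  qed
  have ulim: "(\<lambda>n. u n t) \<longlonglongrightarrow> f t" for t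
  proof (cases "f t = 0")
    case True
    then have "u n t = 0" for n by (simp add: u_def)
    with True show ?thesis by simp
  next
    case False
    have "(\<lambda>n. norm (s n t)) \<longlonglongrightarrow> norm (f t)" by (intro tendsto_norm lim)
    then have "\<forall>\<^sub>F n in sequentially. norm (s n t) < 2 * norm (f t)"
      using False by (intro order_tendstoD(2)) auto
    then have "\<forall>\<^sub>F n in sequentially. u n t = s n t"
      by eventually_elim (simp add: u_def)
    then show ?thesis
      using lim[of t] by (simp add: tendsto_cong)
  qed
  have ub: "norm (f t - u n t) \<le> 3 * norm (f t)" for n t
    using norm_triangle_ineq4[of "f t" "u n t"] by (auto simp: u_def)
  have sqd: "square_integrable (\<lambda>t. f t - u n t)" for n
    by (intro square_integrable_diff f square_integrable_simple u)
  have "(\<lambda>n. LINT t|circle_measure. (norm (f t - u n t))\<^sup>2) \<longlonglongrightarrow> (LINT t|circle_measure. 0)"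
  proof (rule integral_dominated_convergence[where w = "\<lambda>t. 9 * (norm (f t))\<^sup>2"])
    show "(\<lambda>t. (norm (f t - u n t))\<^sup>2) \<in> borel_measurable circle_measure" for n
      using sqd[of n] unfolding square_integrable_def by (blast intro: borel_measurable_integrable)
    show "integrable circle_measure (\<lambda>t. 9 * (norm (f t))\<^sup>2)"
      using fi by simp
    show "AE t in circle_measure. (\<lambda>n. (norm (f t - u n t))\<^sup>2) \<longlonglongrightarrow> 0"
    proof (rule AE_I2)
      fix t
      have "(\<lambda>n. (norm (f t - u n t))\<^sup>2) \<longlonglongrightarrow> (norm (f t - f t))\<^sup>2"
        by (intro tendsto_intros ulim)
      then show "(\<lambda>n. (norm (f t - u n t))\<^sup>2) \<longlonglongrightarrow> 0" by simp
    qed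
    show "AE t in circle_measure. norm ((norm (f t - u n t))\<^sup>2) \<le> 9 * (norm (f t))\<^sup>2" for n
      using power_mono[OF ub norm_ge_zero, of _ n 2] by (intro AE_I2) (simp add: power_mult_distrib)
  qed simp
  then have "\<forall>\<^sub>F n in sequentially. (LINT t|circle_measure. (norm (f t - u n t))\<^sup>2) < e\<^sup>2"
    using assms by (intro order_tendstoD(2)) auto
  then obtain n where n: "(LINT t|circle_measure. (norm (f t - u n t))\<^sup>2) < e\<^sup>2"
    using eventually_happens'[OF sequentially_bot] by blast
  have "x - abs_L2circle (u n) = abs_L2circle (\<lambda>t. f t - u n t)"
    using abs_L2circle_diff[OF f square_integrable_simple[OF u]] by (simp add: f_def abs_rep_L2circle)
  then have "(norm (x - abs_L2circle (u n)))\<^sup>2 < e\<^sup>2"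
    using n norm_L2circle_abs[OF sqd] by simp
  then have "norm (x - abs_L2circle (u n)) < e"
    by (rule power2_less_imp_less) (use assms in simp)
  with u show ?thesis by blast
qed

lemma L2circle_fast_Cauchy:
  assumes s: "\<And>n. simple_function circle_measure (s n)" and "c > 0"
    and fast: "\<And>n. norm (abs_L2circle (s (Suc n)) - abs_L2circle (s n)) \<le> c * (1/2) ^ n"
  shows "convergent (\<lambda>n. abs_L2circle (s n) :: 'a::chilbert_space L2circle)"
proof -
  define d where "d n t = norm (s (Suc n) t - s n t)" for n t
  note sq = square_integrable_simple[OF s]
  have sqd: "square_integrable (\<lambda>t. s m t - s n t)" for m n
    by (intro square_integrable_diff sq)
  have nd: "(norm (abs_L2circle (s m) - abs_L2circle (s n)))\<^sup>2 = (LINT t|circle_measure. (norm (s m t - s n t))\<^sup>2)" for m n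
    unfolding abs_L2circle_diff[OF sq sq] by (rule norm_L2circle_abs[OF sqd])
  have dm: "d n \<in> borel_measurable circle_measure" for n
    unfolding d_def by (intro borel_measurable_simple_function simple_function_compose2[OF s s])
  have dsq: "integrable circle_measure (\<lambda>t. (d n t)\<^sup>2)" for n
    using sqd unfolding square_integrable_def d_def by blast
  have dint: "(\<integral>\<^sup>+t. ennreal (d n t) \<partial>circle_measure) \<le> ennreal (c * (1/2) ^ n)" for n
  proof -
    define k where "k = c * (1/2) ^ n"
    have k: "k > 0" using \<open>c > 0\<close> by (simp add: k_def)
    have le: "d n t \<le> ((d n t)\<^sup>2 / k + k) / 2" for t
    proof -
      have "0 \<le> (d n t - k)\<^sup>2 / k" using k by simp
      also have "\<dots> = (d n t)\<^sup>2 / k + k - 2 * d n t"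
        using k by (simp add: power2_eq_square field_simps)
      finally show ?thesis by simp
    qed
    have i: "integrable circle_measure (\<lambda>t. ((d n t)\<^sup>2 / k + k) / 2)"
      using dsq by simp
    have "(\<integral>\<^sup>+t. ennreal (d n t) \<partial>circle_measure) \<le> (\<integral>\<^sup>+t. ennreal (((d n t)\<^sup>2 / k + k) / 2) \<partial>circle_measure)"
      by (intro nn_integral_mono ennreal_leI le)
    also have "\<dots> = ennreal (LINT t|circle_measure. ((d n t)\<^sup>2 / k + k) / 2)"
      using k by (intro nn_integral_eq_integral i AE_I2) auto
    also have "(LINT t|circle_measure. ((d n t)\<^sup>2 / k + k) / 2) = ((LINT t|circle_measure. (d n t)\<^sup>2) / k + k) / 2"
      using dsq emeasure_circle_UNIV by (simp add: measure_def)
    also have "(LINT t|circle_measure. (d n t)\<^sup>2) \<le> k\<^sup>2"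
      using nd[of "Suc n" n] power_mono[OF fast[of n] norm_ge_zero, of 2] by (simp add: d_def k_def)
    then have "((LINT t|circle_measure. (d n t)\<^sup>2) / k + k) / 2 \<le> (k\<^sup>2 / k + k) / 2"
      using k by (intro divide_right_mono add_right_mono) auto
    also have "\<dots> = k" using k by (simp add: power2_eq_square)
    finally show ?thesis unfolding k_def by (meson ennreal_leI order_trans)
  qed
  have "(\<integral>\<^sup>+t. (\<Sum>n. ennreal (d n t)) \<partial>circle_measure) = (\<Sum>n. \<integral>\<^sup>+t. ennreal (d n t) \<partial>circle_measure)"
    by (rule nn_integral_suminf) (use dm in measurable)
  also have "\<dots> \<le> (\<Sum>n. ennreal (c * (1/2) ^ n))"
    by (intro suminf_le dint) auto
  also have "\<dots> < \<infinity>"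
  proof -
    have "summable (\<lambda>n. c * (1/2) ^ n)" by (intro summable_mult summable_geometric) simp
    then show ?thesis
      using \<open>c > 0\<close> by (simp add: ennreal_suminf_neq_top less_top[symmetric])
  qed
  finally have "AE t in circle_measure. (\<Sum>n. ennreal (d n t)) \<noteq> \<infinity>"
    by (intro nn_integral_noteq_infinite) (use dm in \<open>auto intro!: borel_measurable_suminf\<close>)
  then have "AE t in circle_measure. convergent (\<lambda>n. s n t)"
  proof (rule AE_mp, intro AE_I2 impI)
    fix t assume "(\<Sum>n. ennreal (d n t)) \<noteq> \<infinity>"
    then have "summable (\<lambda>n. d n t)"
      by (intro summable_suminf_not_top) (auto simp: d_def)
    then have "summable (\<lambda>n. s (Suc n) t - s n t)"
      unfolding d_def by (rule summable_norm_cancel)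
    then have "convergent (\<lambda>n. \<Sum>k<n. s (Suc k) t - s k t)"
      by (simp add: summable_iff_convergent)
    then have "convergent (\<lambda>n. s n t - s 0 t)"
      using sum_lessThan_telescope[of "\<lambda>n. s n t"] by simp
    from convergent_add[OF this convergent_const[of "s 0 t"]] show "convergent (\<lambda>n. s n t)"
      by simp
  qed
  then obtain N where N: "N \<in> null_sets circle_measure" "\<And>t. t \<notin> N \<Longrightarrow> convergent (\<lambda>n. s n t)"
    by (auto simp: eventually_ae_filter)
  define u where "u n t = (if t \<in> N then 0 else s n t)" for n t
  have u: "simple_function circle_measure (u n)" for n
    unfolding u_def using N(1) by (intro simple_function_If_set s simple_function_const) auto
  note squ = square_integrable_simple[OF u]
  define f where "f t = lim (\<lambda>n. u n t)" for t
  have uf: "(\<lambda>n. u n t) \<longlonglongrightarrow> f t" for t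
  proof -
    have "convergent (\<lambda>n. u n t)"
      by (cases "t \<in> N") (auto simp: u_def convergent_const N(2))
    then show ?thesis unfolding f_def by (simp add: convergent_LIMSEQ_iff)
  qed
  have fs: "strongly_measurable circle_measure f"
    unfolding strongly_measurable_def using u uf by blast
  have us: "AE t in circle_measure. u n t = s n t" for n
    using AE_not_in[OF N(1)] by eventually_elim (simp add: u_def)
  have abs_us: "abs_L2circle (u n) = abs_L2circle (s n)" for n
    using us[of n] squ[of n] sq[of n]
    by (intro Quotient3_rel_abs[OF Quotient3_L2circle]) (simp add: L2_eq_def)
  have sqdu: "square_integrable (\<lambda>t. u m t - u n t)" for m n
    by (intro square_integrable_diff squ)
  have ndu: "(norm (abs_L2circle (s m) - abs_L2circle (s n)))\<^sup>2 = (LINT t|circle_measure. (norm (u m t - u n t))\<^sup>2)" for m n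
    unfolding abs_us[symmetric] abs_L2circle_diff[OF squ squ] by (rule norm_L2circle_abs[OF sqdu])
  have far: "norm (abs_L2circle (s (n + k)) - abs_L2circle (s n)) \<le> 2 * c * (1/2)^n - 2 * c * (1/2)^(n + k)" for n k
  proof (induction k)
    case (Suc k)
    have "norm (abs_L2circle (s (n + Suc k)) - abs_L2circle (s n)) \<le>
       norm (abs_L2circle (s (Suc (n + k))) - abs_L2circle (s (n + k))) + norm (abs_L2circle (s (n + k)) - abs_L2circle (s n))"
      using norm_triangle_ineq[of "abs_L2circle (s (Suc (n + k))) - abs_L2circle (s (n + k))" "abs_L2circle (s (n + k)) - abs_L2circle (s n)"]
      by simp
    also have "\<dots> \<le> c * (1/2)^(n+k) + (2 * c * (1/2)^n - 2 * c * (1/2)^(n + k))"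
      by (intro add_mono fast Suc)
    finally show ?case by simp
  qed simp
  have far': "norm (abs_L2circle (s m) - abs_L2circle (s n)) \<le> 2 * c * (1/2)^n" if "m \<ge> n" for m n
  proof -
    have "norm (abs_L2circle (s m) - abs_L2circle (s n)) \<le> 2 * c * (1/2)^n - 2 * c * (1/2)^m"
      using far[of n "m - n"] that by simp
    also have "\<dots> \<le> 2 * c * (1/2)^n" using \<open>c > 0\<close> by simp
    finally show ?thesis .
  qed
  have fatou: "(\<integral>\<^sup>+t. ennreal ((norm (f t - u n t))\<^sup>2) \<partial>circle_measure) \<le> ennreal ((2 * c * (1/2)^n)\<^sup>2)" for n
  proof -
    have "ennreal ((norm (f t - u n t))\<^sup>2) = liminf (\<lambda>m. ennreal ((norm (u m t - u n t))\<^sup>2))" for t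
      by (intro lim_imp_Liminf[symmetric] tendsto_ennrealI tendsto_intros uf) simp
    then have "(\<integral>\<^sup>+t. ennreal ((norm (f t - u n t))\<^sup>2) \<partial>circle_measure)
        = (\<integral>\<^sup>+t. liminf (\<lambda>m. ennreal ((norm (u m t - u n t))\<^sup>2)) \<partial>circle_measure)"
      by simp
    also have "\<dots> \<le> liminf (\<lambda>m. \<integral>\<^sup>+t. ennreal ((norm (u m t - u n t))\<^sup>2) \<partial>circle_measure)"
      using sqdu by (intro nn_integral_liminf measurable_compose[OF _ measurable_ennreal])
        (auto simp: square_integrable_def)
    also have "\<dots> = liminf (\<lambda>m. ennreal (LINT t|circle_measure. (norm (u m t - u n t))\<^sup>2))"
      using sqdu by (subst nn_integral_eq_integral) (auto simp: square_integrable_def)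
    also have "\<dots> \<le> ennreal ((2 * c * (1/2)^n)\<^sup>2)"
    proof (rule Liminf_le)
      show "\<forall>\<^sub>F m in sequentially. ennreal (LINT t|circle_measure. (norm (u m t - u n t))\<^sup>2) \<le> ennreal ((2 * c * (1/2)^n)\<^sup>2)"
        using eventually_ge_at_top[of n]
      proof eventually_elim
        case (elim m)
        show ?case
          unfolding ndu[symmetric] by (intro ennreal_leI power_mono far' elim norm_ge_zero)
      qed
    qed simp
    finally show ?thesis .
  qed
  have sfu: "square_integrable (\<lambda>t. f t - u n t)" for n
  proof -
    have sm: "strongly_measurable circle_measure (\<lambda>t. f t - u n t)"
      by (intro strongly_measurable_compose2[OF fs strongly_measurable_simple[OF u], where h = "(-)"])
        (intro continuous_intros)
    moreover have "integrable circle_measure (\<lambda>t. (norm (f t - u n t))\<^sup>2)"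
    proof (rule integrableI_bounded)
      show "(\<lambda>t. (norm (f t - u n t))\<^sup>2) \<in> borel_measurable circle_measure"
        using strongly_measurable_borel[OF sm] by measurable
      show "(\<integral>\<^sup>+t. ennreal (norm ((norm (f t - u n t))\<^sup>2)) \<partial>circle_measure) < \<infinity>"
        using fatou[of n] by (auto intro: order_le_less_trans)
    qed
    ultimately show ?thesis by (simp add: square_integrable_def)
  qed
  have sqf: "square_integrable f"
    using square_integrable_add[OF sfu squ, of 0 0] by simp
  have close: "norm (abs_L2circle (s n) - abs_L2circle f) \<le> 2 * c * (1/2)^n" for n
  proof -
    have "(norm (abs_L2circle f - abs_L2circle (s n)))\<^sup>2 = (LINT t|circle_measure. (norm (f t - u n t))\<^sup>2)"
      unfolding abs_us[symmetric] abs_L2circle_diff[OF sqf squ] by (rule norm_L2circle_abs[OF sfu])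
    also have "ennreal \<dots> = (\<integral>\<^sup>+t. ennreal ((norm (f t - u n t))\<^sup>2) \<partial>circle_measure)"
      using sfu[of n] by (subst nn_integral_eq_integral) (auto simp: square_integrable_def)
    then have "(LINT t|circle_measure. (norm (f t - u n t))\<^sup>2) \<le> (2 * c * (1/2)^n)\<^sup>2"
      using fatou[of n] by (metis ennreal_le_iff zero_le_power2)
    finally have "norm (abs_L2circle f - abs_L2circle (s n)) \<le> 2 * c * (1/2)^n"
      by (rule power2_le_imp_le) (use \<open>c > 0\<close> in simp)
    then show ?thesis by (simp add: norm_minus_commute)
  qed
  have "(\<lambda>n. 2 * c * (1/2)^n) \<longlonglongrightarrow> 2 * c * 0"
    by (intro tendsto_mult tendsto_const LIMSEQ_realpow_zero) auto
  then have "(\<lambda>n. 2 * c * (1/2)^n) \<longlonglongrightarrow> 0" by simp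
  from Lim_null_comparison[OF always_eventually this, of "\<lambda>n. abs_L2circle (s n) - abs_L2circle f"] close
  have "(\<lambda>n. abs_L2circle (s n) - abs_L2circle f) \<longlonglongrightarrow> 0" by blast
  then have "(\<lambda>n. abs_L2circle (s n)) \<longlonglongrightarrow> abs_L2circle f"
    by (simp only: LIM_zero_iff)
  then show ?thesis by (rule convergentI)
qed

instance L2circle :: (chilbert_space) chilbert_space
proof
  fix X :: "nat \<Rightarrow> 'a L2circle"
  assume X: "Cauchy X"
  have "\<exists>N. \<forall>m\<ge>N. \<forall>n\<ge>N. norm (X m - X n) < (1/2)^k" for k
    using X unfolding Cauchy_def dist_norm by (auto dest: spec[of _ "(1/2)^k"])
  then obtain N where N: "\<And>k m n. m \<ge> N k \<Longrightarrow> n \<ge> N k \<Longrightarrow> norm (X m - X n) < (1/2)^k"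
    by metis
  define r where "r k = k + (\<Sum>i\<le>k. N i)" for k
  have r: "strict_mono r"
    unfolding strict_mono_Suc_iff r_def by simp
  have rN: "r k \<ge> N k" for k
    unfolding r_def by (simp add: sum.remove[of "{..k}" k])
  have "\<exists>s. simple_function circle_measure s \<and> norm (X (r k) - abs_L2circle s) < (1/2)^k" for k
    by (rule L2circle_simple_dense) simp
  then obtain s where s: "\<And>k. simple_function circle_measure (s k)"
    and sX: "\<And>k. norm (X (r k) - abs_L2circle (s k)) < (1/2)^k"
    by metis
  have "convergent (\<lambda>k. abs_L2circle (s k))"
  proof (rule L2circle_fast_Cauchy[OF s, where c = 3])
    fix k
    have "norm (abs_L2circle (s (Suc k)) - abs_L2circle (s k)) =
      norm ((X (r (Suc k)) - X (r k)) - (X (r (Suc k)) - abs_L2circle (s (Suc k))) + (X (r k) - abs_L2circle (s k)))"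
      by simp
    also have "\<dots> \<le> norm (X (r (Suc k)) - X (r k)) + norm (X (r (Suc k)) - abs_L2circle (s (Suc k))) + norm (X (r k) - abs_L2circle (s k))"
      by (intro norm_triangle_le add_right_mono norm_triangle_ineq4)
    also have "\<dots> \<le> (1/2)^k + (1/2)^Suc k + (1/2)^k"
      using strict_monoD[OF r, of k "Suc k"] rN[of k]
      by (intro add_mono less_imp_le[OF sX] less_imp_le[OF N]) auto
    also have "\<dots> \<le> 3 * (1/2)^k" by simp
    finally show "norm (abs_L2circle (s (Suc k)) - abs_L2circle (s k)) \<le> 3 * (1/2)^k" .
  qed simp
  then obtain l where l: "(\<lambda>k. abs_L2circle (s k)) \<longlonglongrightarrow> l" by (auto simp: convergent_def)
  have "(\<lambda>k. X (r k) - abs_L2circle (s k)) \<longlonglongrightarrow> 0"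
    by (rule Lim_null_comparison[where g = "\<lambda>k. (1/2)^k"])
      (use sX in \<open>auto intro!: always_eventually less_imp_le LIMSEQ_realpow_zero\<close>)
  from tendsto_add[OF this l] have "(X \<circ> r) \<longlonglongrightarrow> l" by (simp add: o_def)
  from Cauchy_converges_subseq[OF X r this] show "convergent X" by (rule convergentI)
qed

section \<open>Vector-valued Hardy space\<close>

text \<open>The value \<open>0\<close> outside the disc makes the series determine a unique function on the whole
  type.\<close>

definition hardy_series :: "'a::chilbert_space ell2 \<Rightarrow> complex \<Rightarrow> 'a"
  where "hardy_series a z = (if cmod z < 1 then \<Sum>n. z ^ n *\<^sub>C ell2_nth a n else 0)"

lemma summable_hardy_series:
  assumes "cmod z < 1"
  shows "summable (\<lambda>n. z ^ n *\<^sub>C ell2_nth a n)"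
proof (rule summable_comparison_test')
  show "summable (\<lambda>n. cmod z ^ n * norm a)"
    using assms by (intro summable_mult2 summable_geometric) simp
  show "norm (z ^ n *\<^sub>C ell2_nth a n) \<le> cmod z ^ n * norm a" for n
    by (simp add: norm_scaleC norm_power mult_left_mono norm_ell2_nth_le)
qed

lemma powser_zero_coeff:
  fixes c :: "nat \<Rightarrow> complex"
  assumes "\<And>z. cmod z < 1 \<Longrightarrow> (\<lambda>n. c n * z ^ n) sums 0"
  shows "c n = 0"
proof (induction n rule: less_induct)
  case (less m)
  have "((\<lambda>z::complex. 0) \<longlongrightarrow> c (0 + m)) (at 0)"
  proof (rule powser_limit_0_strong[where s = 1 and a = "\<lambda>n. c (n + m)"])
    fix z :: complex assume z: "z \<noteq> 0" "norm z < 1"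
    have "(\<lambda>n. c (n + m) * z ^ (n + m)) sums (0 - (\<Sum>n<m. c n * z ^ n))"
      using assms z(2) by (intro sums_split_initial_segment) auto
    then have "(\<lambda>n. c (n + m) * z ^ (n + m)) sums 0"
      using less by simp
    from sums_divide[OF this, of "z ^ m"] show "(\<lambda>n. c (n + m) * z ^ n) sums 0"
      using z(1) by (simp add: power_add)
  qed simp
  then show ?case
    using tendsto_const_iff[of "at (0::complex)" 0 "c m"] by (simp add: trivial_limit_at)
qed

lemma bounded_linear_cinner_left: "bounded_linear (\<lambda>x::'a::complex_inner. cinner x y)"
proof (rule bounded_linear_intro[where K = "2 * norm y"])
  show "norm (cinner x y) \<le> norm x * (2 * norm y)" for x
  proof -
    have "norm (cinner x y) \<le> \<bar>inner x y\<bar> + \<bar>inner x (\<i> *\<^sub>C y)\<bar>"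
      using cmod_le[of "cinner x y"] by (simp add: cinner_def)
    also have "\<dots> \<le> norm x * norm y + norm x * norm (\<i> *\<^sub>C y)"
      by (intro add_mono Cauchy_Schwarz_ineq2)
    finally show ?thesis by (simp add: norm_scaleC)
  qed
qed (simp_all add: cinner_def complex_eq_iff inner_add_left)

lemma cinner_zero_left: "cinner 0 y = 0"
  by (simp add: cinner_def complex_eq_iff)

lemma inj_hardy_series: "inj (hardy_series :: 'a::chilbert_space ell2 \<Rightarrow> _)"
proof (rule injI)
  fix a b :: "'a ell2"
  assume eq: "hardy_series a = hardy_series b"
  have "inner (ell2_nth a n - ell2_nth b n) y = 0" for n y
  proof -
    have "cinner (ell2_nth a n - ell2_nth b n) y = 0"
    proof (rule powser_zero_coeff[of "\<lambda>n. cinner (ell2_nth a n - ell2_nth b n) y"])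
      fix z :: complex assume z: "cmod z < 1"
      have "(\<lambda>n. z ^ n *\<^sub>C ell2_nth c n) sums hardy_series c z" for c :: "'a ell2"
        using summable_sums[OF summable_hardy_series[OF z, of c]] z by (simp add: hardy_series_def)
      from sums_diff[OF this[of a] this[of b]]
      have "(\<lambda>n. z ^ n *\<^sub>C (ell2_nth a n - ell2_nth b n)) sums 0"
        by (simp add: eq scaleC_diff_right)
      from bounded_linear.sums[OF bounded_linear_cinner_left[of y] this]
      show "(\<lambda>n. cinner (ell2_nth a n - ell2_nth b n) y * z ^ n) sums 0"
        by (simp add: cinner_scaleC_left mult.commute cinner_zero_left)
    qed
    then show ?thesis using Re_cinner[of "ell2_nth a n - ell2_nth b n" y] by simp
  qed
  then have "ell2_nth a n = ell2_nth b n" for n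
    using inner_eq_zero_iff[of "ell2_nth a n - ell2_nth b n"] by simp
  then show "a = b"
    by (metis ell2_nth_inverse ext)
qed

text \<open>The Hilbert tensor product \<open>H\<^sup>2(\<D>) \<otimes> E\<close> is realized as the space of \<open>E\<close>-valued functions
  \<open>z \<mapsto> \<Sum>\<^sub>n z\<^sup>n a\<^sub>n\<close> with \<open>\<Sum>\<^sub>n \<parallel>a\<^sub>n\<parallel>\<^sup>2 < \<infinity>\<close>; \<open>f \<otimes> e\<close> is \<open>z \<mapsto> f(z) e\<close>.  See
  \<open>cinner_hardy_tensor\<close>, \<open>hardy_space_eq_tensor_span\<close>, \<open>hardy_map_tensor\<close> and
  \<open>hardy_mult_z_tensor\<close> below.\<close>

typedef (overloaded) 'a hardy = "range (hardy_series :: 'a::chilbert_space ell2 \<Rightarrow> _)"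
  morphisms hardy_eval Abs_hardy by blast

setup_lifting type_definition_hardy

lift_definition hardy_of_coeffs :: "'a::chilbert_space ell2 \<Rightarrow> 'a hardy" is hardy_series by blast

definition hardy_coeffs :: "'a::chilbert_space hardy \<Rightarrow> 'a ell2"
  where "hardy_coeffs = inv hardy_of_coeffs"

lemma hardy_of_coeffs_bij: "bij hardy_of_coeffs"
proof (rule bijI)
  show "inj (hardy_of_coeffs :: 'a ell2 \<Rightarrow> _)"
    by (rule injI, transfer) (rule injD[OF inj_hardy_series])
  show "surj (hardy_of_coeffs :: 'a ell2 \<Rightarrow> _)"
    unfolding surj_def by transfer blast
qed

lemma hardy_coeffs_of_coeffs [simp]: "hardy_coeffs (hardy_of_coeffs a) = a"
  by (simp add: hardy_coeffs_def hardy_of_coeffs_bij bij_is_inj)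

lemma hardy_of_coeffs_coeffs [simp]: "hardy_of_coeffs (hardy_coeffs f) = f"
  by (simp add: hardy_coeffs_def hardy_of_coeffs_bij bij_is_surj surj_f_inv_f)

lemma hardy_coeffs_inject: "hardy_coeffs f = hardy_coeffs g \<longleftrightarrow> f = g"
  by (metis hardy_of_coeffs_coeffs)

lemma hardy_eval_of_coeffs: "hardy_eval (hardy_of_coeffs a) = hardy_series a"
  by transfer simp

lemma hardy_eval_conv: "hardy_eval f = hardy_series (hardy_coeffs f)"
  by (metis hardy_eval_of_coeffs hardy_of_coeffs_coeffs)

lemma ell2_nth_add: "ell2_nth (a + b) n = ell2_nth a n + ell2_nth b n"
  and ell2_nth_diff: "ell2_nth (a - b) n = ell2_nth a n - ell2_nth b n"
  and ell2_nth_uminus: "ell2_nth (- a) n = - ell2_nth a n"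
  and ell2_nth_zero: "ell2_nth 0 n = 0"
  and ell2_nth_scaleC: "ell2_nth (c *\<^sub>C a) n = c *\<^sub>C ell2_nth a n"
  and ell2_nth_scaleR: "ell2_nth (r *\<^sub>R a) n = r *\<^sub>R ell2_nth a n"
  by (transfer; simp)+

lemma hardy_series_add: "hardy_series (a + b) = (\<lambda>z. hardy_series a z + hardy_series b z)"
  by (auto simp: hardy_series_def fun_eq_iff ell2_nth_add scaleC_add_right suminf_add summable_hardy_series)

lemma hardy_series_scaleC: "hardy_series (c *\<^sub>C a) = (\<lambda>z. c *\<^sub>C hardy_series a z)"
proof -
  have "(\<Sum>n. c *\<^sub>C z ^ n *\<^sub>C ell2_nth a n) = c *\<^sub>C (\<Sum>n. z ^ n *\<^sub>C ell2_nth a n)" if "cmod z < 1" for z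
    by (rule bounded_linear.suminf[OF bounded_linear_scaleC summable_hardy_series[OF that], symmetric])
  then show ?thesis
    by (auto simp: hardy_series_def fun_eq_iff ell2_nth_scaleC scaleC_scaleC mult.commute)
qed

lemma hardy_series_scaleR: "hardy_series (r *\<^sub>R a) = (\<lambda>z. r *\<^sub>R hardy_series a z)"
  using hardy_series_scaleC[of "complex_of_real r" a] by (simp add: scaleC_of_real)

lemma hardy_series_uminus: "hardy_series (- a) = (\<lambda>z. - hardy_series a z)"
  using hardy_series_scaleR[of "- 1" a] by simp

lemma hardy_series_diff: "hardy_series (a - b) = (\<lambda>z. hardy_series a z - hardy_series b z)"
  using hardy_series_add[of a "- b"] by (simp add: hardy_series_uminus)

lemma hardy_series_zero: "hardy_series 0 = (\<lambda>z. 0)"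
  using hardy_series_scaleR[of 0 0] by simp

instantiation hardy :: (chilbert_space) complex_inner
begin

lift_definition zero_hardy :: "'a hardy" is "\<lambda>_. 0"
  using rangeI[of hardy_series 0] by (simp add: hardy_series_zero)
lift_definition plus_hardy :: "'a hardy \<Rightarrow> 'a hardy \<Rightarrow> 'a hardy" is "\<lambda>f g z. f z + g z"
  by (auto simp flip: hardy_series_add)
lift_definition uminus_hardy :: "'a hardy \<Rightarrow> 'a hardy" is "\<lambda>f z. - f z"
  by (auto simp flip: hardy_series_uminus)
lift_definition minus_hardy :: "'a hardy \<Rightarrow> 'a hardy \<Rightarrow> 'a hardy" is "\<lambda>f g z. f z - g z"
  by (auto simp flip: hardy_series_diff)
lift_definition scaleC_hardy :: "complex \<Rightarrow> 'a hardy \<Rightarrow> 'a hardy" is "\<lambda>c f z. c *\<^sub>C f z"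
  by (auto simp flip: hardy_series_scaleC)
lift_definition scaleR_hardy :: "real \<Rightarrow> 'a hardy \<Rightarrow> 'a hardy" is "\<lambda>c f z. c *\<^sub>R f z"
  by (auto simp flip: hardy_series_scaleR)
definition inner_hardy :: "'a hardy \<Rightarrow> 'a hardy \<Rightarrow> real"
  where "inner_hardy f g = inner (hardy_coeffs f) (hardy_coeffs g)"
definition norm_hardy :: "'a hardy \<Rightarrow> real" where "norm_hardy x = sqrt (inner x x)"
definition dist_hardy :: "'a hardy \<Rightarrow> 'a hardy \<Rightarrow> real" where "dist_hardy x y = norm (x - y)"
definition sgn_hardy :: "'a hardy \<Rightarrow> 'a hardy" where "sgn_hardy x = inverse (norm x) *\<^sub>R x"
definition uniformity_hardy :: "('a hardy \<times> 'a hardy) filter"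
  where "uniformity_hardy = (INF e\<in>{0<..}. principal {(x, y). dist x y < e})"
definition open_hardy :: "'a hardy set \<Rightarrow> bool"
  where "open_hardy U \<longleftrightarrow> (\<forall>x\<in>U. \<forall>\<^sub>F (x', y) in uniformity. x' = x \<longrightarrow> y \<in> U)"

lemma hardy_of_coeffs_linear:
  "hardy_of_coeffs a + hardy_of_coeffs b = hardy_of_coeffs (a + b)"
  "hardy_of_coeffs a - hardy_of_coeffs b = hardy_of_coeffs (a - b)"
  "c *\<^sub>C hardy_of_coeffs a = hardy_of_coeffs (c *\<^sub>C a)"
  "r *\<^sub>R hardy_of_coeffs a = hardy_of_coeffs (r *\<^sub>R a)"
  "0 = hardy_of_coeffs 0"
  by (transfer; simp add: hardy_series_add hardy_series_diff hardy_series_scaleC hardy_series_scaleR hardy_series_zero)+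

lemma hardy_coeffs_linear:
  "hardy_coeffs (f + g) = hardy_coeffs f + hardy_coeffs g"
  "hardy_coeffs (f - g) = hardy_coeffs f - hardy_coeffs g"
  "hardy_coeffs (c *\<^sub>C f) = c *\<^sub>C hardy_coeffs f"
  "hardy_coeffs (r *\<^sub>R f) = r *\<^sub>R hardy_coeffs f"
  "hardy_coeffs 0 = 0"
  by (metis hardy_of_coeffs_linear hardy_of_coeffs_coeffs hardy_coeffs_of_coeffs)+

instance
proof
  fix x y z :: "'a hardy" and a b :: real and c d :: complex
  show "x + y + z = x + (y + z)" "x + y = y + x" "0 + x = x" "- x + x = 0" "x - y = x + - y"
    "a *\<^sub>R (x + y) = a *\<^sub>R x + a *\<^sub>R y" "(a + b) *\<^sub>R x = a *\<^sub>R x + b *\<^sub>R x"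
    "a *\<^sub>R b *\<^sub>R x = (a * b) *\<^sub>R x" "1 *\<^sub>R x = x"
    "c *\<^sub>C (x + y) = c *\<^sub>C x + c *\<^sub>C y" "(c + d) *\<^sub>C x = c *\<^sub>C x + d *\<^sub>C x"
    "c *\<^sub>C d *\<^sub>C x = (c * d) *\<^sub>C x" "complex_of_real a *\<^sub>C x = a *\<^sub>R x"
    by (transfer; simp add: algebra_simps scaleC_add_right scaleC_add_left scaleC_scaleC scaleC_of_real)+
  show "(inner x x = 0) = (x = 0)"
    by (metis hardy_coeffs_inject hardy_coeffs_linear(5) inner_eq_zero_iff inner_hardy_def)
  show "inner x y = inner y x"
    by (simp add: inner_hardy_def inner_commute)
qed (simp_all add: inner_hardy_def hardy_coeffs_linear inner_add_left inner_scaleC_ii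
    norm_hardy_def dist_hardy_def sgn_hardy_def uniformity_hardy_def open_hardy_def)

end

lemma norm_hardy_coeffs: "norm (hardy_coeffs f) = norm f"
  by (simp add: norm_hardy_def inner_hardy_def norm_eq_sqrt_inner)

instance hardy :: (chilbert_space) chilbert_space
proof
  fix X :: "nat \<Rightarrow> 'a hardy"
  assume "Cauchy X"
  then have "Cauchy (\<lambda>n. hardy_coeffs (X n))"
    by (simp add: Cauchy_def dist_norm hardy_coeffs_linear[symmetric] norm_hardy_coeffs)
  then obtain l where l: "(\<lambda>n. hardy_coeffs (X n)) \<longlonglongrightarrow> l"
    using Cauchy_convergent unfolding convergent_def by blast
  have "X \<longlonglongrightarrow> hardy_of_coeffs l"
  proof (rule LIMSEQ_I)
    fix r :: real assume "r > 0"
    have "norm (X n - hardy_of_coeffs l) = norm (hardy_coeffs (X n) - l)" for n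
      by (simp add: norm_hardy_coeffs[symmetric] hardy_coeffs_linear)
    then show "\<exists>no. \<forall>n\<ge>no. norm (X n - hardy_of_coeffs l) < r"
      using LIMSEQ_D[OF l \<open>r > 0\<close>] by simp
  qed
  then show "convergent X" by (rule convergentI)
qed

section \<open>Operators on closed subspaces\<close>

text \<open>
  A Hilbert space is a closed complex subspace \<open>M\<close> of a type of class
  \<^class>\<open>chilbert_space\<close>, and an operator on it is a function whose values outside \<open>M\<close>
  are irrelevant.  An \<open>m\<close>-tuple is a family indexed by \<open>nat\<close> of which only the entries
  \<open>1, \<dots>, m\<close> matter; in an \<open>n\<close>-tuple \<open>(S\<^sub>1, \<dots>, S\<^sub>n\<^sub>-\<^sub>1, P)\<close> the last entry has index \<open>n\<close>.
\<close>

definition csubspace :: "'a::complex_inner set \<Rightarrow> bool"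
  where "csubspace M \<longleftrightarrow> 0 \<in> M \<and> (\<forall>x\<in>M. \<forall>y\<in>M. x + y \<in> M) \<and> (\<forall>c. \<forall>x\<in>M. c *\<^sub>C x \<in> M)"

definition closed_csubspace :: "'a::complex_inner set \<Rightarrow> bool"
  where "closed_csubspace M \<longleftrightarrow> csubspace M \<and> closed M"

definition cspan :: "'a::complex_inner set \<Rightarrow> 'a set"
  where "cspan X = csubspace hull X"

definition bounded_op :: "'a::complex_inner set \<Rightarrow> 'b::complex_inner set \<Rightarrow> ('a \<Rightarrow> 'b) \<Rightarrow> bool"
  where "bounded_op M N T \<longleftrightarrow> (\<forall>x\<in>M. T x \<in> N) \<and>
    (\<forall>x\<in>M. \<forall>y\<in>M. T (x + y) = T x + T y) \<and> (\<forall>c. \<forall>x\<in>M. T (c *\<^sub>C x) = c *\<^sub>C T x) \<and>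
    (\<exists>K. \<forall>x\<in>M. norm (T x) \<le> K * norm x)"

definition op_norm :: "'a::complex_inner set \<Rightarrow> ('a \<Rightarrow> 'b::complex_inner) \<Rightarrow> real"
  where "op_norm M T = (SUP x\<in>{x\<in>M. norm x \<le> 1}. norm (T x))"

definition orth_proj :: "'a::complex_inner set \<Rightarrow> 'a \<Rightarrow> 'a"
  where "orth_proj M x = (THE p. p \<in> M \<and> (\<forall>m\<in>M. cinner (x - p) m = 0))"

text \<open>\<open>adjoint_on M T\<close> is the adjoint of \<open>T : M \<rightarrow> N\<close>; it depends on \<open>N\<close> only through the
  arguments it is applied to.\<close>

definition adjoint_on :: "'a::complex_inner set \<Rightarrow> ('a \<Rightarrow> 'b::complex_inner) \<Rightarrow> 'b \<Rightarrow> 'a"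
  where "adjoint_on M T y = (THE x. x \<in> M \<and> (\<forall>m\<in>M. cinner (T m) y = cinner m x))"

definition isometric_op :: "'a::complex_inner set \<Rightarrow> 'b::complex_inner set \<Rightarrow> ('a \<Rightarrow> 'b) \<Rightarrow> bool"
  where "isometric_op M N T \<longleftrightarrow> bounded_op M N T \<and> (\<forall>x\<in>M. norm (T x) = norm x)"

definition unitary_op :: "'a::complex_inner set \<Rightarrow> 'b::complex_inner set \<Rightarrow> ('a \<Rightarrow> 'b) \<Rightarrow> bool"
  where "unitary_op M N U \<longleftrightarrow> isometric_op M N U \<and> U ` M = N"

definition normal_op :: "'a::complex_inner set \<Rightarrow> ('a \<Rightarrow> 'a) \<Rightarrow> bool"
  where "normal_op M T \<longleftrightarrow> (\<forall>x\<in>M. T (adjoint_on M T x) = adjoint_on M T (T x))"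

definition reducing :: "'a::complex_inner set \<Rightarrow> ('a \<Rightarrow> 'a) \<Rightarrow> 'a set \<Rightarrow> bool"
  where "reducing M T N \<longleftrightarrow> closed_csubspace N \<and> N \<subseteq> M \<and>
    (\<forall>x\<in>N. T x \<in> N \<and> adjoint_on M T x \<in> N)"

definition cnu :: "'a::complex_inner set \<Rightarrow> ('a \<Rightarrow> 'a) \<Rightarrow> bool"
  where "cnu M P \<longleftrightarrow> (\<forall>N. reducing M P N \<and> unitary_op N N P \<longrightarrow> N = {0})"

definition positive_sqrt :: "'a::complex_inner set \<Rightarrow> ('a \<Rightarrow> 'a) \<Rightarrow> 'a \<Rightarrow> 'a"
  where "positive_sqrt M T = (THE Q. bounded_op M M Q \<and>
    (\<forall>x\<in>M. Im (cinner (Q x) x) = 0 \<and> 0 \<le> Re (cinner (Q x) x)) \<and>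
    (\<forall>x\<in>M. Q (Q x) = T x) \<and> (\<forall>x. x \<notin> M \<longrightarrow> Q x = 0))"

definition defect_op :: "'a::complex_inner set \<Rightarrow> ('a \<Rightarrow> 'a) \<Rightarrow> 'a \<Rightarrow> 'a"
  where "defect_op M P = positive_sqrt M (\<lambda>x. x - adjoint_on M P (P x))"

definition defect_space :: "'a::complex_inner set \<Rightarrow> ('a \<Rightarrow> 'a) \<Rightarrow> 'a set"
  where "defect_space M P = closure (defect_op M P ` M)"

definition orthogonal_sum :: "'a::complex_inner set \<Rightarrow> 'a set \<Rightarrow> 'a set \<Rightarrow> bool"
  where "orthogonal_sum K K1 K2 \<longleftrightarrow> closed_csubspace K1 \<and> closed_csubspace K2 \<and>
    (\<forall>x\<in>K1. \<forall>y\<in>K2. cinner x y = 0) \<and> K = {x + y | x y. x \<in> K1 \<and> y \<in> K2}"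

section \<open>Operators on the Hardy space\<close>

lift_definition ell2_shift :: "'a::chilbert_space ell2 \<Rightarrow> 'a ell2" is "\<lambda>f n. if n = 0 then 0 else f (n - 1)"
  by (subst summable_Suc_iff[symmetric]) simp

lemma hardy_series_shift: "hardy_series (ell2_shift a) = (\<lambda>z. z *\<^sub>C hardy_series a z)"
proof
  fix z
  have "(\<Sum>n. z ^ n *\<^sub>C ell2_nth (ell2_shift a) n) = z *\<^sub>C (\<Sum>n. z ^ n *\<^sub>C ell2_nth a n)" if "cmod z < 1"
  proof -
    have "(\<Sum>n. z ^ n *\<^sub>C ell2_nth (ell2_shift a) n) = (\<Sum>n. z ^ Suc n *\<^sub>C ell2_nth (ell2_shift a) (Suc n))"
      using suminf_split_head[OF summable_hardy_series[OF that, of "ell2_shift a"]]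
      by (simp add: ell2_shift.rep_eq)
    also have "\<dots> = (\<Sum>n. z *\<^sub>C z ^ n *\<^sub>C ell2_nth a n)"
      by (simp add: ell2_shift.rep_eq scaleC_scaleC)
    also have "\<dots> = z *\<^sub>C (\<Sum>n. z ^ n *\<^sub>C ell2_nth a n)"
      by (rule bounded_linear.suminf[OF bounded_linear_scaleC summable_hardy_series[OF that], symmetric])
    finally show ?thesis .
  qed
  then show "hardy_series (ell2_shift a) z = z *\<^sub>C hardy_series a z"
    by (simp add: hardy_series_def)
qed

lift_definition hardy_mult_z :: "'a::chilbert_space hardy \<Rightarrow> 'a hardy" is "\<lambda>f z. z *\<^sub>C f z"
  by (auto simp flip: hardy_series_shift)

definition hardy_space :: "'a::chilbert_space set \<Rightarrow> 'a hardy set"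
  where "hardy_space E = {f. \<forall>z. hardy_eval f z \<in> E}"

text \<open>\<open>I \<otimes> X\<close> for an operator \<open>X\<close> on \<open>E\<close>, applied to elements of \<open>hardy_space E\<close>.\<close>

definition hardy_map :: "('a::chilbert_space \<Rightarrow> 'a) \<Rightarrow> 'a hardy \<Rightarrow> 'a hardy"
  where "hardy_map X f = Abs_hardy (\<lambda>z. X (hardy_eval f z))"

definition hardy_tensor :: "complex hardy \<Rightarrow> 'a::chilbert_space \<Rightarrow> 'a hardy"
  where "hardy_tensor f e = Abs_hardy (\<lambda>z. hardy_eval f z *\<^sub>C e)"

lemma csubspaceD:
  assumes "csubspace M"
  shows "0 \<in> M" "x \<in> M \<Longrightarrow> y \<in> M \<Longrightarrow> x + y \<in> M" "x \<in> M \<Longrightarrow> c *\<^sub>C x \<in> M"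
    "x \<in> M \<Longrightarrow> - x \<in> M" "x \<in> M \<Longrightarrow> y \<in> M \<Longrightarrow> x - y \<in> M"
proof -
  show *: "0 \<in> M" "x \<in> M \<Longrightarrow> y \<in> M \<Longrightarrow> x + y \<in> M" "x \<in> M \<Longrightarrow> c *\<^sub>C x \<in> M" for x y c
    using assms by (auto simp: csubspace_def)
  show **: "x \<in> M \<Longrightarrow> - x \<in> M" for x
    using *(3)[of x "- 1"] scaleC_of_real[of "- 1" x] by simp
  show "x \<in> M \<Longrightarrow> y \<in> M \<Longrightarrow> x - y \<in> M"
    using *(2)[of x "- y"] **[of y] by simp
qed

lemma csubspace_sum:
  assumes "csubspace M" "\<And>i. i \<in> I \<Longrightarrow> f i \<in> M"
  shows "sum f I \<in> M"
  using assms(2) by (induction I rule: infinite_finite_induct) (auto intro: csubspaceD[OF assms(1)])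

lemma hardy_series_mem:
  assumes E: "closed_csubspace E" and a: "\<And>n. ell2_nth a n \<in> E"
  shows "hardy_series a z \<in> E"
proof (cases "cmod z < 1")
  case True
  have sub: "csubspace E" "closed E" using E by (auto simp: closed_csubspace_def)
  have "(\<lambda>N. \<Sum>n<N. z ^ n *\<^sub>C ell2_nth a n) \<longlonglongrightarrow> hardy_series a z"
    using summable_LIMSEQ[OF summable_hardy_series[OF True, of a]] True by (simp add: hardy_series_def)
  then show ?thesis
    by (rule closed_sequentially[OF sub(2), rotated]) (intro csubspace_sum sub csubspaceD(3) a)
next
  case False
  then show ?thesis using E by (simp add: hardy_series_def closed_csubspace_def csubspaceD)
qed

lemma summable_ell2_scale:
  fixes f :: "nat \<Rightarrow> 'a::real_normed_vector"
  assumes "\<And>n. norm (f n) \<le> K * norm (ell2_nth a n)"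
  shows "summable (\<lambda>n. (norm (f n))\<^sup>2)"
proof (rule summable_comparison_test')
  show "summable (\<lambda>n. K\<^sup>2 * (norm (ell2_nth a n))\<^sup>2)"
    by (intro summable_mult summable_ell2)
  show "norm ((norm (f n))\<^sup>2) \<le> K\<^sup>2 * (norm (ell2_nth a n))\<^sup>2" for n
    using power_mono[OF assms[of n] norm_ge_zero, of 2] by (simp add: power_mult_distrib)
qed

text \<open>The Taylor coefficients of an \<open>E\<close>-valued function are in \<open>E\<close>.\<close>

lemma hardy_coeffs_mem:
  assumes E: "closed_csubspace E" and f: "\<And>z. hardy_series a z \<in> E"
  shows "ell2_nth a m \<in> E"
proof (induction m rule: less_induct)
  case (less m)
  have sub: "csubspace E" "closed E" using E by (auto simp: closed_csubspace_def)
  define r where "r k = inverse (real (k + 2))" for k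
  define g where "g k = (\<Sum>n. complex_of_real (r k) ^ n *\<^sub>C ell2_nth a (n + m))" for k
  have r01: "0 < r k" "r k < 1" for k
    by (auto simp: r_def inverse_less_1_iff)
  have r: "0 < r k" "r k < 1" "cmod (complex_of_real (r k)) < 1" for k
    using r01[of k] by (auto simp only: norm_of_real abs_of_pos)
  have split: "hardy_series a (of_real (r k)) = complex_of_real (r k) ^ m *\<^sub>C g k + (\<Sum>n<m. complex_of_real (r k) ^ n *\<^sub>C ell2_nth a n)" for k
  proof -
    let ?z = "complex_of_real (r k)"
    have s: "summable (\<lambda>n. ?z ^ n *\<^sub>C ell2_nth a (n + m))"
    proof (rule summable_comparison_test')
      show "summable (\<lambda>n. cmod ?z ^ n * norm a)"
        using r[of k] by (intro summable_mult2 summable_geometric) simp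
      show "norm (?z ^ n *\<^sub>C ell2_nth a (n + m)) \<le> cmod ?z ^ n * norm a" for n
        by (simp add: norm_scaleC norm_power mult_left_mono norm_ell2_nth_le)
    qed
    have "hardy_series a ?z = (\<Sum>n. ?z ^ (n + m) *\<^sub>C ell2_nth a (n + m)) + (\<Sum>n<m. ?z ^ n *\<^sub>C ell2_nth a n)"
      using suminf_split_initial_segment[OF summable_hardy_series[OF r(3)[of k], of a], of m] r(3)[of k]
      by (simp add: hardy_series_def)
    also have "(\<Sum>n. ?z ^ (n + m) *\<^sub>C ell2_nth a (n + m)) = (\<Sum>n. ?z ^ m *\<^sub>C ?z ^ n *\<^sub>C ell2_nth a (n + m))"
      by (simp add: scaleC_scaleC power_add mult.commute)
    also have "\<dots> = ?z ^ m *\<^sub>C g k"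
      unfolding g_def by (rule bounded_linear.suminf[OF bounded_linear_scaleC s, symmetric])
    finally show ?thesis .
  qed
  have gE: "g k \<in> E" for k
  proof -
    let ?z = "complex_of_real (r k)"
    have "?z ^ m *\<^sub>C g k = hardy_series a ?z - (\<Sum>n<m. ?z ^ n *\<^sub>C ell2_nth a n)"
      using split[of k] by simp
    moreover have "(\<Sum>n<m. ?z ^ n *\<^sub>C ell2_nth a n) \<in> E"
      by (intro csubspace_sum sub csubspaceD(3)) (use less in auto)
    ultimately have "?z ^ m *\<^sub>C g k \<in> E"
      using f csubspaceD(5)[OF sub(1)] by metis
    then have "inverse (?z ^ m) *\<^sub>C ?z ^ m *\<^sub>C g k \<in> E"
      by (rule csubspaceD(3)[OF sub(1)])
    then show ?thesis using r(1)[of k] by (simp add: scaleC_scaleC)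
  qed
  have bound: "norm (g k - ell2_nth a m) \<le> r k * (2 * norm a)" for k
  proof -
    let ?z = "complex_of_real (r k)"
    have r2: "r k \<le> 1/2" by (simp add: r_def field_simps)
    have s: "summable (\<lambda>n. norm (?z ^ n *\<^sub>C ell2_nth a (n + m)))"
    proof (rule summable_comparison_test')
      show "summable (\<lambda>n. cmod ?z ^ n * norm a)"
        using r[of k] by (intro summable_mult2 summable_geometric) simp
      show "norm (norm (?z ^ n *\<^sub>C ell2_nth a (n + m))) \<le> cmod ?z ^ n * norm a" for n
        by (simp add: norm_scaleC norm_power mult_left_mono norm_ell2_nth_le)
    qed
    have s': "summable (\<lambda>n. norm (?z ^ Suc n *\<^sub>C ell2_nth a (Suc n + m)))"
      using s summable_Suc_iff[of "\<lambda>n. norm (?z ^ n *\<^sub>C ell2_nth a (n + m))"] by blast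
    have "g k - ell2_nth a m = (\<Sum>n. ?z ^ Suc n *\<^sub>C ell2_nth a (Suc n + m))"
      using suminf_split_head[OF summable_norm_cancel[OF s]] by (simp add: g_def)
    also have "norm \<dots> \<le> (\<Sum>n. norm (?z ^ Suc n *\<^sub>C ell2_nth a (Suc n + m)))"
      by (rule summable_norm[OF s'])
    also have "\<dots> \<le> (\<Sum>n. r k * norm a * r k ^ n)"
    proof (intro suminf_le allI)
      show "norm (?z ^ Suc n *\<^sub>C ell2_nth a (Suc n + m)) \<le> r k * norm a * r k ^ n" for n
        using norm_ell2_nth_le[of a "Suc n + m"] r(1)[of k]
        by (simp add: norm_scaleC norm_mult norm_power mult_left_mono mult_ac)
      show "summable (\<lambda>n. norm (?z ^ Suc n *\<^sub>C ell2_nth a (Suc n + m)))"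
        by (rule s')
      show "summable (\<lambda>n. r k * norm a * r k ^ n)"
        using r[of k] by (intro summable_mult summable_geometric) simp
    qed
    also have "\<dots> = r k * norm a * (1 / (1 - r k))"
      using r[of k] by (subst suminf_mult) (auto intro!: summable_geometric simp: suminf_geometric)
    also have "\<dots> \<le> r k * norm a * 2"
      using r(1)[of k] r2 by (intro mult_left_mono) (auto simp: field_simps)
    finally show ?thesis by (simp add: mult_ac)
  qed
  have r0: "(\<lambda>k. r k * (2 * norm a)) \<longlonglongrightarrow> 0"
  proof -
    have "r \<longlonglongrightarrow> 0"
      using LIMSEQ_ignore_initial_segment[OF lim_inverse_n[where 'a = real], of 2] unfolding r_def by simp
    from tendsto_mult_left_zero[OF this] show ?thesis .
  qed
  have "(\<lambda>k. g k - ell2_nth a m) \<longlonglongrightarrow> 0"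
    by (rule Lim_null_comparison[OF always_eventually[OF allI, OF bound] r0])
  then have "g \<longlonglongrightarrow> ell2_nth a m" by (simp only: LIM_zero_iff)
  then show ?case by (rule closed_sequentially[OF sub(2) gE])
qed

lemma hardy_eval_map:
  assumes E: "closed_csubspace E" and X: "bounded_op E E X" and f: "f \<in> hardy_space E"
  shows "hardy_eval (hardy_map X f) z = X (hardy_eval f z)"
proof -
  have sub: "csubspace E" using E by (simp add: closed_csubspace_def)
  define a where "a = hardy_coeffs f"
  have fa: "hardy_eval f = hardy_series a" by (simp add: a_def hardy_eval_conv)
  have fE: "hardy_series a z \<in> E" for z using f by (simp add: hardy_space_def fa)
  note aE = hardy_coeffs_mem[OF E fE]
  have "\<exists>K. \<forall>x\<in>E. norm (X x) \<le> K * norm x"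
    and add: "x \<in> E \<Longrightarrow> y \<in> E \<Longrightarrow> X (x + y) = X x + X y"
    and scale: "x \<in> E \<Longrightarrow> X (c *\<^sub>C x) = c *\<^sub>C X x" for x y c
    using X unfolding bounded_op_def by blast+
  then obtain K where K: "\<And>x. x \<in> E \<Longrightarrow> norm (X x) \<le> K * norm x"
    by blast
  define b where "b = Abs_ell2 (\<lambda>n. X (ell2_nth a n))"
  have b: "ell2_nth b n = X (ell2_nth a n)" for n
  proof -
    have "summable (\<lambda>n. (norm (X (ell2_nth a n)))\<^sup>2)"
      by (rule summable_ell2_scale[where K = K and a = a]) (rule K[OF aE])
    then show ?thesis by (simp add: b_def Abs_ell2_inverse)
  qed
  have X0: "X 0 = 0" using scale[OF csubspaceD(1)[OF sub], of 0] by simp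
  have diff: "X (x - y) = X x - X y" if "x \<in> E" "y \<in> E" for x y
    using add[of "x - y" y] that csubspaceD(5)[OF sub] by simp
  have "X (hardy_series a z) = hardy_series b z" for z
  proof (cases "cmod z < 1")
    case True
    define p where "p N = (\<Sum>n<N. z ^ n *\<^sub>C ell2_nth a n)" for N
    have pE: "p N \<in> E" for N
      unfolding p_def by (intro csubspace_sum sub csubspaceD(3) aE)
    have p: "p \<longlonglongrightarrow> hardy_series a z"
      using summable_LIMSEQ[OF summable_hardy_series[OF True, of a]] True
      by (simp add: hardy_series_def p_def[abs_def])
    have Xp: "X (p N) = (\<Sum>n<N. z ^ n *\<^sub>C ell2_nth b n)" for N
    proof (induction N)
      case (Suc N)
      have "p (Suc N) = p N + z ^ N *\<^sub>C ell2_nth a N" by (simp add: p_def)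
      then show ?case using Suc pE[of N] aE[of N]
        by (simp add: add scale csubspaceD[OF sub] b)
    qed (simp add: p_def X0)
    have q: "(\<lambda>N. X (p N)) \<longlonglongrightarrow> hardy_series b z"
      using summable_LIMSEQ[OF summable_hardy_series[OF True, of b]] True by (simp add: hardy_series_def Xp)
    have "(\<lambda>N. X (p N) - X (hardy_series a z)) \<longlonglongrightarrow> 0"
    proof (rule Lim_null_comparison[OF always_eventually])
      show "\<forall>N. norm (X (p N) - X (hardy_series a z)) \<le> K * norm (p N - hardy_series a z)"
        using K[OF csubspaceD(5)[OF sub pE fE]] by (simp add: diff[OF pE fE])
      show "(\<lambda>N. K * norm (p N - hardy_series a z)) \<longlonglongrightarrow> 0"
        using p by (intro tendsto_mult_right_zero tendsto_norm_zero) (simp only: LIM_zero_iff)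
    qed
    then have "(\<lambda>N. X (p N)) \<longlonglongrightarrow> X (hardy_series a z)" by (simp only: LIM_zero_iff)
    then show ?thesis using q LIMSEQ_unique by blast
  qed (simp add: hardy_series_def X0)
  then have "(\<lambda>z. X (hardy_eval f z)) = hardy_series b" by (simp add: fa fun_eq_iff)
  then show ?thesis
    unfolding hardy_map_def by (simp add: Abs_hardy_inverse) (simp add: fun_eq_iff)
qed

lemma hardy_eval_tensor: "hardy_eval (hardy_tensor f e) z = hardy_eval f z *\<^sub>C e"
  and hardy_coeffs_tensor: "ell2_nth (hardy_coeffs (hardy_tensor f e)) n = ell2_nth (hardy_coeffs f) n *\<^sub>C e"
proof -
  define a where "a = hardy_coeffs f"
  have fa: "hardy_eval f = hardy_series a" by (simp add: a_def hardy_eval_conv)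
  define b where "b = Abs_ell2 (\<lambda>n. ell2_nth a n *\<^sub>C e)"
  have "summable (\<lambda>n. (norm (ell2_nth a n *\<^sub>C e))\<^sup>2)"
    by (rule summable_ell2_scale[where K = "norm e" and a = a]) (simp add: norm_scaleC mult.commute)
  then have b: "ell2_nth b n = ell2_nth a n *\<^sub>C e" for n by (simp add: b_def Abs_ell2_inverse)
  have bl: "bounded_linear (\<lambda>c. c *\<^sub>C e)"
    by (rule bounded_linear_intro[where K = "norm e"])
      (simp_all add: scaleC_add_left norm_scaleC scaleR_conv_of_real scaleC_scaleC[symmetric] scaleC_of_real)
  have ser: "(\<lambda>z. hardy_eval f z *\<^sub>C e) = hardy_series b"
  proof
    fix z
    have "hardy_series a z *\<^sub>C e = (\<Sum>n. (z ^ n * ell2_nth a n) *\<^sub>C e)" if "cmod z < 1"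
      using bounded_linear.suminf[OF bl, of "\<lambda>n. z ^ n * ell2_nth a n"] summable_hardy_series[OF that, of a] that
      by (simp add: hardy_series_def scaleC_complex_def)
    then show "hardy_eval f z *\<^sub>C e = hardy_series b z"
      by (simp add: fa hardy_series_def b scaleC_scaleC)
  qed
  then have T: "hardy_tensor f e = hardy_of_coeffs b"
    by (simp add: hardy_tensor_def hardy_of_coeffs.abs_eq)
  show "hardy_eval (hardy_tensor f e) z = hardy_eval f z *\<^sub>C e"
    by (simp add: T hardy_eval_of_coeffs ser[symmetric])
  show "ell2_nth (hardy_coeffs (hardy_tensor f e)) n = ell2_nth (hardy_coeffs f) n *\<^sub>C e"
    by (simp add: T b a_def)
qed

lemma closed_csubspace_hardy_space:
  assumes E: "closed_csubspace E"
  shows "closed_csubspace (hardy_space E)"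
proof -
  have sub: "csubspace E" "closed E" using E by (auto simp: closed_csubspace_def)
  have "csubspace (hardy_space E)"
    using sub(1) by (auto simp: csubspace_def hardy_space_def zero_hardy.rep_eq plus_hardy.rep_eq scaleC_hardy.rep_eq)
  moreover have "closed (hardy_space E)"
    unfolding closed_sequential_limits
  proof (intro allI impI)
    fix x :: "nat \<Rightarrow> 'a hardy" and l assume x: "(\<forall>n. x n \<in> hardy_space E) \<and> x \<longlonglongrightarrow> l"
    have "ell2_nth (hardy_coeffs l) k \<in> E" for k
    proof (rule closed_sequentially[OF sub(2)])
      show "ell2_nth (hardy_coeffs (x n)) k \<in> E" for n
        using x by (intro hardy_coeffs_mem[OF E]) (auto simp: hardy_space_def hardy_eval_conv)
      have 1: "(\<lambda>n. norm (x n - l)) \<longlonglongrightarrow> 0"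
        using x by (intro tendsto_norm_zero) (simp add: LIM_zero_iff)
      have 2: "norm (ell2_nth (hardy_coeffs (x n)) k - ell2_nth (hardy_coeffs l) k) \<le> norm (x n - l)" for n
        using norm_ell2_nth_le[of "hardy_coeffs (x n - l)" k]
        by (simp add: hardy_coeffs_linear ell2_nth_diff norm_hardy_coeffs[symmetric])
      have "(\<lambda>n. ell2_nth (hardy_coeffs (x n)) k - ell2_nth (hardy_coeffs l) k) \<longlonglongrightarrow> 0"
        by (rule Lim_null_comparison[OF always_eventually[OF allI, OF 2] 1])
      then show "(\<lambda>n. ell2_nth (hardy_coeffs (x n)) k) \<longlonglongrightarrow> ell2_nth (hardy_coeffs l) k"
        by (simp only: LIM_zero_iff)
    qed
    then show "l \<in> hardy_space E"
      by (simp add: hardy_space_def hardy_eval_conv hardy_series_mem[OF E])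
  qed
  ultimately show ?thesis by (simp add: closed_csubspace_def)
qed

lemma csubspace_cspan: "csubspace (cspan X)"
  unfolding cspan_def by (rule hull_in) (auto simp: csubspace_def)

lemma cspan_superset: "X \<subseteq> cspan X"
  unfolding cspan_def by (rule hull_subset)

lemma cspan_minimal: "X \<subseteq> M \<Longrightarrow> csubspace M \<Longrightarrow> cspan X \<subseteq> M"
  unfolding cspan_def by (rule hull_minimal)

lemma cinner_ell2_sums: "(\<lambda>n. cinner (ell2_nth a n) (ell2_nth b n)) sums cinner a b"
proof -
  have "(\<lambda>n. inner (ell2_nth a n) (ell2_nth b n)) sums inner a b" for a b :: "'a ell2"
    using summable_sums[OF summable_inner[OF summable_ell2 summable_ell2, of a b]]
    by (simp add: inner_ell2.rep_eq)
  from this[of a b] this[of a "\<i> *\<^sub>C b"] show ?thesis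
    by (simp add: sums_complex_iff cinner_def ell2_nth_scaleC)
qed

lemma cinner_hardy: "cinner f g = cinner (hardy_coeffs f) (hardy_coeffs g)"
  by (simp add: cinner_def inner_hardy_def hardy_coeffs_linear)

lemma cinner_scaleC_right: "cinner x (c *\<^sub>C y) = cnj c * cinner x y"
  by (subst (1 2) cinner_commute) (simp add: cinner_scaleC_left)

lemma cinner_complex: "cinner x y = x * cnj y" for x y :: complex
  by (simp add: cinner_def scaleC_complex_def inner_complex_def complex_eq_iff)

lemma cinner_hardy_tensor:
  "cinner (hardy_tensor f e) (hardy_tensor g e') = cinner f g * cinner e e'"
proof -
  have "(\<lambda>n. cinner (ell2_nth (hardy_coeffs f) n) (ell2_nth (hardy_coeffs g) n) * cinner e e')
      sums (cinner f g * cinner e e')"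
    unfolding cinner_hardy[of f g] by (intro sums_mult2 cinner_ell2_sums)
  moreover have "(\<lambda>n. cinner (ell2_nth (hardy_coeffs f) n) (ell2_nth (hardy_coeffs g) n) * cinner e e')
      sums cinner (hardy_tensor f e) (hardy_tensor g e')"
    using cinner_ell2_sums[of "hardy_coeffs (hardy_tensor f e)" "hardy_coeffs (hardy_tensor g e')"]
    by (simp add: cinner_hardy[of "hardy_tensor f e"] hardy_coeffs_tensor cinner_scaleC_left
        cinner_scaleC_right cinner_complex mult_ac)
  ultimately show ?thesis by (rule sums_unique2[symmetric])
qed

lemma hardy_space_eq_tensor_span:
  assumes E: "closed_csubspace E"
  shows "hardy_space E = closure (cspan {hardy_tensor f e | f e. e \<in> E})"
proof
  have sub: "csubspace E" "closed E" using E by (auto simp: closed_csubspace_def)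
  let ?S = "{hardy_tensor f e | f e. e \<in> E}"
  have "?S \<subseteq> hardy_space E"
    using csubspaceD(3)[OF sub(1)] by (auto simp: hardy_space_def hardy_eval_tensor)
  then show "closure (cspan ?S) \<subseteq> hardy_space E"
    using closed_csubspace_hardy_space[OF E]
    by (intro closure_minimal cspan_minimal) (auto simp: closed_csubspace_def)
  show "hardy_space E \<subseteq> closure (cspan ?S)"
  proof
    fix f assume f: "f \<in> hardy_space E"
    define a where "a = hardy_coeffs f"
    have aE: "ell2_nth a n \<in> E" for n
      using f by (intro hardy_coeffs_mem[OF E]) (simp add: hardy_space_def hardy_eval_conv a_def)
    define e where "e n = hardy_of_coeffs (Abs_ell2 (\<lambda>k. if k = n then 1 else (0::complex)))" for n
    have e: "ell2_nth (hardy_coeffs (e n)) k = (if k = n then 1 else 0)" for n k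
    proof -
      have "(\<lambda>k. (norm (if k = n then 1 else (0::complex)))\<^sup>2) = (\<lambda>k. if k = n then 1 else 0)"
        by auto
      then have "summable (\<lambda>k. (norm (if k = n then 1 else (0::complex)))\<^sup>2)"
        using summable_single[of n "\<lambda>_. 1::real"] by simp
      then show ?thesis by (simp add: e_def Abs_ell2_inverse)
    qed
    define p where "p N = (\<Sum>n<N. hardy_tensor (e n) (ell2_nth a n))" for N
    have pk: "ell2_nth (hardy_coeffs (p N)) k = (if k < N then ell2_nth a k else 0)" for N k
    proof (induction N)
      case (Suc N)
      then show ?case
        by (auto simp: p_def hardy_coeffs_linear ell2_nth_add hardy_coeffs_tensor e less_Suc_eq)
    qed (simp add: p_def hardy_coeffs_linear ell2_nth_zero)
    have "p N \<in> cspan ?S" for N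
      unfolding p_def using aE cspan_superset[of ?S] by (intro csubspace_sum csubspace_cspan) blast
    then have pS: "\<forall>N. p N \<in> cspan ?S" ..
    have lim: "p \<longlonglongrightarrow> f"
    proof -
      have "(\<lambda>N. (norm (p N - f))\<^sup>2) \<longlonglongrightarrow> 0"
      proof -
        have "(norm (p N - f))\<^sup>2 = (\<Sum>k. (norm (ell2_nth a (k + N)))\<^sup>2)" for N
        proof -
          have *: "(norm (ell2_nth (hardy_coeffs (p N - f)) k))\<^sup>2 = (if k < N then 0 else (norm (ell2_nth a k))\<^sup>2)" for k
            by (simp add: hardy_coeffs_linear ell2_nth_diff pk a_def[symmetric])
          have "summable (\<lambda>k. if k < N then 0 else (norm (ell2_nth a k))\<^sup>2)"
            using summable_ell2[of "hardy_coeffs (p N - f)"] by (simp add: *)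
          from suminf_split_initial_segment[OF this, of N] show ?thesis
            by (simp add: norm_hardy_coeffs[symmetric, of "p N - f"] norm_ell2_sq *)
        qed
        then show ?thesis using suminf_exist_split2[OF summable_ell2[of a]] by simp
      qed
      from tendsto_real_sqrt[OF this] have "(\<lambda>N. norm (p N - f)) \<longlonglongrightarrow> 0" by simp
      then show ?thesis by (rule LIM_zero_cancel[OF tendsto_norm_zero_cancel])
    qed
    show "f \<in> closure (cspan ?S)"
      unfolding closure_sequential by (intro exI[of _ p] conjI pS lim)
  qed
qed

lemma hardy_map_tensor:
  assumes E: "closed_csubspace E" and X: "bounded_op E E X" and e: "e \<in> E"
  shows "hardy_map X (hardy_tensor f e) = hardy_tensor f (X e)"
proof -
  have "hardy_tensor f e \<in> hardy_space E"
    using csubspaceD(3)[of E] E e by (auto simp: hardy_space_def hardy_eval_tensor closed_csubspace_def)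
  from hardy_eval_map[OF E X this]
  have "hardy_eval (hardy_map X (hardy_tensor f e)) z = hardy_eval (hardy_tensor f (X e)) z" for z
    using X e by (simp add: hardy_eval_tensor bounded_op_def)
  then show ?thesis by (simp add: hardy_eval_inject[symmetric] fun_eq_iff)
qed

lemma hardy_mult_z_tensor: "hardy_mult_z (hardy_tensor f e) = hardy_tensor (hardy_mult_z f) e"
  by (simp add: hardy_eval_inject[symmetric] fun_eq_iff hardy_eval_tensor hardy_mult_z.rep_eq
      scaleC_scaleC scaleC_complex_def)

section \<open>Commuting tuples, joint spectrum, spectral sets\<close>

definition commuting_tuple :: "nat \<Rightarrow> 'a::complex_inner set \<Rightarrow> (nat \<Rightarrow> 'a \<Rightarrow> 'a) \<Rightarrow> bool"
  where "commuting_tuple m M T \<longleftrightarrow> closed_csubspace M \<and> (\<forall>i\<in>{1..m}. bounded_op M M (T i)) \<and>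
    (\<forall>i\<in>{1..m}. \<forall>j\<in>{1..m}. \<forall>x\<in>M. T i (T j x) = T j (T i x))"

text \<open>\<open>T\<^sub>1\<^bsup>k 1\<^esup> \<circ> \<dots> \<circ> T\<^sub>m\<^bsup>k m\<^esup>\<close>\<close>

definition tuple_monomial :: "nat \<Rightarrow> (nat \<Rightarrow> 'a \<Rightarrow> 'a) \<Rightarrow> (nat \<Rightarrow> nat) \<Rightarrow> 'a \<Rightarrow> 'a"
  where "tuple_monomial m T k = foldr (\<lambda>i f. (T i ^^ k i) \<circ> f) [1..<Suc m] id"

text \<open>The Koszul complex of \<open>T\<close> on \<open>M \<otimes> \<Lambda>\<complex>\<^sup>m\<close>: a form is the family of its coefficients
  \<open>\<omega> I\<close> with respect to the basis vectors \<open>e\<^sub>I\<close>, \<open>I \<subseteq> {1..m}\<close>, and the differential is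
  \<open>x \<otimes> e\<^sub>I \<mapsto> \<Sum>\<^sub>j T\<^sub>j x \<otimes> (e\<^sub>j \<and> e\<^sub>I)\<close>.  The differential is
  homogeneous, so exactness in every degree is equality of its kernel and range on all forms.\<close>

definition koszul_form :: "nat \<Rightarrow> 'a::complex_inner set \<Rightarrow> (nat set \<Rightarrow> 'a) \<Rightarrow> bool"
  where "koszul_form m M \<omega> \<longleftrightarrow> (\<forall>I. \<omega> I \<in> M) \<and> (\<forall>I. \<not> I \<subseteq> {1..m} \<longrightarrow> \<omega> I = 0)"

definition koszul_d :: "nat \<Rightarrow> (nat \<Rightarrow> 'a \<Rightarrow> 'a) \<Rightarrow> (nat set \<Rightarrow> 'a::complex_inner) \<Rightarrow> nat set \<Rightarrow> 'a"
  where "koszul_d m T \<omega> J = (if J \<subseteq> {1..m}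
    then \<Sum>j\<in>J. (-1) ^ card {i\<in>J. i < j} *\<^sub>R T j (\<omega> (J - {j})) else 0)"

definition koszul_exact :: "nat \<Rightarrow> 'a::complex_inner set \<Rightarrow> (nat \<Rightarrow> 'a \<Rightarrow> 'a) \<Rightarrow> bool"
  where "koszul_exact m M T \<longleftrightarrow> (\<forall>\<omega>. koszul_form m M \<omega> \<and> koszul_d m T \<omega> = (\<lambda>_. 0) \<longrightarrow>
    (\<exists>\<eta>. koszul_form m M \<eta> \<and> koszul_d m T \<eta> = \<omega>))"

text \<open>Points of \<open>\<complex>\<^sup>m\<close> are functions \<open>nat \<Rightarrow> complex\<close> vanishing off \<open>{1..m}\<close>.\<close>

definition taylor_spectrum :: "nat \<Rightarrow> 'a::complex_inner set \<Rightarrow> (nat \<Rightarrow> 'a \<Rightarrow> 'a) \<Rightarrow> (nat \<Rightarrow> complex) set"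
  where "taylor_spectrum m M T = {\<mu>. (\<forall>i. i \<notin> {1..m} \<longrightarrow> \<mu> i = 0) \<and>
    \<not> koszul_exact m M (\<lambda>i x. T i x - \<mu> i *\<^sub>C x)}"

type_synonym mpolynomial = "(nat \<Rightarrow>\<^sub>0 nat) \<Rightarrow>\<^sub>0 complex"

definition in_vars :: "nat \<Rightarrow> mpolynomial \<Rightarrow> bool"
  where "in_vars m p \<longleftrightarrow> (\<forall>\<alpha>\<in>Poly_Mapping.keys p. Poly_Mapping.keys \<alpha> \<subseteq> {1..m})"

definition mpoly_eval :: "nat \<Rightarrow> mpolynomial \<Rightarrow> (nat \<Rightarrow> complex) \<Rightarrow> complex"
  where "mpoly_eval m p s = (\<Sum>\<alpha>\<in>Poly_Mapping.keys p.
    Poly_Mapping.lookup p \<alpha> * (\<Prod>i\<in>{1..m}. s i ^ Poly_Mapping.lookup \<alpha> i))"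

definition mpoly_op :: "nat \<Rightarrow> mpolynomial \<Rightarrow> (nat \<Rightarrow> 'a \<Rightarrow> 'a) \<Rightarrow> 'a \<Rightarrow> 'a::complex_inner"
  where "mpoly_op m p T x = (\<Sum>\<alpha>\<in>Poly_Mapping.keys p.
    Poly_Mapping.lookup p \<alpha> *\<^sub>C tuple_monomial m T (Poly_Mapping.lookup \<alpha>) x)"

text \<open>For a rational function \<open>r = p/q\<close> with poles off \<open>X\<close>, \<open>r(T) = p(T) q(T)\<^sup>-\<^sup>1\<close>;
  \<open>q(T)\<close> is invertible on \<open>M\<close> because the joint spectrum lies in \<open>X\<close>.\<close>

definition spectral_set :: "nat \<Rightarrow> 'a::complex_inner set \<Rightarrow> (nat \<Rightarrow> 'a \<Rightarrow> 'a) \<Rightarrow> (nat \<Rightarrow> complex) set \<Rightarrow> bool"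
  where "spectral_set m M T X \<longleftrightarrow> taylor_spectrum m M T \<subseteq> X \<and>
    (\<forall>p q. in_vars m p \<and> in_vars m q \<and> (\<forall>s\<in>X. mpoly_eval m q s \<noteq> 0) \<longrightarrow>
      op_norm M (mpoly_op m p T \<circ> inv_into M (mpoly_op m q T))
        \<le> (SUP s\<in>X. cmod (mpoly_eval m p s / mpoly_eval m q s)))"

section \<open>Operators associated with the symmetrized polydisc\<close>

definition symmetrization :: "nat \<Rightarrow> (nat \<Rightarrow> complex) \<Rightarrow> nat \<Rightarrow> complex"
  where "symmetrization m z k = (if k \<in> {1..m}
    then \<Sum>I | I \<subseteq> {1..m} \<and> card I = k. \<Prod>i\<in>I. z i else 0)"

definition Gamma :: "nat \<Rightarrow> (nat \<Rightarrow> complex) set"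
  where "Gamma m = {symmetrization m z | z. \<forall>i\<in>{1..m}. cmod (z i) \<le> 1}"

definition bGamma :: "nat \<Rightarrow> (nat \<Rightarrow> complex) set"
  where "bGamma n = {s \<in> Gamma n. cmod (s n) = 1}"

definition Gamma_contraction :: "nat \<Rightarrow> 'a::complex_inner set \<Rightarrow> (nat \<Rightarrow> 'a \<Rightarrow> 'a) \<Rightarrow> bool"
  where "Gamma_contraction m M T \<longleftrightarrow> commuting_tuple m M T \<and> spectral_set m M T (Gamma m)"

definition Gamma_unitary :: "nat \<Rightarrow> 'a::complex_inner set \<Rightarrow> (nat \<Rightarrow> 'a \<Rightarrow> 'a) \<Rightarrow> bool"
  where "Gamma_unitary n M T \<longleftrightarrow> commuting_tuple n M T \<and> (\<forall>i\<in>{1..n}. normal_op M (T i)) \<and>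
    taylor_spectrum n M T \<subseteq> bGamma n"

text \<open>
  The \<open>\<Gamma>\<^sub>n\<close>-unitary extension acts on some Hilbert space \<open>L\<close>; the type \<open>'e\<close> containing \<open>L\<close> is a
  parameter.  In the theorem it occurs as a free type variable in the hypotheses, which amounts
  to the existence of an extension on a Hilbert space of any type.
\<close>

definition Gamma_isometry ::
    "'e::chilbert_space itself \<Rightarrow> nat \<Rightarrow> 'a::complex_inner set \<Rightarrow> (nat \<Rightarrow> 'a \<Rightarrow> 'a) \<Rightarrow> bool"
  where "Gamma_isometry TYPE_E n M T \<longleftrightarrow> closed_csubspace M \<and> (\<forall>i\<in>{1..n}. \<forall>x\<in>M. T i x \<in> M) \<and>
    (\<exists>(L::'e set) N J. Gamma_unitary n L N \<and> isometric_op M L J \<and>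
      (\<forall>i\<in>{1..n}. \<forall>x\<in>M. N i (J x) = J (T i x)))"

definition pure_Gamma_isometry ::
    "'e::chilbert_space itself \<Rightarrow> nat \<Rightarrow> 'a::complex_inner set \<Rightarrow> (nat \<Rightarrow> 'a \<Rightarrow> 'a) \<Rightarrow> bool"
  where "pure_Gamma_isometry TYPE_E n M T \<longleftrightarrow> Gamma_isometry TYPE_E n M T \<and>
    (\<forall>x\<in>M. (\<lambda>k. (adjoint_on M (T n) ^^ k) x) \<longlonglongrightarrow> 0)"

definition adjoint_tuple :: "'a::complex_inner set \<Rightarrow> (nat \<Rightarrow> 'a \<Rightarrow> 'a) \<Rightarrow> nat \<Rightarrow> 'a \<Rightarrow> 'a"
  where "adjoint_tuple M T i = adjoint_on M (T i)"

definition FO_tuple :: "nat \<Rightarrow> 'a::complex_inner set \<Rightarrow> (nat \<Rightarrow> 'a \<Rightarrow> 'a) \<Rightarrow> (nat \<Rightarrow> 'a \<Rightarrow> 'a) \<Rightarrow> bool"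
  where "FO_tuple n M T A \<longleftrightarrow> (\<forall>i\<in>{1..n - 1}.
    bounded_op (defect_space M (T n)) (defect_space M (T n)) (A i) \<and>
    (\<forall>x\<in>M. T i x - adjoint_on M (T (n - i)) (T n x)
      = defect_op M (T n) (A i (defect_op M (T n) x))))"

text \<open>\<open>J\<close> identifies the space \<open>M\<close> of \<open>T\<close> with a subspace of \<open>L\<close>, so that
  \<open>adjoint_on M J\<close> is the projection of \<open>L\<close> onto \<open>M\<close>.\<close>

definition Gamma_isometric_dilation ::
    "'e::chilbert_space itself \<Rightarrow> nat \<Rightarrow> 'a::complex_inner set \<Rightarrow> (nat \<Rightarrow> 'a \<Rightarrow> 'a) \<Rightarrow>
      'b::complex_inner set \<Rightarrow> (nat \<Rightarrow> 'b \<Rightarrow> 'b) \<Rightarrow> ('a \<Rightarrow> 'b) \<Rightarrow> bool"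
  where "Gamma_isometric_dilation TYPE_E n M T L Q J \<longleftrightarrow>
    Gamma_isometry TYPE_E n L Q \<and> isometric_op M L J \<and>
    (\<forall>k. \<forall>x\<in>M. adjoint_on M J (tuple_monomial n Q k (J x)) = tuple_monomial n T k x)"

definition minimal_Gamma_isometric_dilation ::
    "'e::chilbert_space itself \<Rightarrow> nat \<Rightarrow> 'a::complex_inner set \<Rightarrow> (nat \<Rightarrow> 'a \<Rightarrow> 'a) \<Rightarrow>
      'b::complex_inner set \<Rightarrow> (nat \<Rightarrow> 'b \<Rightarrow> 'b) \<Rightarrow> ('a \<Rightarrow> 'b) \<Rightarrow> bool"
  where "minimal_Gamma_isometric_dilation TYPE_E n M T L Q J \<longleftrightarrow>
    Gamma_isometric_dilation TYPE_E n M T L Q J \<and>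
    L = closure (cspan {tuple_monomial n Q k (J x) | k x. x \<in> M})"

section \<open>Characteristic function\<close>

definition char_fun :: "'a::complex_inner set \<Rightarrow> ('a \<Rightarrow> 'a) \<Rightarrow> complex \<Rightarrow> 'a \<Rightarrow> 'a"
  where "char_fun M P z x = - P x + z *\<^sub>C defect_op M (adjoint_on M P)
    (inv_into M (\<lambda>y. y - z *\<^sub>C adjoint_on M P y) (defect_op M P x))"

text \<open>
  The boundary value at \<open>e\<^bsup>it\<^esup>\<close> is the strong radial limit.  If the defect space is
  separable, this limit exists on the whole defect space for almost every \<open>t\<close>.  In general the
  vectors for which it exists at a given \<open>t\<close> form a closed subspace, and the boundary value is
  taken to be \<open>0\<close> on its orthogonal complement: an element \<open>f\<close> of \<open>L\<^sup>2\<close> is almost separably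
  valued, so \<open>f t\<close> belongs to the subspace for almost every \<open>t\<close>.
\<close>

definition radial_domain :: "'a::complex_inner set \<Rightarrow> ('a \<Rightarrow> 'a) \<Rightarrow> real \<Rightarrow> 'a set"
  where "radial_domain M P t = {x \<in> defect_space M P.
    \<exists>y. ((\<lambda>r. char_fun M P (complex_of_real r * cis t) x) \<longlongrightarrow> y) (at_left 1)}"

definition char_fun_boundary :: "'a::complex_inner set \<Rightarrow> ('a \<Rightarrow> 'a) \<Rightarrow> real \<Rightarrow> 'a \<Rightarrow> 'a"
  where "char_fun_boundary M P t x =
    Lim (at_left 1) (\<lambda>r. char_fun M P (complex_of_real r * cis t) (orth_proj (radial_domain M P t) x))"

definition Delta :: "'a::complex_inner set \<Rightarrow> ('a \<Rightarrow> 'a) \<Rightarrow> real \<Rightarrow> 'a \<Rightarrow> 'a"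
  where "Delta M P t = positive_sqrt (defect_space M P)
    (\<lambda>x. x - adjoint_on (defect_space M P) (char_fun_boundary M P t) (char_fun_boundary M P t x))"

definition L2_space :: "'a::chilbert_space set \<Rightarrow> 'a L2circle set"
  where "L2_space E = {f. AE t in circle_measure. rep_L2circle f t \<in> E}"

definition Delta_L2 :: "'a::chilbert_space set \<Rightarrow> ('a \<Rightarrow> 'a) \<Rightarrow> 'a L2circle set"
  where "Delta_L2 M P = closure {g. \<exists>f\<in>L2_space (defect_space M P).
    AE t in circle_measure. rep_L2circle g t = Delta M P t (rep_L2circle f t)}"

lemma strongly_measurable_cis: "strongly_measurable circle_measure cis"
proof -
  have "cis \<in> borel_measurable circle_measure"
    by (simp add: measurable_cong_sets[OF sets_circle_measure refl] borel_measurable_continuous_onI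
        continuous_on_cis)
  from borel_measurable_implies_sequence_metric[OF this, of 0] show ?thesis
    unfolding strongly_measurable_def by blast
qed

lift_definition L2_mult_exp :: "'a::chilbert_space L2circle \<Rightarrow> 'a L2circle" is "\<lambda>f t. cis t *\<^sub>C f t"
  unfolding L2_eq_def by (auto intro: square_integrable_scaleC_fun[where B = 1] strongly_measurable_cis)

section \<open>The dilation space \<open>M \<oplus> D\<^sub>P \<oplus> D\<^sub>P \<oplus> \<dots>\<close>\<close>

definition Schaffer_space :: "'a::chilbert_space set \<Rightarrow> ('a \<Rightarrow> 'a) \<Rightarrow> 'a ell2 set"
  where "Schaffer_space M P = {h. ell2_nth h 0 \<in> M \<and> (\<forall>k\<ge>1. ell2_nth h k \<in> defect_space M P)}"

definition Schaffer_R :: "nat \<Rightarrow> 'a::chilbert_space set \<Rightarrow> (nat \<Rightarrow> 'a \<Rightarrow> 'a) \<Rightarrow> ('a \<Rightarrow> 'a) \<Rightarrow>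
    (nat \<Rightarrow> 'a \<Rightarrow> 'a) \<Rightarrow> nat \<Rightarrow> 'a ell2 \<Rightarrow> 'a ell2"
  where "Schaffer_R n M S P A i h = (let A' = adjoint_on (defect_space M P) (A (n - i)) in
    Abs_ell2 (\<lambda>k. if k = 0 then S i (ell2_nth h 0)
      else if k = 1 then A' (defect_op M P (ell2_nth h 0)) + A i (ell2_nth h 1)
      else A' (ell2_nth h (k - 1)) + A i (ell2_nth h k)))"

definition Schaffer_V :: "'a::chilbert_space set \<Rightarrow> ('a \<Rightarrow> 'a) \<Rightarrow> 'a ell2 \<Rightarrow> 'a ell2"
  where "Schaffer_V M P h = Abs_ell2 (\<lambda>k. if k = 0 then P (ell2_nth h 0)
      else if k = 1 then defect_op M P (ell2_nth h 0) else ell2_nth h (k - 1))"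

end

theory Submission
  imports Defs
begin

text \<open>
  Minimality makes the dilation a co-extension, so with \<open>J\<close> the embedding of the space into the
  dilation space, \<open>P J\<^sup>* = J\<^sup>* P~\<close> for the last entry \<open>P~ = M\<^sub>z \<oplus> M\<close> of the dilation, where \<open>M\<close> is
  multiplication by \<open>e\<^bsup>it\<^esup>\<close>.  Therefore \<open>C\<^sub>i + P C\<^sub>n\<^sub>-\<^sub>i\<^sup>*\<close> is the compression of
  \<open>(I \<otimes> U\<^sub>1\<^sup>* G\<^sub>i\<^sup>* U\<^sub>1 + M\<^sub>z \<otimes> U\<^sub>1\<^sup>* G\<^sub>n\<^sub>-\<^sub>i U\<^sub>1) \<oplus> (S~\<^sub>i\<^sub>2 + M S~\<^sub>(\<^sub>n\<^sub>-\<^sub>i\<^sub>)\<^sub>2\<^sup>*)/2\<close>, and everything reduces to the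
  relation \<open>S~\<^sub>i\<^sub>2 = M S~\<^sub>(\<^sub>n\<^sub>-\<^sub>i\<^sub>)\<^sub>2\<^sup>*\<close>.

  This relation is not immediate, because \<open>U\<^sub>2\<close> is not assumed to intertwine \<open>M\<close> with \<open>V\<^sub>2\<close>.
  On \<open>K\<^sub>2\<close> the explicit form of the \<open>R\<^sub>i\<close> gives \<open>R\<^sub>i = R\<^sub>n\<^sub>-\<^sub>i\<^sup>* V\<close> with \<open>V\<close> unitary, so the \<open>R\<^sub>i\<close> commute
  with each other's adjoints; \<open>M\<close> is an isometry commuting with these normal operators and hence
  with their adjoints.  Thus, if the difference of both sides were nonzero, it would be bounded away
  from zero on some sequence of joint approximate eigenvectors of \<open>M\<close> and the \<open>S~\<^sub>j\<^sub>2\<close>.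
  Their limiting eigenvalues belong to the Taylor spectrum of a \<open>\<Gamma>\<^sub>n\<close>-unitary extension, hence to
  \<open>b\<Gamma>\<^sub>n\<close>, where \<open>s\<^sub>i = s\<^sub>n\<^sub>-\<^sub>i\<^sup>* p\<close>: a contradiction.
\<close>

section \<open>Bounded operators and adjoints\<close>

text \<open>The factor 1/2 in \<open>C\<close> reflects a difference between the two summands. On
  the Hardy space the two terms of \<open>St1\<close> come one each from \<open>C i\<close> and from
  P times the adjoint of \<open>C (n - i)\<close>, as \<open>X j\<close> and \<open>Y j\<close> are
  adjoint to each other. On the other summand both contributions are the same operator once the
  relation for \<open>St2\<close> is known, so each is taken half.

  The approximate eigenvectors come from maximization instead of spectral measures. Among sequences
  of unit vectors asymptotically annihilated by the operators treated so far, the limits of |A x|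
  have a largest value c, and for suitable A a maximizing sequence satisfies A' A x - c^2 x -> 0,
  with A' the adjoint of A. For self-adjoint A this factors, and one factor yields an approximate
  eigenvalue. The obstacle is that multiplication by the exponential is available only as an
  isometry, so it need not commute with adjoints of operators built from it. It is therefore treated
  last, via M + 1, and its compatibility with the first constraint, which involves such an adjoint,
  is proved through norms.\<close>

lemma closed_csubspaceD:
  assumes "closed_csubspace M"
  shows "csubspace M" "closed M" "0 \<in> M" "x \<in> M \<Longrightarrow> y \<in> M \<Longrightarrow> x + y \<in> M" "x \<in> M \<Longrightarrow> c *\<^sub>C x \<in> M"
    "x \<in> M \<Longrightarrow> - x \<in> M" "x \<in> M \<Longrightarrow> y \<in> M \<Longrightarrow> x - y \<in> M" "x \<in> M \<Longrightarrow> r *\<^sub>R x \<in> M"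
  using assms csubspaceD[of M] unfolding closed_csubspace_def
  by (auto simp flip: scaleC_of_real)

lemma csubspace_scaleR: "csubspace M \<Longrightarrow> x \<in> M \<Longrightarrow> r *\<^sub>R x \<in> M"
  using csubspaceD(3)[of M x "complex_of_real r"] by (simp add: scaleC_of_real)

lemma scaleC_minus_left: "(- c) *\<^sub>C x = - (c *\<^sub>C (x::'a::complex_inner))"
  using scaleC_add_left[of c "- c" x] by (simp add: eq_neg_iff_add_eq_0 add.commute)

lemma scaleC_diff_left: "(c - d) *\<^sub>C x = c *\<^sub>C x - d *\<^sub>C (x::'a::complex_inner)"
  using scaleC_add_left[of c "- d" x] by (simp add: scaleC_minus_left)

lemma scaleC_scaleR: "c *\<^sub>C (r *\<^sub>R x) = r *\<^sub>R (c *\<^sub>C (x::'a::complex_inner))"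
  by (simp add: scaleC_scaleC mult.commute flip: scaleC_of_real)

lemma closed_csubspace_UNIV [simp]: "closed_csubspace UNIV"
  by (simp add: closed_csubspace_def csubspace_def)

lemma bounded_opI:
  assumes "\<And>x. x \<in> M \<Longrightarrow> T x \<in> N"
    and "\<And>x y. x \<in> M \<Longrightarrow> y \<in> M \<Longrightarrow> T (x + y) = T x + T y"
    and "\<And>c x. x \<in> M \<Longrightarrow> T (c *\<^sub>C x) = c *\<^sub>C T x"
    and "\<And>x. x \<in> M \<Longrightarrow> norm (T x) \<le> K * norm x"
  shows "bounded_op M N T"
  using assms unfolding bounded_op_def by blast

lemma bounded_opD:
  assumes "bounded_op M N T"
  shows "x \<in> M \<Longrightarrow> T x \<in> N"
    and "x \<in> M \<Longrightarrow> y \<in> M \<Longrightarrow> T (x + y) = T x + T y"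
    and "x \<in> M \<Longrightarrow> T (c *\<^sub>C x) = c *\<^sub>C T x"
    and "x \<in> M \<Longrightarrow> T (r *\<^sub>R x) = r *\<^sub>R T x"
    and "csubspace M \<Longrightarrow> x \<in> M \<Longrightarrow> y \<in> M \<Longrightarrow> T (x - y) = T x - T y"
    and "csubspace M \<Longrightarrow> x \<in> M \<Longrightarrow> T (- x) = - T x"
    and "csubspace M \<Longrightarrow> T 0 = 0"
proof -
  show *: "x \<in> M \<Longrightarrow> T x \<in> N" "x \<in> M \<Longrightarrow> y \<in> M \<Longrightarrow> T (x + y) = T x + T y"
    "x \<in> M \<Longrightarrow> T (c *\<^sub>C x) = c *\<^sub>C T x" for x y c
    using assms unfolding bounded_op_def by blast+
  show "x \<in> M \<Longrightarrow> T (r *\<^sub>R x) = r *\<^sub>R T x"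
    using *(3)[of x "complex_of_real r"] by (simp add: scaleC_of_real)
  show neg: "csubspace M \<Longrightarrow> x \<in> M \<Longrightarrow> T (- x) = - T x" for x
    using *(3)[of x "- 1"] by (simp add: scaleC_minus_left)
  show "csubspace M \<Longrightarrow> x \<in> M \<Longrightarrow> y \<in> M \<Longrightarrow> T (x - y) = T x - T y"
    using *(2)[of x "- y"] neg[of y] csubspaceD(4)[of M y] by simp
  show "csubspace M \<Longrightarrow> T 0 = 0"
    using *(3)[of 0 0] csubspaceD(1)[of M] by simp
qed

lemma bounded_op_bound:
  assumes "bounded_op M N T"
  obtains K where "K > 0" "\<And>x. x \<in> M \<Longrightarrow> norm (T x) \<le> K * norm x"
proof -
  obtain K where K: "\<And>x. x \<in> M \<Longrightarrow> norm (T x) \<le> K * norm x"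
    using assms unfolding bounded_op_def by blast
  have "norm (T x) \<le> (\<bar>K\<bar> + 1) * norm x" if "x \<in> M" for x
    by (rule order_trans[OF K[OF that] mult_right_mono]) auto
  then show ?thesis using that[of "\<bar>K\<bar> + 1"] by simp
qed

lemma bounded_op_comp:
  assumes "bounded_op M N T" "bounded_op N L U"
  shows "bounded_op M L (\<lambda>x. U (T x))"
proof -
  obtain K1 where K1: "K1 > 0" "\<And>x. x \<in> M \<Longrightarrow> norm (T x) \<le> K1 * norm x"
    using bounded_op_bound[OF assms(1)] by blast
  obtain K2 where K2: "K2 > 0" "\<And>x. x \<in> N \<Longrightarrow> norm (U x) \<le> K2 * norm x"
    using bounded_op_bound[OF assms(2)] by blast
  show ?thesis
  proof (rule bounded_opI[where K = "K2 * K1"])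
    fix x assume x: "x \<in> M"
    show "norm (U (T x)) \<le> K2 * K1 * norm x"
      using order_trans[OF K2(2) mult_left_mono[OF K1(2)[OF x]]] bounded_opD(1)[OF assms(1) x] K2(1)
      by (simp add: mult.assoc)
  qed (simp_all add: bounded_opD[OF assms(1)] bounded_opD[OF assms(2)])
qed

lemma bounded_op_add:
  assumes "bounded_op M N T" "bounded_op M N U" "csubspace N"
  shows "bounded_op M N (\<lambda>x. T x + U x)"
proof -
  obtain K1 where K1: "\<And>x. x \<in> M \<Longrightarrow> norm (T x) \<le> K1 * norm x"
    using bounded_op_bound[OF assms(1)] by metis
  obtain K2 where K2: "\<And>x. x \<in> M \<Longrightarrow> norm (U x) \<le> K2 * norm x"
    using bounded_op_bound[OF assms(2)] by metis
  show ?thesis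
  proof (rule bounded_opI[where K = "K1 + K2"])
    fix x assume x: "x \<in> M"
    show "norm (T x + U x) \<le> (K1 + K2) * norm x"
      using norm_triangle_ineq[of "T x" "U x"] K1[OF x] K2[OF x] by (simp add: algebra_simps)
  qed (simp_all add: bounded_opD[OF assms(1)] bounded_opD[OF assms(2)] csubspaceD[OF assms(3)] scaleC_add_right)
qed

lemma bounded_op_scaleC:
  assumes "bounded_op M N T" "csubspace N"
  shows "bounded_op M N (\<lambda>x. c *\<^sub>C T x)"
proof -
  obtain K where K: "\<And>x. x \<in> M \<Longrightarrow> norm (T x) \<le> K * norm x"
    using bounded_op_bound[OF assms(1)] by metis
  show ?thesis
  proof (rule bounded_opI[where K = "cmod c * K"])
    fix x assume x: "x \<in> M"
    show "norm (c *\<^sub>C T x) \<le> cmod c * K * norm x"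
      using mult_left_mono[OF K[OF x], of "cmod c"] by (simp add: norm_scaleC mult.assoc)
  qed (simp_all add: bounded_opD[OF assms(1)] csubspaceD[OF assms(2)] scaleC_add_right scaleC_scaleC mult.commute)
qed

lemma bounded_op_scaleR:
  "bounded_op M N T \<Longrightarrow> csubspace N \<Longrightarrow> bounded_op M N (\<lambda>x. r *\<^sub>R T x)"
  using bounded_op_scaleC[of M N T "complex_of_real r"] by (simp add: scaleC_of_real)

lemma bounded_op_diff:
  assumes "bounded_op M N T" "bounded_op M N U" "csubspace N"
  shows "bounded_op M N (\<lambda>x. T x - U x)"
  using bounded_op_add[OF assms(1) bounded_op_scaleR[OF assms(2,3), of "- 1"] assms(3)] by simp

lemma bounded_op_id: "bounded_op M M (\<lambda>x. x)"
  by (rule bounded_opI[where K = 1]) auto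

lemma bounded_op_mono:
  "bounded_op M N T \<Longrightarrow> M' \<subseteq> M \<Longrightarrow> (\<And>x. x \<in> M' \<Longrightarrow> T x \<in> N') \<Longrightarrow> bounded_op M' N' T"
  unfolding bounded_op_def by blast

text \<open>Adjoints are defined with \<open>cinner\<close>, while the computations use the real
  \<open>inner\<close>. Evaluation at i times m recovers the imaginary part, by complex linearity of
  T.\<close>

lemma cinner_eq_iff_inner:
  assumes "csubspace M" "bounded_op M N T"
  shows "(\<forall>m\<in>M. cinner (T m) y = cinner m x) \<longleftrightarrow> (\<forall>m\<in>M. inner (T m) y = inner m x)"
proof
  assume "\<forall>m\<in>M. cinner (T m) y = cinner m x"
  then show "\<forall>m\<in>M. inner (T m) y = inner m x" by (metis Re_cinner)
next
  assume *: "\<forall>m\<in>M. inner (T m) y = inner m x"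
  show "\<forall>m\<in>M. cinner (T m) y = cinner m x"
  proof
    fix m assume m: "m \<in> M"
    then have "inner (T (\<i> *\<^sub>C m)) y = inner (\<i> *\<^sub>C m) x"
      using * csubspaceD(3)[OF assms(1)] by blast
    then show "cinner (T m) y = cinner m x"
      using m * by (simp add: cinner_def bounded_opD(3)[OF assms(2)] inner_ii_left)
  qed
qed

section \<open>Orthogonal projections, the Riesz representation and adjoints\<close>

lemma polarization: "4 * inner x y = (norm (x + y))\<^sup>2 - (norm (x - y))\<^sup>2"
  for x y :: "'a::real_inner"
  by (simp add: power2_norm_eq_inner inner_add_left inner_add_right inner_diff_left inner_diff_right inner_commute)

lemma parallelogram: "(norm (x + y))\<^sup>2 + (norm (x - y))\<^sup>2 = 2 * (norm x)\<^sup>2 + 2 * (norm y)\<^sup>2"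
  for x y :: "'a::real_inner"
  by (simp add: power2_norm_eq_inner inner_add_left inner_add_right inner_diff_left inner_diff_right inner_commute)

text \<open>A minimizing sequence for the distance to M is Cauchy by the parallelogram identity,
  since midpoints stay in M.\<close>

lemma orth_decomp:
  fixes x :: "'a::chilbert_space"
  assumes M: "closed_csubspace M"
  shows "\<exists>p\<in>M. \<forall>m\<in>M. inner (x - p) m = 0"
proof -
  note D = closed_csubspaceD[OF M]
  define d where "d = (INF m\<in>M. (norm (x - m))\<^sup>2)"
  have bdd: "bdd_below ((\<lambda>m. (norm (x - m))\<^sup>2) ` M)" by (rule bdd_belowI2[of _ 0]) simp
  have dle: "d \<le> (norm (x - m))\<^sup>2" if "m \<in> M" for m
    unfolding d_def by (rule cINF_lower[OF bdd that])
  have "\<exists>m\<in>M. (norm (x - m))\<^sup>2 < d + inverse (real (Suc k))" for k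
  proof -
    have "(INF m\<in>M. (norm (x - m))\<^sup>2) < d + inverse (real (Suc k))" unfolding d_def by simp
    then show ?thesis using D(3) bdd by (subst (asm) cINF_less_iff) auto
  qed
  then obtain p where p: "\<And>k. p k \<in> M" "\<And>k. (norm (x - p k))\<^sup>2 < d + inverse (real (Suc k))" by metis
  have close: "(norm (p j - p k))\<^sup>2 \<le> 2 * inverse (real (Suc j)) + 2 * inverse (real (Suc k))" for j k
  proof -
    have "(norm ((x - p j) + (x - p k)))\<^sup>2 = 4 * (norm (x - (1/2) *\<^sub>R (p j + p k)))\<^sup>2"
      by (simp add: power2_norm_eq_inner inner_diff_left inner_diff_right inner_add_left inner_add_right algebra_simps)
    moreover have "d \<le> (norm (x - (1/2) *\<^sub>R (p j + p k)))\<^sup>2" using p D by (intro dle) auto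
    ultimately show ?thesis
      using parallelogram[of "x - p j" "x - p k"] p(2)[of j] p(2)[of k] by (simp add: norm_minus_commute)
  qed
  have "Cauchy p"
  proof (rule CauchyI)
    fix e :: real assume e: "e > 0"
    obtain N where N: "inverse (real (Suc N)) < e\<^sup>2 / 4" using reals_Archimedean[of "e\<^sup>2/4"] e by auto
    have "norm (p j - p k) < e" if "j \<ge> N" "k \<ge> N" for j k
    proof -
      have "inverse (real (Suc j)) \<le> inverse (real (Suc N))" "inverse (real (Suc k)) \<le> inverse (real (Suc N))"
        using that by (auto intro!: le_imp_inverse_le)
      then have "(norm (p j - p k))\<^sup>2 < e\<^sup>2" using close[of j k] N by linarith
      then show ?thesis using e by (simp add: power2_less_imp_less)
    qed
    then show "\<exists>N. \<forall>m\<ge>N. \<forall>n\<ge>N. norm (p m - p n) < e" by blast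
  qed
  then obtain q where q: "p \<longlonglongrightarrow> q" using Cauchy_convergent convergent_def by blast
  have qM: "q \<in> M" using closed_sequentially[OF D(2) p(1) q] .
  have "(norm (x - q))\<^sup>2 \<le> d"
  proof (rule LIMSEQ_le)
    show "(\<lambda>k. (norm (x - p k))\<^sup>2) \<longlonglongrightarrow> (norm (x - q))\<^sup>2" by (intro tendsto_intros q)
    show "(\<lambda>k. d + inverse (real (Suc k))) \<longlonglongrightarrow> d" using tendsto_add[OF tendsto_const LIMSEQ_inverse_real_of_nat, of d] by simp
    show "\<exists>N. \<forall>n\<ge>N. (norm (x - p n))\<^sup>2 \<le> d + inverse (real (Suc n))" using p(2) less_imp_le by blast
  qed
  have "inner (x - q) m = 0" if m: "m \<in> M" for m
  proof -
    have *: "2 * t * inner (x - q) m \<le> t\<^sup>2 * (norm m)\<^sup>2" for t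
    proof -
      have "(norm (x - q))\<^sup>2 \<le> (norm (x - (q + t *\<^sub>R m)))\<^sup>2"
        using \<open>(norm (x - q))\<^sup>2 \<le> d\<close> dle[OF D(4)[OF qM D(8)[OF m, of t]]] by (rule order_trans)
      then show ?thesis unfolding power2_norm_eq_inner
        by (simp add: inner_diff_left inner_diff_right inner_add_left inner_add_right
            inner_commute algebra_simps power2_eq_square)
    qed
    show ?thesis
    proof (cases "m = 0")
      case False
      then have n: "(norm m)\<^sup>2 > 0" by simp
      define a b where "a = inner (x - q) m" and "b = (norm m)\<^sup>2"
      \<comment> \<open>The parameter t = a/b minimizes t^2 b - 2 t a; the minimum is
        -a^2/b.\<close>
      have "2 * (a / b) * a \<le> (a / b)\<^sup>2 * b" using *[of "a / b"] by (simp only: a_def b_def)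
      moreover have b: "b > 0" using n by (simp only: b_def)
      ultimately have "a * a / b \<le> 0" by (simp add: power2_eq_square)
      then show ?thesis using b by (auto simp: a_def divide_le_0_iff mult_le_0_iff)
    qed simp
  qed
  then show ?thesis using qM by blast
qed

lemma cinner_eq_0_iff_inner:
  assumes "csubspace M"
  shows "(\<forall>m\<in>M. cinner x m = 0) \<longleftrightarrow> (\<forall>m\<in>M. inner x m = 0)"
  using csubspaceD(3)[OF assms] by (auto simp: cinner_def complex_eq_iff)

lemma orth_proj:
  fixes x :: "'a::chilbert_space"
  assumes M: "closed_csubspace M"
  shows "orth_proj M x \<in> M" "m \<in> M \<Longrightarrow> inner (x - orth_proj M x) m = 0"
    and orth_proj_eqI: "p \<in> M \<Longrightarrow> (\<And>m. m \<in> M \<Longrightarrow> inner (x - p) m = 0) \<Longrightarrow> orth_proj M x = p"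
proof -
  note D = closed_csubspaceD[OF M]
  obtain q where q: "q \<in> M" "\<forall>m\<in>M. inner (x - q) m = 0" using orth_decomp[OF M] by blast
  have un: "p = p'" if "p \<in> M" "\<forall>m\<in>M. inner (x - p) m = 0" "p' \<in> M" "\<forall>m\<in>M. inner (x - p') m = 0" for p p'
  proof -
    have "p - p' \<in> M" using that D by blast
    with that have "inner (x - p') (p - p') = 0" "inner (x - p) (p - p') = 0" by blast+
    then have "inner (p - p') (p - p') = 0" by (simp add: inner_diff_left)
    then show ?thesis by simp
  qed
  have *: "orth_proj M x = (THE p. p \<in> M \<and> (\<forall>m\<in>M. inner (x - p) m = 0))"
    unfolding orth_proj_def cinner_eq_0_iff_inner[OF D(1)] ..
  have ex1: "\<exists>!p. p \<in> M \<and> (\<forall>m\<in>M. inner (x - p) m = 0)" using q un by blast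
  from theI'[OF ex1] show "orth_proj M x \<in> M" "m \<in> M \<Longrightarrow> inner (x - orth_proj M x) m = 0"
    by (simp_all add: *)
  show "p \<in> M \<Longrightarrow> (\<And>m. m \<in> M \<Longrightarrow> inner (x - p) m = 0) \<Longrightarrow> orth_proj M x = p"
    unfolding * by (rule the1_equality[OF ex1]) blast
qed

lemma orth_proj_ident: "closed_csubspace M \<Longrightarrow> x \<in> M \<Longrightarrow> orth_proj M x = (x::'a::chilbert_space)"
  by (rule orth_proj_eqI) auto

lemma bounded_op_orth_proj:
  assumes M: "closed_csubspace (M::'a::chilbert_space set)"
  shows "bounded_op UNIV M (orth_proj M)"
proof (rule bounded_opI[where K = 1])
  note D = closed_csubspaceD[OF M] and P = orth_proj[OF M]
  show "orth_proj M (x + y) = orth_proj M x + orth_proj M y" for x y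
  proof (rule orth_proj_eqI[OF M])
    fix m assume "m \<in> M"
    then show "inner (x + y - (orth_proj M x + orth_proj M y)) m = 0"
      using P(2)[of m x] P(2)[of m y] by (simp add: inner_diff_left inner_add_left)
  qed (intro D P)
  show "orth_proj M (c *\<^sub>C x) = c *\<^sub>C orth_proj M x" for c x
  proof (rule orth_proj_eqI[OF M])
    have "\<forall>m\<in>M. cinner (x - orth_proj M x) m = 0" using P(2) cinner_eq_0_iff_inner[OF D(1)] by blast
    then have "\<forall>m\<in>M. cinner (c *\<^sub>C x - c *\<^sub>C orth_proj M x) m = 0"
      by (simp add: cinner_scaleC_left flip: scaleC_diff_right)
    then show "inner (c *\<^sub>C x - c *\<^sub>C orth_proj M x) m = 0" if "m \<in> M" for m
      using that cinner_eq_0_iff_inner[OF D(1)] by blast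
  qed (intro D P)
  show "norm (orth_proj M x) \<le> 1 * norm x" for x
  proof -
    have "(norm (orth_proj M x))\<^sup>2 = inner x (orth_proj M x)"
      using P(2)[OF P(1), of x x] by (simp add: power2_norm_eq_inner inner_diff_left)
    also have "\<dots> \<le> norm x * norm (orth_proj M x)" by (rule norm_cauchy_schwarz)
    finally show ?thesis by (simp add: power2_eq_square) (metis mult_le_cancel_right norm_ge_zero order_le_less)
  qed
  show "orth_proj M x \<in> M" for x by (rule P)
qed

lemma bounded_op_bounded_linear:
  assumes "bounded_op UNIV N T" shows "bounded_linear T"
proof -
  obtain K where "\<And>x. norm (T x) \<le> K * norm x" using bounded_op_bound[OF assms] by auto
  then show ?thesis
    by (intro bounded_linear_intro[where K = K]) (simp_all add: bounded_opD[OF assms] mult.commute)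
qed

lemma bounded_linear_extension:
  assumes "closed_csubspace (M::'a::chilbert_space set)" "bounded_op M N T"
  shows "bounded_linear (\<lambda>x. T (orth_proj M x))"
  by (rule bounded_op_bounded_linear[OF bounded_op_comp[OF bounded_op_orth_proj[OF assms(1)] assms(2)]])

text \<open>\<open>orth_decomp\<close> concerns complex subspaces, but f is only real linear. Its
  complexification g has real part f and a closed complex kernel, whose orthogonal complement
  supplies the representing vector.\<close>

lemma riesz_representation:
  fixes f :: "'a::chilbert_space \<Rightarrow> real"
  assumes f: "bounded_linear f"
  shows "\<exists>x. \<forall>m. f m = inner m x"
proof (cases "\<forall>m. f m = 0")
  case True then show ?thesis by (intro exI[of _ 0]) simp
next
  case False
  interpret f: bounded_linear f by (rule f)
  obtain u where u: "f u \<noteq> 0" using False by blast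
  define g where "g x = complex_of_real (f x) - \<i> * complex_of_real (f (\<i> *\<^sub>C x))" for x
  have g_add: "g (x + y) = g x + g y" for x y
    by (simp add: g_def f.add scaleC_add_right algebra_simps)
  have fC: "f (c *\<^sub>C x) = Re c * f x + Im c * f (\<i> *\<^sub>C x)" for c x
    by (subst scaleC_decomp) (simp add: f.add f.scaleR)
  have g_sc: "g (c *\<^sub>C x) = c * g x" for c x
  proof -
    have "f (\<i> *\<^sub>C c *\<^sub>C x) = Re c * f (\<i> *\<^sub>C x) - Im c * f x"
      unfolding scaleC_scaleC using fC[of "\<i> * c" x] by simp
    then show ?thesis by (simp add: g_def fC[of c x] complex_eq_iff)
  qed
  have g_zero: "g 0 = 0" using g_sc[of 0 0] by simp
  define N where "N = {x. g x = 0}"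
  have ref: "Re (g x) = f x" for x by (simp add: g_def)
  have cN: "csubspace N" unfolding N_def csubspace_def using g_add g_sc g_zero by simp
  have "closed N"
  proof -
    have "continuous_on UNIV g" unfolding g_def
      by (intro continuous_intros f.continuous_on bounded_linear.continuous_on[OF bounded_linear_scaleC])
    from continuous_closed_preimage_constant[OF this] show ?thesis by (simp add: N_def)
  qed
  with cN have N: "closed_csubspace N" by (simp add: closed_csubspace_def)
  obtain p where p: "p \<in> N" "\<forall>m\<in>N. inner (u - p) m = 0" using orth_decomp[OF N] by blast
  define w where "w = u - p"
  have gw: "g w = g u" using p(1) g_add[of w p] by (simp add: w_def N_def)
  have gu: "g u \<noteq> 0" using u ref[of u] by auto
  have w0: "w \<noteq> 0" using gw gu g_zero by auto
  have ci: "\<forall>m\<in>N. cinner w m = 0" using p(2) cinner_eq_0_iff_inner[OF cN] by (simp add: w_def)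
  define x where "x = cnj (g w / cinner w w) *\<^sub>C w"
  have "g m = cinner m x" for m
  proof -
    have "m - (g m / g w) *\<^sub>C w \<in> N"
      using g_add[of "m - (g m / g w) *\<^sub>C w" "(g m / g w) *\<^sub>C w"] gw gu by (simp add: N_def g_sc)
    with ci have "cinner w (m - (g m / g w) *\<^sub>C w) = 0" by blast
    then have z: "cinner (m - (g m / g w) *\<^sub>C w) w = 0" by (subst cinner_commute) simp
    have "cinner m w = g m / g w * cinner w w"
      using cinner_add_left[of "m - (g m / g w) *\<^sub>C w" "(g m / g w) *\<^sub>C w" w] z
      by (simp add: cinner_scaleC_left)
    moreover have "cinner w w \<noteq> 0" using w0 by (simp add: cinner_self)
    ultimately show ?thesis using gw gu by (simp add: x_def cinner_scaleC_right)
  qed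
  then show ?thesis using ref Re_cinner by metis
qed

text \<open>T is controlled only on M, so Riesz is applied to T composed with the projection onto M,
  and the representing vector is projected back into M.\<close>

lemma adjoint_on:
  fixes T :: "'a::chilbert_space \<Rightarrow> 'b::complex_inner"
  assumes M: "closed_csubspace M" and T: "bounded_op M N T"
  shows "adjoint_on M T y \<in> M" "m \<in> M \<Longrightarrow> inner (T m) y = inner m (adjoint_on M T y)"
    and adjoint_on_eqI: "x \<in> M \<Longrightarrow> (\<And>m. m \<in> M \<Longrightarrow> inner (T m) y = inner m x) \<Longrightarrow> adjoint_on M T y = x"
proof -
  note D = closed_csubspaceD[OF M]
  have un: "x = x'" if "x \<in> M" "\<forall>m\<in>M. inner (T m) y = inner m x" "x' \<in> M" "\<forall>m\<in>M. inner (T m) y = inner m x'" for x x'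
  proof -
    have "x - x' \<in> M" using that D by blast
    with that have "inner (x - x') x = inner (x - x') x'" by metis
    then have "inner (x - x') (x - x') = 0" by (simp add: inner_diff_right)
    then show ?thesis by simp
  qed
  have ex: "\<exists>x. x \<in> M \<and> (\<forall>m\<in>M. inner (T m) y = inner m x)"
  proof -
    have "bounded_linear (\<lambda>x. inner (T (orth_proj M x)) y)"
      by (intro bounded_linear_inner_left_comp bounded_linear_extension[OF M T])
    from riesz_representation[OF this] obtain z where z: "\<And>m. inner (T (orth_proj M m)) y = inner m z" by blast
    have "inner (T m) y = inner m (orth_proj M z)" if m: "m \<in> M" for m
      using z[of m] orth_proj_ident[OF M m] orth_proj(2)[OF M m, of z] by (simp add: inner_diff_left inner_diff_right inner_commute[of _ m])
    then show ?thesis using orth_proj(1)[OF M] by blast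
  qed
  have *: "adjoint_on M T y = (THE x. x \<in> M \<and> (\<forall>m\<in>M. inner (T m) y = inner m x))"
    unfolding adjoint_on_def cinner_eq_iff_inner[OF D(1) T] ..
  have ex1: "\<exists>!x. x \<in> M \<and> (\<forall>m\<in>M. inner (T m) y = inner m x)" using ex un by blast
  from theI'[OF ex1, folded *] show "adjoint_on M T y \<in> M" "m \<in> M \<Longrightarrow> inner (T m) y = inner m (adjoint_on M T y)"
    by blast+
  show "x \<in> M \<Longrightarrow> (\<And>m. m \<in> M \<Longrightarrow> inner (T m) y = inner m x) \<Longrightarrow> adjoint_on M T y = x"
    unfolding * by (rule the1_equality[OF ex1]) blast
qed

lemma inner_ext:
  assumes "csubspace M" "x \<in> M" "y \<in> M" "\<And>m. m \<in> M \<Longrightarrow> inner m x = inner m y"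
  shows "x = y"
proof -
  have "inner (x - y) (x - y) = 0" using assms(4)[OF csubspaceD(5)[OF assms(1-3)]] by (simp add: inner_diff_right)
  then show ?thesis by simp
qed

lemma bounded_op_adjoint:
  fixes T :: "'a::chilbert_space \<Rightarrow> 'b::complex_inner"
  assumes M: "closed_csubspace M" and T: "bounded_op M N T"
  shows "bounded_op UNIV M (adjoint_on M T)"
proof -
  note D = closed_csubspaceD[OF M] and A = adjoint_on[OF M T]
  obtain K where K: "K > 0" "\<And>x. x \<in> M \<Longrightarrow> norm (T x) \<le> K * norm x"
    using bounded_op_bound[OF T] by blast
  have ci: "cinner (T m) y = cinner m (adjoint_on M T y)" if "m \<in> M" for m y
    using that cinner_eq_iff_inner[OF D(1) T] A(2) by blast
  show ?thesis
  proof (rule bounded_opI[where K = K])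
    show "adjoint_on M T (x + y) = adjoint_on M T x + adjoint_on M T y" for x y
      by (rule adjoint_on_eqI[OF M T D(4)[OF A(1) A(1)]]) (simp add: A(2) inner_add_right)
    show "adjoint_on M T (c *\<^sub>C x) = c *\<^sub>C adjoint_on M T x" for c x
    proof (rule adjoint_on_eqI[OF M T D(5)[OF A(1)]])
      show "inner (T m) (c *\<^sub>C x) = inner m (c *\<^sub>C adjoint_on M T x)" if "m \<in> M" for m
        using ci[OF that, of x] by (metis Re_cinner cinner_scaleC_right)
    qed
    show "norm (adjoint_on M T y) \<le> K * norm y" for y
    proof -
      let ?a = "adjoint_on M T y"
      have "(norm ?a)\<^sup>2 = inner (T ?a) y"
        using A(2)[of ?a y] A(1)[of y] by (simp add: power2_norm_eq_inner)
      also have "\<dots> \<le> norm (T ?a) * norm y" by (rule norm_cauchy_schwarz)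
      also have "\<dots> \<le> K * norm ?a * norm y" by (intro mult_right_mono K A) simp
      finally have "norm ?a * norm ?a \<le> norm ?a * (K * norm y)" by (simp add: power2_eq_square mult_ac)
      then show ?thesis using K(1) by (cases "?a = 0") auto
    qed
  qed (rule A)
qed

lemma bounded_op_adjoint':
  fixes T :: "'a::chilbert_space \<Rightarrow> 'b::complex_inner"
  shows "closed_csubspace M \<Longrightarrow> bounded_op M N T \<Longrightarrow> bounded_op N M (adjoint_on M T)"
  by (rule bounded_op_mono[OF bounded_op_adjoint]) (auto simp: adjoint_on)

lemma adjoint_adjoint:
  fixes T :: "'a::chilbert_space \<Rightarrow> 'b::chilbert_space"
  assumes M: "closed_csubspace M" and N: "closed_csubspace N" and T: "bounded_op M N T" and x: "x \<in> M"
  shows "adjoint_on N (adjoint_on M T) x = T x"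
proof (rule adjoint_on_eqI[OF N bounded_op_adjoint'[OF M T]])
  show "inner (adjoint_on M T m) x = inner m (T x)" for m
    using adjoint_on(2)[OF M T x, of m] by (simp add: inner_commute)
qed (rule bounded_opD(1)[OF T x])

lemma isometric_op_inner:
  assumes U: "isometric_op M N U" and M: "csubspace M" and x: "x \<in> M" "y \<in> M"
  shows "inner (U x) (U y) = inner x y"
proof -
  have b: "bounded_op M N U" and n: "\<And>x. x \<in> M \<Longrightarrow> norm (U x) = norm x"
    using U by (auto simp: isometric_op_def)
  have "U x + U y = U (x + y)" "U x - U y = U (x - y)" using bounded_opD(2)[OF b x] bounded_opD(5)[OF b M x] by simp_all
  then show ?thesis
    using polarization[of "U x" "U y"] polarization[of x y] n[OF csubspaceD(2)[OF M x]]
      n[OF csubspaceD(5)[OF M x]] by simp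
qed

lemma isometric_op_adjoint_cancel:
  fixes U :: "'a::chilbert_space \<Rightarrow> 'b::complex_inner"
  assumes U: "isometric_op M N U" and M: "closed_csubspace M" and x: "x \<in> M"
  shows "adjoint_on M U (U x) = x"
proof (rule adjoint_on_eqI[OF M _ x])
  show "bounded_op M N U" using U by (simp add: isometric_op_def)
qed (rule isometric_op_inner[OF U closed_csubspaceD(1)[OF M] _ x])

lemma csubspace_closure:
  assumes "csubspace M" shows "csubspace (closure M)"
proof -
  have 1: "x + y \<in> closure M" if "x \<in> closure M" "y \<in> closure M" for x y
  proof -
    from that(1) obtain f where "(\<forall>n. f n \<in> M) \<and> f \<longlonglongrightarrow> x" unfolding closure_sequential by blast
    moreover from that(2) obtain g where "(\<forall>n. g n \<in> M) \<and> g \<longlonglongrightarrow> y" unfolding closure_sequential by blast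
    ultimately show ?thesis unfolding closure_sequential
      by (intro exI[of _ "\<lambda>n. f n + g n"]) (auto intro!: tendsto_intros csubspaceD[OF assms])
  qed
  have 2: "c *\<^sub>C x \<in> closure M" if "x \<in> closure M" for c x
  proof -
    from that obtain f where "(\<forall>n. f n \<in> M) \<and> f \<longlonglongrightarrow> x" unfolding closure_sequential by blast
    then show ?thesis unfolding closure_sequential
      by (intro exI[of _ "\<lambda>n. c *\<^sub>C f n"])
        (auto intro!: bounded_linear.tendsto[OF bounded_linear_scaleC] csubspaceD[OF assms])
  qed
  show ?thesis unfolding csubspace_def using 1 2 csubspaceD(1)[OF assms] closure_subset[of M] by blast
qed

lemma closed_csubspace_closure_image:
  assumes M: "csubspace M" and T: "bounded_op M N T"
  shows "closed_csubspace (closure (T ` M))"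
proof -
  have "csubspace (T ` M)" unfolding csubspace_def
  proof (intro conjI ballI allI)
    show "0 \<in> T ` M" using bounded_opD(7)[OF T M] csubspaceD(1)[OF M] by (metis image_eqI)
  next
    fix x y assume "x \<in> T ` M" "y \<in> T ` M"
    then obtain a b where "a \<in> M" "b \<in> M" "x = T a" "y = T b" by blast
    then show "x + y \<in> T ` M" by (intro image_eqI[of _ _ "a + b"]) (simp_all add: bounded_opD(2)[OF T] csubspaceD[OF M])
  next
    fix c x assume "x \<in> T ` M"
    then obtain a where "a \<in> M" "x = T a" by blast
    then show "c *\<^sub>C x \<in> T ` M" by (intro image_eqI[of _ _ "c *\<^sub>C a"]) (simp_all add: bounded_opD(3)[OF T] csubspaceD[OF M])
  qed
  from csubspace_closure[OF this] show ?thesis by (simp add: closed_csubspace_def)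
qed

section \<open>Positive square roots\<close>

text \<open>Polarization: the real inner product of Q u and i u vanishes at x, at w and at x + w,
  where w = -i y is chosen so that i w = y.\<close>

lemma positive_imp_selfadjoint:
  assumes M: "csubspace M" and Q: "bounded_op M M Q"
    and im: "\<And>x. x \<in> M \<Longrightarrow> Im (cinner (Q x) x) = 0" and xy: "x \<in> M" "y \<in> M"
  shows "inner (Q x) y = inner x (Q y)"
proof -
  have z: "inner (Q u) (\<i> *\<^sub>C u) = 0" if "u \<in> M" for u using im[OF that] by (simp add: cinner_def)
  define w where "w = - (\<i> *\<^sub>C y)"
  have w: "w \<in> M" "\<i> *\<^sub>C w = y" "Q w = - (\<i> *\<^sub>C Q y)"
    using csubspaceD(3)[OF M xy(2), of \<i>]
    by (simp_all add: w_def csubspaceD(4)[OF M] scaleC_minus_right scaleC_ii_ii bounded_opD(3)[OF Q xy(2)] bounded_opD(6)[OF Q M])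
  have "inner (Q (x + w)) (\<i> *\<^sub>C (x + w)) = 0" using z csubspaceD(2)[OF M xy(1) w(1)] by blast
  then have "inner (Q x) y + inner (Q w) (\<i> *\<^sub>C x) = 0"
    using z[OF xy(1)] z[OF w(1)] w(2)
    by (simp add: bounded_opD(2)[OF Q xy(1) w(1)] scaleC_add_right inner_add_left inner_add_right)
  then show ?thesis by (simp add: w(3) inner_scaleC_ii inner_commute)
qed

lemma selfadjoint_Im_cinner:
  assumes M: "csubspace M" and Q: "bounded_op M M Q"
    and sa: "\<And>x y. x \<in> M \<Longrightarrow> y \<in> M \<Longrightarrow> inner (Q x) y = inner x (Q y)" and x: "x \<in> M"
  shows "Im (cinner (Q x) x) = 0"
proof -
  have "inner (Q x) (\<i> *\<^sub>C x) = inner x (\<i> *\<^sub>C Q x)"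
    using sa[OF x csubspaceD(3)[OF M x]] bounded_opD(3)[OF Q x] by simp
  also have "\<dots> = - inner (Q x) (\<i> *\<^sub>C x)" using inner_ii_left[of x "Q x"] by (simp add: inner_commute)
  finally show ?thesis by (simp add: cinner_def)
qed

text \<open>The form at x + t Q x is nonnegative for every real t but has no constant term, which
  forces its linear coefficient, twice the squared norm of Q x, to vanish.\<close>

lemma positive_op_kernel:
  assumes M: "csubspace M" and Q: "bounded_op M M Q"
    and sa: "\<And>x y. x \<in> M \<Longrightarrow> y \<in> M \<Longrightarrow> inner (Q x) y = inner x (Q y)"
    and pos: "\<And>x. x \<in> M \<Longrightarrow> 0 \<le> inner (Q x) x" and x: "x \<in> M" "inner (Q x) x = 0"
  shows "Q x = 0"
proof -
  define a b where "a = inner (Q x) (Q x)" and "b = inner (Q (Q x)) (Q x)"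
  have Qx: "Q x \<in> M" using bounded_opD(1)[OF Q x(1)] .
  have b: "b \<ge> 0" using pos[OF Qx] by (simp add: b_def)
  have "0 \<le> 2 * t * a + t\<^sup>2 * b" for t
  proof -
    have tx: "t *\<^sub>R Q x \<in> M" using csubspace_scaleR[OF M Qx] .
    have "0 \<le> inner (Q (x + t *\<^sub>R Q x)) (x + t *\<^sub>R Q x)" using pos csubspaceD(2)[OF M x(1) tx] by blast
    also have "Q (x + t *\<^sub>R Q x) = Q x + t *\<^sub>R Q (Q x)"
      using bounded_opD(2)[OF Q x(1) tx] bounded_opD(4)[OF Q Qx] by simp
    also have "inner (Q x + t *\<^sub>R Q (Q x)) (x + t *\<^sub>R Q x) = 2 * t * a + t\<^sup>2 * b"
      using x(2) sa[OF Qx x(1)]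
      by (simp add: inner_add_left inner_add_right a_def b_def power2_eq_square algebra_simps)
    finally show ?thesis .
  qed
  \<comment> \<open>A negative t small enough for the linear term to dominate; the 1 keeps the
    denominator positive when b = 0.\<close>
  from this[of "- a / (b + 1)"] have "0 \<le> (- a / (b + 1)) * (2 * a - a / (b + 1) * b)"
    by (simp add: power2_eq_square algebra_simps)
  moreover have "2 * a - a / (b + 1) * b \<ge> a"
  proof -
    have "a / (b + 1) * b \<le> a" using b by (simp add: a_def field_simps)
    then show ?thesis by simp
  qed
  moreover have "a \<ge> 0" by (simp add: a_def)
  ultimately have "a = 0" using b
    by (smt (verit) divide_pos_pos divide_minus_left mult_pos_pos mult_minus_left)
  then show ?thesis by (simp add: a_def)
qed

text \<open>A competing root Q commutes with A = Q Q, hence with D by \<open>comm\<close>, a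
  property of roots that are limits of polynomials in A. Then (D + Q)(D - Q) = 0, so both
  nonnegative forms vanish on the range of D - Q. The value 0 off M makes D unique as a total
  function.\<close>

lemma positive_sqrt_eqI:
  assumes M: "csubspace M" and D: "bounded_op M M D"
    and sa: "\<And>x y. x \<in> M \<Longrightarrow> y \<in> M \<Longrightarrow> inner (D x) y = inner x (D y)"
    and pos: "\<And>x. x \<in> M \<Longrightarrow> 0 \<le> inner (D x) x"
    and sq: "\<And>x. x \<in> M \<Longrightarrow> D (D x) = A x"
    and off: "\<And>x. x \<notin> M \<Longrightarrow> D x = 0"
    and comm: "\<And>Q x. bounded_op M M Q \<Longrightarrow> (\<And>y. y \<in> M \<Longrightarrow> Q (A y) = A (Q y)) \<Longrightarrow> x \<in> M \<Longrightarrow> Q (D x) = D (Q x)"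
  shows "positive_sqrt M A = D"
  unfolding positive_sqrt_def
proof (rule the_equality)
  show "bounded_op M M D \<and> (\<forall>x\<in>M. Im (cinner (D x) x) = 0 \<and> 0 \<le> Re (cinner (D x) x)) \<and>
    (\<forall>x\<in>M. D (D x) = A x) \<and> (\<forall>x. x \<notin> M \<longrightarrow> D x = 0)"
    using D pos sq off selfadjoint_Im_cinner[OF M D sa] by (simp add: Re_cinner)
next
  fix Q assume Qa: "bounded_op M M Q \<and> (\<forall>x\<in>M. Im (cinner (Q x) x) = 0 \<and> 0 \<le> Re (cinner (Q x) x)) \<and>
    (\<forall>x\<in>M. Q (Q x) = A x) \<and> (\<forall>x. x \<notin> M \<longrightarrow> Q x = 0)"
  then have Q: "bounded_op M M Q" and Qsq: "\<And>x. x \<in> M \<Longrightarrow> Q (Q x) = A x"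
    and Qpos: "\<And>x. x \<in> M \<Longrightarrow> 0 \<le> inner (Q x) x" and Qim: "\<And>x. x \<in> M \<Longrightarrow> Im (cinner (Q x) x) = 0"
    and Qoff: "\<And>x. x \<notin> M \<Longrightarrow> Q x = 0" by (auto simp: Re_cinner)
  note Qm = bounded_opD(1)[OF Q] and Dm = bounded_opD(1)[OF D]
  have Qsa: "inner (Q x) y = inner x (Q y)" if "x \<in> M" "y \<in> M" for x y
    using positive_imp_selfadjoint[OF M Q Qim that] .
  have QD: "Q (D x) = D (Q x)" if "x \<in> M" for x
  proof (rule comm[OF Q _ that])
    show "Q (A y) = A (Q y)" if "y \<in> M" for y using Qsq[OF that] Qsq[OF Qm[OF that]] by simp
  qed
  have "D x = Q x" if x: "x \<in> M" for x
  proof -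
    define y where "y = D x - Q x"
    have y: "y \<in> M" using csubspaceD(5)[OF M Dm[OF x] Qm[OF x]] by (simp add: y_def)
    have "D y + Q y = 0"
      using bounded_opD(5)[OF D M Dm[OF x] Qm[OF x]] bounded_opD(5)[OF Q M Dm[OF x] Qm[OF x]] QD[OF x] sq[OF x] Qsq[OF x]
      by (simp add: y_def)
    then have "inner (D y) y + inner (Q y) y = 0" by (metis inner_add_left inner_zero_left)
    with pos[OF y] Qpos[OF y] have "inner (D y) y = 0" "inner (Q y) y = 0" by linarith+
    then have "D y = 0" "Q y = 0"
      using positive_op_kernel[OF M D sa pos y] positive_op_kernel[OF M Q Qsa Qpos y] by auto
    then have "inner y y = 0"
      using sa[OF x y] Qsa[OF x y] by (simp add: y_def inner_diff_left)
    then show ?thesis by (simp add: y_def)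
  qed
  then show "Q = D" using off Qoff by (metis ext)
qed

text \<open>The Taylor coefficients of \<open>sqrt (1 - x)\<close> have absolute sum at most 2 because all but
  the first are negative and the partial sums are positive.\<close>

definition sqrt_coeff :: "nat \<Rightarrow> real" where "sqrt_coeff k = (1/2 gchoose k) * (- 1) ^ k"

lemma sqrt_coeff_0 [simp]: "sqrt_coeff 0 = 1" by (simp add: sqrt_coeff_def)

text \<open>The partial sums are single binomial coefficients up to sign. Consecutive ones have
  ratio (m + 1/2)/(m + 1), between 0 and 1, so they stay nonnegative and decrease.\<close>

lemma sqrt_coeff_partial_sum:
  defines "b \<equiv> \<lambda>m. \<Sum>k\<le>m. sqrt_coeff k"
  shows "b m \<ge> 0" "sqrt_coeff (Suc m) \<le> 0"
proof -
  have b: "b m = (- 1) ^ m * (- 1/2 gchoose m)" for m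
    unfolding b_def sqrt_coeff_def using gbinomial_sum_lower_neg[of "1/2::real" m] by simp
  have step: "b (Suc m) = b m * ((real m + 1/2) / (real m + 1))" for m
  proof -
    have "(- 1/2 :: real) * (- 1/2 gchoose m) = real m * (- 1/2 gchoose m) + real (Suc m) * (- 1/2 gchoose Suc m)"
      by (rule gbinomial_mult_1)
    then have "(- 1/2 gchoose Suc m) * (real m + 1) = - ((- 1/2 :: real) gchoose m) * (real m + 1/2)"
      by (simp add: algebra_simps)
    then have "(- 1/2 gchoose Suc m) = - ((- 1/2 :: real) gchoose m) * (real m + 1/2) / (real m + 1)"
      by (subst eq_divide_eq) simp
    then show ?thesis by (simp add: b)
  qed
  show pos: "b m \<ge> 0" for m by (induction m) (simp_all add: step, simp add: b_def)
  have "b (Suc m) \<le> b m * 1" unfolding step by (intro mult_left_mono pos) simp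
  then show "sqrt_coeff (Suc m) \<le> 0" by (simp add: b_def)
qed

lemma sqrt_coeff_abs_sum: "(\<Sum>k<m. \<bar>sqrt_coeff k\<bar>) \<le> 2"
proof (cases m)
  case (Suc n)
  have "(\<Sum>k\<le>n. \<bar>sqrt_coeff k\<bar>) = 2 - (\<Sum>k\<le>n. sqrt_coeff k)"
    by (induction n) (use sqrt_coeff_partial_sum(2) in auto)
  then show ?thesis using sqrt_coeff_partial_sum(1)[of n] Suc by (simp add: lessThan_Suc_atMost)
qed simp

lemma summable_sqrt_coeff: "summable (\<lambda>k. \<bar>sqrt_coeff k\<bar>)"
  by (rule summableI_nonneg_bounded[OF _ sqrt_coeff_abs_sum]) simp

text \<open>Squaring sqrt (1 - x) leaves 1 - x: Vandermonde with 1/2 + 1/2 = 1.\<close>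

lemma sqrt_coeff_convolution:
  "(\<Sum>k\<le>i. sqrt_coeff k * sqrt_coeff (i - k)) = (if i = 0 then 1 else if i = 1 then - 1 else 0)"
proof -
  have "(\<Sum>k\<le>i. sqrt_coeff k * sqrt_coeff (i - k)) = (\<Sum>k\<le>i. (- 1) ^ i * ((1/2 gchoose k) * (1/2 gchoose (i - k))))"
  proof (rule sum.cong)
    fix k assume "k \<in> {..i}"
    then have "(- 1::real) ^ i = (- 1) ^ k * (- 1) ^ (i - k)" by (simp flip: power_add)
    then show "sqrt_coeff k * sqrt_coeff (i - k) = (- 1) ^ i * ((1/2 gchoose k) * (1/2 gchoose (i - k)))"
      by (simp add: sqrt_coeff_def)
  qed simp
  also have "\<dots> = (- 1) ^ i * (1 gchoose i)"
    using gbinomial_Vandermonde[of "1/2::real" "1/2" i] by (simp add: atLeast0AtMost flip: sum_distrib_left)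
  also have "(1 gchoose i) = real (1 choose i)" using binomial_gbinomial[of 1 i, where 'a = real] by simp
  finally show ?thesis by (auto simp: less_Suc_eq binomial_eq_0 intro: neq0_conv[THEN iffD1] le_neq_implies_less)
qed

text \<open>The power series of sqrt (1 - x) at B. Its coefficients are absolutely summable, so B
  may have norm 1. The last property is what \<open>positive_sqrt_eqI\<close> needs for
  uniqueness.\<close>

lemma contraction_sqrt:
  fixes B :: "'a::chilbert_space \<Rightarrow> 'a"
  assumes B: "bounded_op UNIV UNIV B" and le: "\<And>x. norm (B x) \<le> norm x"
    and sa: "\<And>x y. inner (B x) y = inner x (B y)"
  obtains D where "bounded_op UNIV UNIV D" "\<And>x y. inner (D x) y = inner x (D y)" "\<And>x. 0 \<le> inner (D x) x"
    "\<And>x. D (D x) = x - B x"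
    "\<And>Q x. bounded_op UNIV UNIV Q \<Longrightarrow> (\<And>y. Q (B y) = B (Q y)) \<Longrightarrow> Q (D x) = D (Q x)"
proof
  define D where "D x = (\<Sum>k. sqrt_coeff k *\<^sub>R (B ^^ k) x)" for x
  have Bk: "bounded_op UNIV UNIV (B ^^ k)" for k
    by (induction k) (use bounded_op_id[of UNIV] bounded_op_comp[OF _ B] in \<open>auto simp: id_def o_def\<close>)
  have Bkle: "norm ((B ^^ k) x) \<le> norm x" for k x
    by (induction k) (use le order_trans in auto)
  have Bksa: "inner ((B ^^ k) x) y = inner x ((B ^^ k) y)" for k x y
    by (induction k arbitrary: x y) (simp_all add: sa funpow_swap1)
  have nle: "norm (sqrt_coeff k *\<^sub>R (B ^^ k) x) \<le> \<bar>sqrt_coeff k\<bar> * norm x" for k x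
    using mult_left_mono[OF Bkle abs_ge_zero] by simp
  have sm: "summable (\<lambda>k. sqrt_coeff k *\<^sub>R (B ^^ k) x)" for x
    by (rule summable_comparison_test'[OF summable_mult2[OF summable_sqrt_coeff] nle])
  have sums: "(\<lambda>k. sqrt_coeff k *\<^sub>R (B ^^ k) x) sums D x" for x
    unfolding D_def by (rule summable_sums[OF sm])
  define p where "p m x = (\<Sum>k<m. sqrt_coeff k *\<^sub>R (B ^^ k) x)" for m x
  have p: "(\<lambda>m. p m x) \<longlonglongrightarrow> D x" for x using sums unfolding p_def sums_def .
  have ple: "norm (p m x) \<le> 2 * norm x" for m x
  proof -
    have "norm (p m x) \<le> (\<Sum>k<m. \<bar>sqrt_coeff k\<bar> * norm x)" unfolding p_def by (rule sum_norm_le) (rule nle)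
    also have "\<dots> \<le> 2 * norm x" unfolding sum_distrib_right[symmetric]
      by (intro mult_right_mono sqrt_coeff_abs_sum) simp
    finally show ?thesis .
  qed
  have padd: "p m (x + y) = p m x + p m y" for m x y
    by (simp add: p_def bounded_opD(2)[OF Bk] scaleR_add_right sum.distrib)
  have psc: "p m (c *\<^sub>C x) = c *\<^sub>C p m x" for m c x
    unfolding p_def by (induction m) (simp_all add: bounded_opD(3)[OF Bk] scaleC_add_right scaleC_scaleR)
  show "bounded_op UNIV UNIV D"
  proof (rule bounded_opI[where K = 2])
    show "D (x + y) = D x + D y" for x y
      using LIMSEQ_unique[OF p[of "x + y"]] tendsto_add[OF p[of x] p[of y]] by (simp add: padd)
    show "D (c *\<^sub>C x) = c *\<^sub>C D x" for c x
      using LIMSEQ_unique[OF p[of "c *\<^sub>C x"]] bounded_linear.tendsto[OF bounded_linear_scaleC p[of x], of c] by (simp add: psc)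
    show "norm (D x) \<le> 2 * norm x" for x
      by (rule LIMSEQ_le_const2[OF tendsto_norm[OF p]]) (use ple in blast)
  qed simp
  have psa: "inner (p m x) y = inner x (p m y)" for m x y
    by (simp add: p_def inner_sum_left inner_sum_right Bksa)
  show "inner (D x) y = inner x (D y)" for x y
    using LIMSEQ_unique[OF tendsto_inner[OF p[of x] tendsto_const[of y]]] tendsto_inner[OF tendsto_const[of x] p[of y]]
    by (simp add: psa)
  show "0 \<le> inner (D x) x" for x
  proof (rule LIMSEQ_le_const[OF tendsto_inner[OF p tendsto_const]])
    \<comment> \<open>All coefficients but the first are nonpositive, so replacing each inner
      product by its upper bound, the squared norm of x, only lowers the sum.\<close>
    have "(\<Sum>k\<le>m. sqrt_coeff k) * (norm x)\<^sup>2 \<le> inner (p (Suc m) x) x" for m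
    proof (induction m)
      case 0 show ?case by (simp add: p_def power2_norm_eq_inner)
    next
      case (Suc m)
      have "inner ((B ^^ Suc m) x) x \<le> norm ((B ^^ Suc m) x) * norm x" by (rule norm_cauchy_schwarz)
      also have "\<dots> \<le> (norm x)\<^sup>2" unfolding power2_eq_square by (intro mult_right_mono Bkle) simp
      finally have "sqrt_coeff (Suc m) * (norm x)\<^sup>2 \<le> sqrt_coeff (Suc m) * inner ((B ^^ Suc m) x) x"
        by (rule mult_left_mono_neg[OF _ sqrt_coeff_partial_sum(2)])
      then show ?case using Suc by (simp add: p_def inner_add_left algebra_simps)
    qed
    then have "0 \<le> inner (p (Suc m) x) x" for m
      using sqrt_coeff_partial_sum(1)[of m] by (meson mult_nonneg_nonneg order_trans zero_le_power2)
    then show "\<exists>N. \<forall>n\<ge>N. 0 \<le> inner (p n x) x" by (metis Suc_le_D)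
  qed
  show "Q (D x) = D (Q x)" if Q: "bounded_op UNIV UNIV Q" and c: "\<And>y. Q (B y) = B (Q y)" for Q x
  proof -
    interpret Q: bounded_linear Q by (rule bounded_op_bounded_linear[OF Q])
    have "Q ((B ^^ k) y) = (B ^^ k) (Q y)" for k y by (induction k) (simp_all add: c)
    then have "(\<lambda>m. p m (Q x)) = (\<lambda>m. Q (p m x))" by (simp add: p_def Q.sum Q.scaleR)
    then show ?thesis using LIMSEQ_unique[OF p[of "Q x"]] Q.tendsto[OF p[of x]] by metis
  qed
  show "D (D x) = x - B x" for x
  proof -
    define g where "g k l = \<bar>sqrt_coeff k\<bar> * \<bar>sqrt_coeff l\<bar>" for k l
    define e where "e k l = (sqrt_coeff k * sqrt_coeff l) *\<^sub>R (B ^^ (k + l)) x" for k l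
    \<comment> \<open>\<open>?S\<close> indexes the terms of the squared partial sum and
      \<open>?T\<close> those of total degree below m, which already add up to x - B x once m is at
      least 2. The rest is bounded by the same difference for the absolute coefficients, and this
      tends to 0 by the Cauchy product.\<close>
    let ?S = "\<lambda>m::nat. {..<m} \<times> {..<m}" and ?T = "\<lambda>m::nat. {(i, j). i + j < m}"
    have sub: "?T m \<subseteq> ?S m" for m by auto
    have fin: "finite (?S m)" for m by simp
    have pp: "p m (p m x) = (\<Sum>(k, l)\<in>?S m. e k l)" for m
    proof -
      have "(B ^^ k) (p m x) = (\<Sum>l<m. sqrt_coeff l *\<^sub>R (B ^^ (k + l)) x)" for k
        unfolding p_def funpow_add
        using bounded_op_bounded_linear[OF Bk, of k] by (simp add: linear_simps bounded_linear.linear linear_sum linear_scale)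
      then show ?thesis
        by (subst p_def) (simp add: scaleR_sum_right e_def flip: sum.cartesian_product)
    qed
    have tri: "(\<Sum>(k, l)\<in>?T m. e k l) = x - B x" if "m \<ge> 2" for m
    proof -
      have "(\<Sum>(k, l)\<in>?T m. e k l) = (\<Sum>i<m. \<Sum>k\<le>i. e k (i - k))" by (rule sum.triangle_reindex)
      also have "\<dots> = (\<Sum>i<m. (if i = 0 then 1 else if i = 1 then - 1 else 0) *\<^sub>R (B ^^ i) x)"
        by (intro sum.cong refl) (simp add: e_def flip: scaleR_sum_left sqrt_coeff_convolution)
      also have "\<dots> = (\<Sum>i\<in>{0,1}. (if i = 0 then 1 else if i = 1 then - 1 else 0) *\<^sub>R (B ^^ i) x)"
        using that by (intro sum.mono_neutral_right) auto
      also have "\<dots> = x - B x" by simp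
      finally show ?thesis .
    qed
    have bound: "norm (p m (p m x) - (x - B x)) \<le> ((\<Sum>k<m. \<bar>sqrt_coeff k\<bar>)\<^sup>2 - (\<Sum>i<m. \<Sum>k\<le>i. g k (i - k))) * norm x" if "m \<ge> 2" for m
    proof -
      have "p m (p m x) - (x - B x) = (\<Sum>(k, l)\<in>?S m - ?T m. e k l)"
        unfolding pp tri[OF that, symmetric] by (rule sum_diff[OF fin sub, symmetric])
      also have "norm \<dots> \<le> (\<Sum>(k, l)\<in>?S m - ?T m. g k l * norm x)"
        by (rule sum_norm_le) (auto simp: e_def g_def abs_mult intro!: mult_left_mono Bkle)
      also have "\<dots> = ((\<Sum>(k, l)\<in>?S m. g k l) - (\<Sum>(k, l)\<in>?T m. g k l)) * norm x"
        unfolding sum_diff[OF fin sub, symmetric] by (simp add: case_prod_unfold sum_distrib_right)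
      also have "(\<Sum>(k, l)\<in>?S m. g k l) = (\<Sum>k<m. \<bar>sqrt_coeff k\<bar>)\<^sup>2"
        by (simp add: power2_eq_square sum_product g_def sum.cartesian_product)
      also have "(\<Sum>(k, l)\<in>?T m. g k l) = (\<Sum>i<m. \<Sum>k\<le>i. g k (i - k))" by (rule sum.triangle_reindex)
      finally show ?thesis .
    qed
    have "(\<lambda>m. ((\<Sum>k<m. \<bar>sqrt_coeff k\<bar>)\<^sup>2 - (\<Sum>i<m. \<Sum>k\<le>i. g k (i - k))) * norm x)
      \<longlonglongrightarrow> ((\<Sum>k. \<bar>sqrt_coeff k\<bar>)\<^sup>2 - (\<Sum>k. \<bar>sqrt_coeff k\<bar>) * (\<Sum>k. \<bar>sqrt_coeff k\<bar>)) * norm x"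
      using Cauchy_product_sums[of "\<lambda>k. \<bar>sqrt_coeff k\<bar>" "\<lambda>k. \<bar>sqrt_coeff k\<bar>"] summable_sqrt_coeff
      unfolding g_def by (intro tendsto_intros summable_LIMSEQ) (simp_all add: sums_def)
    then have lim0: "(\<lambda>m. ((\<Sum>k<m. \<bar>sqrt_coeff k\<bar>)\<^sup>2 - (\<Sum>i<m. \<Sum>k\<le>i. g k (i - k))) * norm x) \<longlonglongrightarrow> 0"
      by (simp add: power2_eq_square)
    have "(\<lambda>m. p m (p m x) - (x - B x)) \<longlonglongrightarrow> 0"
      by (rule Lim_null_comparison[OF eventually_mono[OF eventually_ge_at_top[of 2] bound] lim0])
    then have 1: "(\<lambda>m. p m (p m x)) \<longlonglongrightarrow> x - B x" by (simp only: LIM_zero_iff)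
    have pdiff: "p m (a - b) = p m a - p m b" for m a b
      using padd[of m "a - b" b] by simp
    \<comment> \<open>The uniform bound on the \<open>p m\<close> allows index and argument to
      converge at the same time.\<close>
    have "(\<lambda>m. p m (p m x - D x)) \<longlonglongrightarrow> 0"
    proof (rule Lim_null_comparison[OF always_eventually])
      show "\<forall>m. norm (p m (p m x - D x)) \<le> 2 * norm (p m x - D x)" using ple by blast
      show "(\<lambda>m. 2 * norm (p m x - D x)) \<longlonglongrightarrow> 0"
        using p[of x] by (intro tendsto_mult_right_zero tendsto_norm_zero) (simp only: LIM_zero_iff)
    qed
    from tendsto_add[OF this p[of "D x"]] have "(\<lambda>m. p m (p m x)) \<longlonglongrightarrow> D (D x)" by (simp add: pdiff)
    then show ?thesis using 1 LIMSEQ_unique by blast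
  qed
qed

section \<open>Defect operators of contractions\<close>

lemma norm_adjoint_on_contraction:
  fixes P :: "'a::chilbert_space \<Rightarrow> 'a"
  assumes P: "bounded_op UNIV UNIV P" and le: "\<And>x. norm (P x) \<le> norm x"
  shows "norm (adjoint_on UNIV P x) \<le> norm x"
proof -
  let ?a = "adjoint_on UNIV P x"
  have "(norm ?a)\<^sup>2 = inner (P ?a) x"
    using adjoint_on(2)[OF closed_csubspace_UNIV P, of ?a x] by (simp add: power2_norm_eq_inner)
  also have "\<dots> \<le> norm (P ?a) * norm x" by (rule norm_cauchy_schwarz)
  also have "\<dots> \<le> norm ?a * norm x" by (intro mult_right_mono le) simp
  finally show ?thesis by (cases "?a = 0") (simp_all add: power2_eq_square)
qed

lemma defect_op_contraction:
  fixes P :: "'a::chilbert_space \<Rightarrow> 'a"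
  assumes P: "bounded_op UNIV UNIV P" and le: "\<And>x. norm (P x) \<le> norm x"
  defines "D \<equiv> defect_op UNIV P"
  shows "bounded_op UNIV UNIV D" "\<And>x y. inner (D x) y = inner x (D y)"
    "\<And>x. D (D x) = x - adjoint_on UNIV P (P x)"
    "closed_csubspace (defect_space UNIV P)"
proof -
  note A = adjoint_on[OF closed_csubspace_UNIV P]
  define B where "B x = adjoint_on UNIV P (P x)" for x
  have B: "bounded_op UNIV UNIV B"
    unfolding B_def by (rule bounded_op_comp[OF P bounded_op_adjoint[OF closed_csubspace_UNIV P]])
  have Ble: "norm (B x) \<le> norm x" for x
    unfolding B_def using norm_adjoint_on_contraction[OF P le, of "P x"] le[of x] by linarith
  have Bsa: "inner (B x) y = inner x (B y)" for x y
    using A(2)[of x "P y"] A(2)[of y "P x"] by (simp add: B_def inner_commute)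
  obtain E where E: "bounded_op UNIV UNIV E" "\<And>x y. inner (E x) y = inner x (E y)" "\<And>x. 0 \<le> inner (E x) x"
    "\<And>x. E (E x) = x - B x"
    "\<And>Q x. bounded_op UNIV UNIV Q \<Longrightarrow> (\<And>y. Q (B y) = B (Q y)) \<Longrightarrow> Q (E x) = E (Q x)"
  proof (rule contraction_sqrt[OF B Ble Bsa], goal_cases)
    case (1 E) show ?case by (rule 1(1)[OF 1(2-6)])
  qed
  have "D = E"
    unfolding D_def defect_op_def
  proof (rule positive_sqrt_eqI)
    fix Q x assume Q: "bounded_op UNIV UNIV Q"
      and c: "\<And>y. y \<in> UNIV \<Longrightarrow> Q (y - adjoint_on UNIV P (P y)) = Q y - adjoint_on UNIV P (P (Q y))"
    have "Q (B y) = B (Q y)" for y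
      using c[of y] bounded_opD(5)[OF Q closed_csubspaceD(1)[OF closed_csubspace_UNIV]] by (simp add: B_def)
    then show "Q (E x) = E (Q x)" by (rule E(5)[OF Q])
  next
    show "E (E x) = x - adjoint_on UNIV P (P x)" for x using E(4)[of x] by (simp only: B_def)
  qed (simp_all add: csubspace_def E(1,3), rule E(2))
  with E(1) show D: "bounded_op UNIV UNIV D" by simp
  show "inner (D x) y = inner x (D y)" for x y unfolding \<open>D = E\<close> by (rule E)
  show "D (D x) = x - adjoint_on UNIV P (P x)" for x unfolding \<open>D = E\<close> using E(4)[of x] by (simp only: B_def)
  show "closed_csubspace (defect_space UNIV P)"
    unfolding defect_space_def using closed_csubspace_closure_image[OF _ D(1)] by (simp add: D_def csubspace_def)
qed

section \<open>Joint approximate eigenvectors\<close>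

text \<open>The joint kernel of \<open>\<B>\<close> in an extension of Berberian type, where
  sequences replace vectors and approximate eigenvectors become eigenvectors. Sequences tending to 0
  are not divided out.\<close>

definition null_seqs :: "'a::complex_inner set \<Rightarrow> ('a \<Rightarrow> 'a) set \<Rightarrow> (nat \<Rightarrow> 'a) set"
  where "null_seqs E \<B> = {x. (\<forall>k. x k \<in> E) \<and> Bseq x \<and> (\<forall>B\<in>\<B>. (\<lambda>k. B (x k)) \<longlonglongrightarrow> 0)}"

definition joint_null :: "'a::complex_inner set \<Rightarrow> ('a \<Rightarrow> 'a) set \<Rightarrow> bool"
  where "joint_null E \<B> \<longleftrightarrow> (\<exists>x\<in>null_seqs E \<B>. \<forall>k. norm (x k) = 1)"

text \<open>Invariance of that kernel. It can hold without commutation: an isometry M is later shown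
  to preserve the kernel of an operator with which it need not commute.\<close>

definition preserves :: "'a::complex_inner set \<Rightarrow> ('a \<Rightarrow> 'a) set \<Rightarrow> ('a \<Rightarrow> 'a) \<Rightarrow> bool"
  where "preserves E \<B> A \<longleftrightarrow> (\<forall>x\<in>null_seqs E \<B>. (\<lambda>k. A (x k)) \<in> null_seqs E \<B>)"

lemma null_seqsD:
  assumes "x \<in> null_seqs E \<B>"
  shows "x k \<in> E" "Bseq x" "B \<in> \<B> \<Longrightarrow> (\<lambda>k. B (x k)) \<longlonglongrightarrow> 0"
  using assms by (auto simp: null_seqs_def)

lemma Bseq_bounded_op:
  assumes A: "bounded_op E N A" and x: "\<And>k. x k \<in> E" "Bseq x"
  shows "Bseq (\<lambda>k. A (x k))"
proof -
  obtain K where K: "K > 0" "\<And>x. x \<in> E \<Longrightarrow> norm (A x) \<le> K * norm x" using bounded_op_bound[OF A] by blast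
  obtain L where L: "\<And>k. norm (x k) \<le> L" using x(2) by (auto simp: Bseq_def)
  have "norm (A (x k)) \<le> K * L" for k
    using K(2)[OF x(1)[of k]] mult_left_mono[OF L[of k], of K] K(1) by linarith
  then show ?thesis by (rule BseqI')
qed

lemma tendsto_bounded_op_zero:
  assumes A: "bounded_op E N A" and x: "\<And>k. x k \<in> E" "x \<longlonglongrightarrow> 0"
  shows "(\<lambda>k. A (x k)) \<longlonglongrightarrow> 0"
proof -
  obtain K where K: "\<And>x. x \<in> E \<Longrightarrow> norm (A x) \<le> K * norm x" using bounded_op_bound[OF A] by blast
  show ?thesis
  proof (rule Lim_null_comparison[OF always_eventually])
    show "\<forall>k. norm (A (x k)) \<le> K * norm (x k)" using K x(1) by blast
    show "(\<lambda>k. K * norm (x k)) \<longlonglongrightarrow> 0" using x(2) by (intro tendsto_mult_right_zero tendsto_norm_zero)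
  qed
qed

lemma null_seqs_diff_scaleC:
  assumes E: "csubspace E" and \<B>: "\<And>B. B \<in> \<B> \<Longrightarrow> bounded_op E E B"
    and x: "x \<in> null_seqs E \<B>" "y \<in> null_seqs E \<B>"
  shows "(\<lambda>k. x k - c *\<^sub>C y k) \<in> null_seqs E \<B>"
proof -
  have mem: "x k \<in> E" "c *\<^sub>C y k \<in> E" for k
    using null_seqsD(1)[OF x(1)] csubspaceD(3)[OF E null_seqsD(1)[OF x(2)]] by auto
  have "(\<lambda>k. B (x k - c *\<^sub>C y k)) \<longlonglongrightarrow> 0" if B: "B \<in> \<B>" for B
  proof -
    have "(\<lambda>k. B (x k) - c *\<^sub>C B (y k)) \<longlonglongrightarrow> 0 - c *\<^sub>C 0"
      by (intro tendsto_diff bounded_linear.tendsto[OF bounded_linear_scaleC] null_seqsD(3)[OF x(1) B] null_seqsD(3)[OF x(2) B])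
    then show ?thesis
      by (simp add: bounded_opD(5)[OF \<B>[OF B] E mem] bounded_opD(3)[OF \<B>[OF B] null_seqsD(1)[OF x(2)]])
  qed
  moreover have "Bseq (\<lambda>k. x k - c *\<^sub>C y k)"
  proof -
    obtain K L where "\<And>k. norm (x k) \<le> K" "\<And>k. norm (y k) \<le> L"
      using null_seqsD(2)[OF x(1)] null_seqsD(2)[OF x(2)] unfolding Bseq_def by metis
    then have "norm (x k - c *\<^sub>C y k) \<le> K + cmod c * L" for k
      by (intro norm_triangle_le_diff add_mono) (auto simp: norm_scaleC mult_left_mono)
    then show ?thesis by (rule BseqI')
  qed
  ultimately show ?thesis using csubspaceD(5)[OF E mem] by (simp add: null_seqs_def)
qed

text \<open>Along a subsequence on which the norms stay at least d, normalization enlarges the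
  images by a factor of at most 1/d.\<close>

lemma joint_nullI:
  assumes E: "csubspace E" and \<B>: "\<And>B. B \<in> \<B> \<Longrightarrow> bounded_op E E B"
    and x: "x \<in> null_seqs E \<B>" and nz: "\<not> x \<longlonglongrightarrow> 0"
  shows "joint_null E \<B>"
proof -
  obtain d where d: "d > 0" "\<And>N. \<exists>k\<ge>N. norm (x k) \<ge> d"
    using nz unfolding LIMSEQ_iff by (auto simp: not_less)
  then obtain r where r: "\<And>k. r k \<ge> k" "\<And>k. norm (x (r k)) \<ge> d" by metis
  have rt: "filterlim r at_top sequentially"
    by (rule filterlim_at_top_mono[OF filterlim_ident]) (use r in auto)
  define u where "u k = (1 / norm (x (r k))) *\<^sub>R x (r k)" for k
  have n1: "norm (u k) = 1" for k using r(2)[of k] d(1) by (auto simp: u_def)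
  have uE: "u k \<in> E" for k unfolding u_def by (rule csubspace_scaleR[OF E null_seqsD(1)[OF x]])
  have "(\<lambda>k. B (u k)) \<longlonglongrightarrow> 0" if B: "B \<in> \<B>" for B
  proof (rule Lim_null_comparison[OF always_eventually])
    show "\<forall>k. norm (B (u k)) \<le> (1/d) * norm (B (x (r k)))"
    proof
      fix k
      have "1 / norm (x (r k)) \<le> 1/d" using r(2)[of k] d(1) by (intro frac_le) auto
      from mult_right_mono[OF this norm_ge_zero, of "B (x (r k))"]
      show "norm (B (u k)) \<le> (1/d) * norm (B (x (r k)))"
        by (simp add: u_def bounded_opD(4)[OF \<B>[OF B] null_seqsD(1)[OF x]])
    qed
    show "(\<lambda>k. (1/d) * norm (B (x (r k)))) \<longlonglongrightarrow> 0"
      by (intro tendsto_mult_right_zero tendsto_norm_zero filterlim_compose[OF null_seqsD(3)[OF x B] rt])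
  qed
  moreover have "Bseq u" by (rule BseqI'[where K = 1]) (simp add: n1)
  ultimately have "u \<in> null_seqs E \<B>" using uE by (simp add: null_seqs_def)
  then show ?thesis unfolding joint_null_def using n1 by blast
qed

text \<open>New constraints are added through commutation alone, so that C may fail to commute with
  the members of \<open>\<B>\<close> itself.\<close>

lemma preserves_union:
  assumes pr: "preserves E \<B> C" and C: "bounded_op E E C"
    and comm: "\<And>Z x. Z \<in> \<Z> \<Longrightarrow> x \<in> E \<Longrightarrow> Z (C x) = C (Z x)" and Z: "\<And>Z x. Z \<in> \<Z> \<Longrightarrow> x \<in> E \<Longrightarrow> Z x \<in> E"
  shows "preserves E (\<B> \<union> \<Z>) C"
  unfolding preserves_def
proof
  fix x assume x: "x \<in> null_seqs E (\<B> \<union> \<Z>)"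
  then have "x \<in> null_seqs E \<B>" by (simp add: null_seqs_def)
  then have *: "(\<lambda>k. C (x k)) \<in> null_seqs E \<B>" using pr by (simp add: preserves_def)
  have "(\<lambda>k. z (C (x k))) \<longlonglongrightarrow> 0" if z: "z \<in> \<Z>" for z
    using tendsto_bounded_op_zero[OF C, of "\<lambda>k. z (x k)"] Z[OF z null_seqsD(1)[OF x]] null_seqsD(3)[OF x, of z] z
      comm[OF z null_seqsD(1)[OF x]] by simp
  with * show "(\<lambda>k. C (x k)) \<in> null_seqs E (\<B> \<union> \<Z>)" by (auto simp: null_seqs_def)
qed

text \<open>The number c plays the role of the norm of A on the joint kernel. The additive
  \<open>\<eta>\<close> covers indices at which y k is too small to be normalized with control of
  the constraints.\<close>

lemma joint_null_maximizer:
  assumes E: "csubspace E" and fin: "finite \<B>" and \<B>: "\<And>B. B \<in> \<B> \<Longrightarrow> bounded_op E E B"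
    and jn: "joint_null E \<B>" and A: "bounded_op E E A"
  shows "\<exists>c\<ge>0. \<exists>x\<in>null_seqs E \<B>. (\<forall>k. norm (x k) = 1) \<and> (\<lambda>k. norm (A (x k))) \<longlonglongrightarrow> c \<and>
    (\<forall>y\<in>null_seqs E \<B>. \<forall>\<eta>>0. \<forall>\<^sub>F k in sequentially. norm (A (y k)) \<le> (c + \<eta>) * norm (y k) + \<eta>)"
proof -
  obtain K where K: "K > 0" "\<And>x. x \<in> E \<Longrightarrow> norm (A x) \<le> K * norm x" using bounded_op_bound[OF A] by blast
  define F where "F e = {u\<in>E. norm u = 1 \<and> (\<forall>B\<in>\<B>. norm (B u) < e)}" for e
  have Fne: "\<exists>u. u \<in> F e" if "e > 0" for e
  proof -
    obtain x where x: "x \<in> null_seqs E \<B>" "\<And>k. norm (x k) = 1" using jn by (auto simp: joint_null_def)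
    have "\<forall>\<^sub>F k in sequentially. norm (B (x k)) < e" if "B \<in> \<B>" for B
      using tendsto_norm_zero[OF null_seqsD(3)[OF x(1) that]] \<open>e > 0\<close> by (rule order_tendstoD)
    then have "\<forall>\<^sub>F k in sequentially. \<forall>B\<in>\<B>. norm (B (x k)) < e" using fin by (simp add: eventually_ball_finite)
    then obtain k where "\<forall>B\<in>\<B>. norm (B (x k)) < e" using eventually_happens'[OF sequentially_bot] by blast
    then show ?thesis using x(2) null_seqsD(1)[OF x(1)] by (auto simp: F_def)
  qed
  \<comment> \<open>The levels that the norm of A reaches on unit vectors no matter how tight the
    constraints are.\<close>
  define S where "S = {r. \<forall>e>0. \<exists>u\<in>F e. r \<le> norm (A u)}"
  have S0: "0 \<in> S" using Fne by (auto simp: S_def)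
  have SK: "r \<le> K" if "r \<in> S" for r
  proof -
    have "\<exists>u\<in>F 1. r \<le> norm (A u)" using \<open>r \<in> S\<close> zero_less_one unfolding S_def by blast
    then obtain u where "u \<in> F 1" "r \<le> norm (A u)" by blast
    then show ?thesis using K(2)[of u] by (auto simp: F_def)
  qed
  have bdd: "bdd_above S" using SK by (rule bdd_aboveI)
  define c where "c = Sup S"
  have c0: "c \<ge> 0" unfolding c_def by (rule cSup_upper[OF S0 bdd])
  have ub: "\<exists>e>0. \<forall>u\<in>F e. norm (A u) < c + \<eta>" if "\<eta> > 0" for \<eta>
  proof (rule ccontr)
    assume "\<not> ?thesis"
    then have "c + \<eta> \<in> S" by (force simp: S_def not_less)
    then have "c + \<eta> \<le> c" unfolding c_def by (rule cSup_upper[OF _ bdd])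
    with that show False by simp
  qed
  have lb: "\<exists>u\<in>F e. norm (A u) > c - e" if "e > 0" for e
  proof -
    obtain r where "r \<in> S" "c - e < r" using less_cSupD[of S "c - e"] S0 \<open>e > 0\<close> by (auto simp: c_def)
    then obtain u where "u \<in> F e" "r \<le> norm (A u)" using \<open>e > 0\<close> unfolding S_def by blast
    then show ?thesis using \<open>c - e < r\<close> by (intro bexI[of _ u]) auto
  qed
  define e where "e k = inverse (real (Suc k))" for k
  have e: "e k > 0" "e \<longlonglongrightarrow> 0" for k using LIMSEQ_inverse_real_of_nat by (simp_all add: e_def[abs_def])
  obtain x where x: "\<And>k. x k \<in> F (e k)" "\<And>k. norm (A (x k)) > c - e k" using lb[OF e(1)] by metis
  have n1: "norm (x k) = 1" and xE: "x k \<in> E" for k using x(1)[of k] by (auto simp: F_def)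
  have xn: "x \<in> null_seqs E \<B>"
    unfolding null_seqs_def
  proof (intro CollectI conjI ballI allI xE)
    show "Bseq x" by (rule BseqI'[where K = 1]) (simp add: n1)
    show "(\<lambda>k. B (x k)) \<longlonglongrightarrow> 0" if "B \<in> \<B>" for B
      by (rule Lim_null_comparison[OF always_eventually e(2)]) (use x(1) that in \<open>auto simp: F_def less_imp_le\<close>)
  qed
  have claim: "\<forall>\<^sub>F k in sequentially. norm (A (y k)) \<le> (c + \<eta>) * norm (y k) + \<eta>"
    if y: "y \<in> null_seqs E \<B>" and \<eta>: "\<eta> > 0" for y \<eta>
  proof -
    obtain \<epsilon> where \<epsilon>: "\<epsilon> > 0" "\<And>u. u \<in> F \<epsilon> \<Longrightarrow> norm (A u) < c + \<eta>" using ub[OF \<eta>] by blast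
    \<comment> \<open>Below d the crude bound K gives at most \<open>\<eta>\<close>; from d on,
      division by the norm of y k turns constraints below \<open>\<epsilon> * d\<close> into
      constraints below \<open>\<epsilon>\<close>.\<close>
    define d where "d = \<eta> / K"
    have d: "d > 0" using \<eta> K(1) by (simp add: d_def)
    have "\<forall>\<^sub>F k in sequentially. norm (B (y k)) < \<epsilon> * d" if "B \<in> \<B>" for B
      using tendsto_norm_zero[OF null_seqsD(3)[OF y that]] by (rule order_tendstoD) (use \<epsilon> d in simp)
    then have "\<forall>\<^sub>F k in sequentially. \<forall>B\<in>\<B>. norm (B (y k)) < \<epsilon> * d" using fin by (simp add: eventually_ball_finite)
    then show ?thesis
    proof eventually_elim
      case (elim k)
      note yE = null_seqsD(1)[OF y, of k]
      show ?case
      proof (cases "norm (y k) < d")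
        case True
        have "norm (A (y k)) \<le> K * norm (y k)" by (rule K(2)[OF yE])
        also have "\<dots> \<le> K * d" using True K(1) by (intro mult_left_mono) auto
        also have "\<dots> = \<eta>" using K(1) by (simp add: d_def)
        also have "\<dots> \<le> (c + \<eta>) * norm (y k) + \<eta>" using c0 \<eta> by simp
        finally show ?thesis .
      next
        case False
        define s where "s = 1 / norm (y k)"
        have pos: "norm (y k) > 0" using False d by linarith
        have s: "s > 0" "s * norm (y k) = 1" "s * d \<le> 1" using pos False by (auto simp: s_def field_simps)
        have "s *\<^sub>R y k \<in> F \<epsilon>"
          unfolding F_def
        proof (intro CollectI conjI ballI)
          show "s *\<^sub>R y k \<in> E" by (rule csubspace_scaleR[OF E yE])
          show "norm (s *\<^sub>R y k) = 1" using s by simp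
          fix B assume B: "B \<in> \<B>"
          have "norm (B (s *\<^sub>R y k)) = s * norm (B (y k))" using s(1) by (simp add: bounded_opD(4)[OF \<B>[OF B] yE])
          also have "\<dots> < s * (\<epsilon> * d)" using elim B s(1) by (intro mult_strict_left_mono) auto
          also have "\<dots> \<le> \<epsilon>" using mult_left_mono[OF s(3), of \<epsilon>] \<epsilon>(1) by (simp add: mult_ac)
          finally show "norm (B (s *\<^sub>R y k)) < \<epsilon>" .
        qed
        from \<epsilon>(2)[OF this] have "s * norm (A (y k)) < c + \<eta>" using s(1) by (simp add: bounded_opD(4)[OF A yE])
        then have "norm (y k) * (s * norm (A (y k))) \<le> norm (y k) * (c + \<eta>)" by (intro mult_left_mono) auto
        moreover have "norm (y k) * (s * norm (A (y k))) = (s * norm (y k)) * norm (A (y k))" by (simp add: mult_ac)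
        ultimately have "norm (A (y k)) \<le> (c + \<eta>) * norm (y k)" unfolding s(2) by (simp add: mult.commute)
        then show ?thesis using \<eta> by simp
      qed
    qed
  qed
  have "(\<lambda>k. norm (A (x k))) \<longlonglongrightarrow> c"
  proof (rule order_tendstoI)
    fix a assume "a < c"
    then have "\<forall>\<^sub>F k in sequentially. e k < c - a" using order_tendstoD(2)[OF e(2), of "c - a"] by simp
    then show "\<forall>\<^sub>F k in sequentially. a < norm (A (x k))"
      by (rule eventually_mono) (use x(2) in \<open>smt (verit)\<close>)
  next
    fix a assume a: "c < a"
    have "\<forall>\<^sub>F k in sequentially. norm (A (x k)) \<le> (c + (a - c) / 3) * norm (x k) + (a - c) / 3"
      using claim[OF xn, of "(a - c) / 3"] a by simp
    then show "\<forall>\<^sub>F k in sequentially. norm (A (x k)) < a"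
      by (rule eventually_mono) (use a in \<open>simp add: n1 field_simps\<close>)
  qed
  then show ?thesis using c0 xn n1 claim by blast
qed

lemma norm_sq_diff_scaleR:
  "(norm (u - r *\<^sub>R v))\<^sup>2 = (norm u)\<^sup>2 - 2 * r * inner u v + r\<^sup>2 * (norm v)\<^sup>2" for u v :: "'a::real_inner"
  unfolding power2_norm_eq_inner by (simp add: inner_diff_left inner_diff_right inner_commute[of v u] power2_eq_square algebra_simps)

text \<open>If y is maximizing, A y is again admissible, so by hyponormality and maximality A' A y
  has asymptotic norm at most c^2, while its inner product with y tends to c^2; near-equality in
  Cauchy-Schwarz gives the limit. Hyponormality serves to replace A' by A, as A' need not preserve
  admissible sequences. Every maximizing y is covered because the isometric case inserts M
  x.\<close>

lemma joint_null_hyponormal: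
  assumes E: "csubspace E" and fin: "finite \<B>" and \<B>: "\<And>B. B \<in> \<B> \<Longrightarrow> bounded_op E E B"
    and jn: "joint_null E \<B>" and A: "bounded_op E E A" and pr: "preserves E \<B> A"
    and adj: "\<And>x y. x \<in> E \<Longrightarrow> y \<in> E \<Longrightarrow> inner (A x) y = inner x (A' y)" and A': "\<And>x. x \<in> E \<Longrightarrow> A' x \<in> E"
    and hyp: "\<And>x. x \<in> E \<Longrightarrow> norm (A' x) \<le> norm (A x)"
  shows "\<exists>c. \<exists>x\<in>null_seqs E \<B>. (\<forall>k. norm (x k) = 1) \<and> (\<lambda>k. norm (A (x k))) \<longlonglongrightarrow> c \<and>
    (\<forall>y\<in>null_seqs E \<B>. (\<forall>k. norm (y k) = 1) \<longrightarrow> (\<lambda>k. norm (A (y k))) \<longlonglongrightarrow> c \<longrightarrow> (\<lambda>k. A' (A (y k)) - c\<^sup>2 *\<^sub>R y k) \<longlonglongrightarrow> 0)"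
proof -
  obtain c x where cx: "c \<ge> 0" "x \<in> null_seqs E \<B>" "(\<forall>k. norm (x k) = 1) \<and> (\<lambda>k. norm (A (x k))) \<longlonglongrightarrow> c \<and>
    (\<forall>y\<in>null_seqs E \<B>. \<forall>\<eta>>0. \<forall>\<^sub>F k in sequentially. norm (A (y k)) \<le> (c + \<eta>) * norm (y k) + \<eta>)"
    using joint_null_maximizer[OF E fin \<B> jn A] by blast
  then have c: "c \<ge> 0" "x \<in> null_seqs E \<B>" "\<And>k. norm (x k) = 1" "(\<lambda>k. norm (A (x k))) \<longlonglongrightarrow> c"
    and ub: "\<And>y \<eta>. y \<in> null_seqs E \<B> \<Longrightarrow> \<eta> > 0 \<Longrightarrow> \<forall>\<^sub>F k in sequentially. norm (A (y k)) \<le> (c + \<eta>) * norm (y k) + \<eta>"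
    by blast+
  have "(\<lambda>k. A' (A (y k)) - c\<^sup>2 *\<^sub>R y k) \<longlonglongrightarrow> 0"
    if y: "y \<in> null_seqs E \<B>" "\<And>k. norm (y k) = 1" and b: "(\<lambda>k. norm (A (y k))) \<longlonglongrightarrow> c" for y
  proof -
    note yE = null_seqsD(1)[OF y(1)] and AE = bounded_opD(1)[OF A]
    have Ay: "(\<lambda>k. A (y k)) \<in> null_seqs E \<B>" using pr y(1) by (simp add: preserves_def)
    define a d where "a k = norm (A' (A (y k)))" and "d k = max 0 (a k - c * norm (A (y k)))" for k
    have d: "d \<longlonglongrightarrow> 0"
    proof (rule order_tendstoI)
      fix r :: real assume "r < 0"
      then show "\<forall>\<^sub>F k in sequentially. r < d k" by (intro always_eventually) (auto simp: d_def less_max_iff_disj)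
    next
      fix r :: real assume r: "r > 0"
      \<comment> \<open>Eventually the norm of A (y k) is below c + 1, so the excess d k is at most
        \<open>\<eta> * (c + 2)\<close>, which is less than r.\<close>
      define \<eta> where "\<eta> = r / (c + 3)"
      have \<eta>: "\<eta> > 0" "\<eta> * (c + 2) < r" using r c(1) by (auto simp: \<eta>_def field_simps)
      have "\<forall>\<^sub>F k in sequentially. norm (A (y k)) < c + 1" using b by (rule order_tendstoD) simp
      with ub[OF Ay \<eta>(1)] show "\<forall>\<^sub>F k in sequentially. d k < r"
      proof eventually_elim
        case (elim k)
        have "a k \<le> norm (A (A (y k)))" unfolding a_def by (rule hyp[OF AE[OF yE]])
        with elim(1) have "a k - c * norm (A (y k)) \<le> \<eta> * norm (A (y k)) + \<eta>" by (simp add: algebra_simps)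
        also have "\<dots> \<le> \<eta> * (c + 2)" using elim(2) \<eta>(1) mult_left_mono[of "norm (A (y k))" "c + 1" \<eta>] by (simp add: algebra_simps)
        finally show ?case using \<eta>(2) r by (simp add: d_def)
      qed
    qed
    have "(\<lambda>k. (norm (A' (A (y k)) - c\<^sup>2 *\<^sub>R y k))\<^sup>2) \<longlonglongrightarrow> 0"
    proof (rule Lim_null_comparison[OF always_eventually])
      show "\<forall>k. norm ((norm (A' (A (y k)) - c\<^sup>2 *\<^sub>R y k))\<^sup>2) \<le> (c * norm (A (y k)) + d k)\<^sup>2 - 2 * c\<^sup>2 * (norm (A (y k)))\<^sup>2 + c^4"
      proof
        fix k
        have "inner (A' (A (y k))) (y k) = (norm (A (y k)))\<^sup>2"
          using adj[OF yE AE[OF yE], of k k] unfolding power2_norm_eq_inner by (metis inner_commute)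
        then have "(norm (A' (A (y k)) - c\<^sup>2 *\<^sub>R y k))\<^sup>2 = (a k)\<^sup>2 - 2 * c\<^sup>2 * (norm (A (y k)))\<^sup>2 + c^4"
          unfolding norm_sq_diff_scaleR a_def y(2) by (simp flip: power_mult)
        moreover have "(a k)\<^sup>2 \<le> (c * norm (A (y k)) + d k)\<^sup>2" by (rule power_mono) (auto simp: d_def a_def)
        ultimately show "norm ((norm (A' (A (y k)) - c\<^sup>2 *\<^sub>R y k))\<^sup>2) \<le> (c * norm (A (y k)) + d k)\<^sup>2 - 2 * c\<^sup>2 * (norm (A (y k)))\<^sup>2 + c^4"
          unfolding real_norm_def abs_power2 by linarith
      qed
      have "(\<lambda>k. (c * norm (A (y k)) + d k)\<^sup>2 - 2 * c\<^sup>2 * (norm (A (y k)))\<^sup>2 + c^4) \<longlonglongrightarrow> (c * c + 0)\<^sup>2 - 2 * c\<^sup>2 * c\<^sup>2 + c^4"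
        by (intro tendsto_intros b d)
      then show "(\<lambda>k. (c * norm (A (y k)) + d k)\<^sup>2 - 2 * c\<^sup>2 * (norm (A (y k)))\<^sup>2 + c^4) \<longlonglongrightarrow> 0"
        by (simp add: power2_eq_square power4_eq_xxxx)
    qed
    from tendsto_real_sqrt[OF this] have "(\<lambda>k. norm (A' (A (y k)) - c\<^sup>2 *\<^sub>R y k)) \<longlonglongrightarrow> 0" by simp
    then show ?thesis by (rule tendsto_norm_zero_cancel)
  qed
  then show ?thesis using c by blast
qed

text \<open>The quadratic is (A - \<open>\<alpha>\<close>)(A - \<open>\<beta>\<close>). Either the
  right factor already annihilates x asymptotically, or its values, renormalized, are approximate
  eigenvectors for \<open>\<alpha>\<close>.\<close>

lemma joint_null_quadratic:
  assumes E: "csubspace E" and \<B>: "\<And>B. B \<in> \<B> \<Longrightarrow> bounded_op E E B"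
    and A: "bounded_op E E A" and pr: "preserves E \<B> A"
    and x: "x \<in> null_seqs E \<B>" "\<And>k. norm (x k) = 1"
    and lim: "(\<lambda>k. A (A (x k)) - (\<alpha> + \<beta>) *\<^sub>C A (x k) + (\<alpha> * \<beta>) *\<^sub>C x k) \<longlonglongrightarrow> 0"
  shows "\<exists>\<gamma>\<in>{\<alpha>, \<beta>}. joint_null E (insert (\<lambda>v. A v - \<gamma> *\<^sub>C v) \<B>)"
proof (cases "(\<lambda>k. A (x k) - \<beta> *\<^sub>C x k) \<longlonglongrightarrow> 0")
  case True
  then have "x \<in> null_seqs E (insert (\<lambda>v. A v - \<beta> *\<^sub>C v) \<B>)" using x(1) by (simp add: null_seqs_def)
  then show ?thesis using x(2) by (auto simp: joint_null_def)
next
  case False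
  define y where "y k = A (x k) - \<beta> *\<^sub>C x k" for k
  note xE = null_seqsD(1)[OF x(1)]
  have y: "y \<in> null_seqs E \<B>"
    unfolding y_def using pr x(1) by (intro null_seqs_diff_scaleC[OF E \<B>]) (auto simp: preserves_def)
  have "A (y k) - \<alpha> *\<^sub>C y k = A (A (x k)) - (\<alpha> + \<beta>) *\<^sub>C A (x k) + (\<alpha> * \<beta>) *\<^sub>C x k" for k
    unfolding y_def bounded_opD(5)[OF A E bounded_opD(1)[OF A xE] csubspaceD(3)[OF E xE]] bounded_opD(3)[OF A xE]
    by (simp add: scaleC_diff_right scaleC_add_left scaleC_scaleC)
  then have "(\<lambda>k. A (y k) - \<alpha> *\<^sub>C y k) \<longlonglongrightarrow> 0" using lim by simp
  with y have y': "y \<in> null_seqs E (insert (\<lambda>v. A v - \<alpha> *\<^sub>C v) \<B>)" by (simp add: null_seqs_def)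
  have "joint_null E (insert (\<lambda>v. A v - \<alpha> *\<^sub>C v) \<B>)"
  proof (rule joint_nullI[OF E _ y'])
    show "\<not> y \<longlonglongrightarrow> 0" using False by (simp add: y_def[abs_def])
    show "bounded_op E E B" if "B \<in> insert (\<lambda>v. A v - \<alpha> *\<^sub>C v) \<B>" for B
      using that \<B> bounded_op_diff[OF A bounded_op_scaleC[OF bounded_op_id E] E] by auto
  qed
  then show ?thesis by blast
qed

lemma joint_null_selfadjoint:
  assumes E: "csubspace E" and fin: "finite \<B>" and \<B>: "\<And>B. B \<in> \<B> \<Longrightarrow> bounded_op E E B"
    and jn: "joint_null E \<B>" and A: "bounded_op E E A" and pr: "preserves E \<B> A"
    and sa: "\<And>x y. x \<in> E \<Longrightarrow> y \<in> E \<Longrightarrow> inner (A x) y = inner x (A y)"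
  shows "\<exists>\<gamma>. joint_null E (insert (\<lambda>v. A v - complex_of_real \<gamma> *\<^sub>C v) \<B>)"
proof -
  obtain c x where x: "x \<in> null_seqs E \<B>" "\<And>k. norm (x k) = 1" and "(\<lambda>k. norm (A (x k))) \<longlonglongrightarrow> c"
    and "\<And>y. y\<in>null_seqs E \<B> \<Longrightarrow> (\<forall>k. norm (y k) = 1) \<Longrightarrow> (\<lambda>k. norm (A (y k))) \<longlonglongrightarrow> c \<Longrightarrow> (\<lambda>k. A (A (y k)) - c\<^sup>2 *\<^sub>R y k) \<longlonglongrightarrow> 0"
    using joint_null_hyponormal[OF E fin \<B> jn A pr sa bounded_opD(1)[OF A] order_refl] by blast
  then have "(\<lambda>k. A (A (x k)) - c\<^sup>2 *\<^sub>R x k) \<longlonglongrightarrow> 0" by blast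
  \<comment> \<open>Here A A - c^2 = (A - c)(A + c), written in the shape of
    \<open>joint_null_quadratic\<close>.\<close>
  then have "(\<lambda>k. A (A (x k)) - (complex_of_real c + complex_of_real (- c)) *\<^sub>C A (x k)
      + (complex_of_real c * complex_of_real (- c)) *\<^sub>C x k) \<longlonglongrightarrow> 0"
    unfolding of_real_add[symmetric] of_real_mult[symmetric] scaleC_of_real by (simp add: power2_eq_square)
  from joint_null_quadratic[OF E \<B> A pr x this] show ?thesis by blast
qed

text \<open>Maximizing the norm of M itself says nothing, since it is constant on unit vectors. But
  M + 1 is hyponormal; if x is maximizing for it then so is M x, and inserting M x into the limit
  relation eliminates M' through M' M = 1.\<close>

lemma joint_null_isometry:
  fixes E :: "'a::chilbert_space set"
  assumes E: "closed_csubspace E" and fin: "finite \<B>" and \<B>: "\<And>B. B \<in> \<B> \<Longrightarrow> bounded_op E E B"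
    and jn: "joint_null E \<B>" and M: "isometric_op E E M" and pr: "preserves E \<B> M"
  shows "\<exists>\<gamma>. joint_null E (insert (\<lambda>v. M v - \<gamma> *\<^sub>C v) \<B>)"
proof -
  note cE = closed_csubspaceD(1)[OF E]
  have Mb: "bounded_op E E M" and Mn: "\<And>x. x \<in> E \<Longrightarrow> norm (M x) = norm x" using M by (auto simp: isometric_op_def)
  define M' where "M' = adjoint_on E M"
  note adj = adjoint_on[OF E Mb, folded M'_def] and ME = bounded_opD(1)[OF Mb]
  have M'M: "M' (M x) = x" if "x \<in> E" for x
    unfolding M'_def by (rule isometric_op_adjoint_cancel[OF M E that])
  have M'n: "norm (M' x) \<le> norm x" if "x \<in> E" for x
  proof -
    have "(norm (M' x))\<^sup>2 = inner (M (M' x)) x"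
      using adj(2)[OF adj(1), of x x] by (simp add: power2_norm_eq_inner)
    also have "\<dots> \<le> norm (M (M' x)) * norm x" by (rule norm_cauchy_schwarz)
    also have "norm (M (M' x)) = norm (M' x)" using Mn adj(1) by blast
    finally show ?thesis by (cases "M' x = 0") (simp_all add: power2_eq_square)
  qed
  have A: "bounded_op E E (\<lambda>x. M x + x)" by (rule bounded_op_add[OF Mb bounded_op_id cE])
  have prA: "preserves E \<B> (\<lambda>x. M x + x)"
    unfolding preserves_def
  proof
    fix x assume x: "x \<in> null_seqs E \<B>"
    with pr have "(\<lambda>k. M (x k)) \<in> null_seqs E \<B>" by (simp add: preserves_def)
    from null_seqs_diff_scaleC[OF cE \<B> this x, of "- 1"] show "(\<lambda>k. M (x k) + x k) \<in> null_seqs E \<B>"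
      by (simp add: scaleC_minus_left)
  qed
  have "\<exists>c. \<exists>x\<in>null_seqs E \<B>. (\<forall>k. norm (x k) = 1) \<and> (\<lambda>k. norm (M (x k) + x k)) \<longlonglongrightarrow> c \<and>
    (\<forall>y\<in>null_seqs E \<B>. (\<forall>k. norm (y k) = 1) \<longrightarrow> (\<lambda>k. norm (M (y k) + y k)) \<longlonglongrightarrow> c \<longrightarrow>
      (\<lambda>k. M' (M (y k) + y k) + (M (y k) + y k) - c\<^sup>2 *\<^sub>R y k) \<longlonglongrightarrow> 0)"
  proof (rule joint_null_hyponormal[OF cE fin \<B> jn A prA, where A' = "\<lambda>x. M' x + x"])
    fix u v assume "u \<in> E" "v \<in> E"
    then show "inner (M u + u) v = inner u (M' v + v)" by (simp add: inner_add_left inner_add_right adj(2))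
  next
    fix u assume u: "u \<in> E"
    show "M' u + u \<in> E" using csubspaceD(2)[OF cE adj(1) u] .
    have "(norm (M' u + u))\<^sup>2 = (norm (M' u))\<^sup>2 + 2 * inner u (M' u) + (norm u)\<^sup>2"
      unfolding power2_norm_eq_inner by (simp add: inner_add_left inner_add_right inner_commute)
    also have "\<dots> \<le> (norm (M u))\<^sup>2 + 2 * inner (M u) u + (norm u)\<^sup>2"
      using power_mono[OF M'n[OF u] norm_ge_zero, of 2] by (simp add: Mn[OF u] adj(2)[OF u])
    also have "\<dots> = (norm (M u + u))\<^sup>2"
      unfolding power2_norm_eq_inner by (simp add: inner_add_left inner_add_right inner_commute)
    finally show "norm (M' u + u) \<le> norm (M u + u)" by simp
  qed
  then obtain c x where x: "x \<in> null_seqs E \<B>" "\<And>k. norm (x k) = 1" and limx: "(\<lambda>k. norm (M (x k) + x k)) \<longlonglongrightarrow> c"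
    and *: "\<And>y. y\<in>null_seqs E \<B> \<Longrightarrow> (\<forall>k. norm (y k) = 1) \<Longrightarrow> (\<lambda>k. norm (M (y k) + y k)) \<longlonglongrightarrow> c \<Longrightarrow>
      (\<lambda>k. M' (M (y k) + y k) + (M (y k) + y k) - c\<^sup>2 *\<^sub>R y k) \<longlonglongrightarrow> 0"
    by blast
  note xE = null_seqsD(1)[OF x(1)]
  have "(\<lambda>k. M' (M (M (x k)) + M (x k)) + (M (M (x k)) + M (x k)) - c\<^sup>2 *\<^sub>R M (x k)) \<longlonglongrightarrow> 0"
  proof (rule *)
    show "(\<lambda>k. M (x k)) \<in> null_seqs E \<B>" using pr x(1) by (simp add: preserves_def)
    show "\<forall>k. norm (M (x k)) = 1" using Mn[OF xE] x(2) by simp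
    have "norm (M (M (x k)) + M (x k)) = norm (M (x k) + x k)" for k
      using bounded_opD(2)[OF Mb ME[OF xE] xE, of k k] Mn[OF csubspaceD(2)[OF cE ME[OF xE] xE], of k k] by simp
    then show "(\<lambda>k. norm (M (M (x k)) + M (x k))) \<longlonglongrightarrow> c" using limx by simp
  qed
  moreover have "M' (M (M (x k)) + M (x k)) = M (x k) + x k" for k
    using bounded_opD(2)[OF Mb ME[OF xE] xE, of k k] M'M[OF csubspaceD(2)[OF cE ME[OF xE] xE], of k k] by simp
  ultimately have lim: "(\<lambda>k. M (x k) + x k + (M (M (x k)) + M (x k)) - c\<^sup>2 *\<^sub>R M (x k)) \<longlonglongrightarrow> 0" by simp
  \<comment> \<open>What remains is M^2 - (c^2 - 2) M + 1, with roots \<open>\<alpha>\<close> and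
    \<open>\<beta>\<close>.\<close>
  define s where "s = csqrt ((complex_of_real (c\<^sup>2 - 2))\<^sup>2 - 4)"
  define \<alpha> \<beta> where "\<alpha> = (complex_of_real (c\<^sup>2 - 2) + s) / 2" and "\<beta> = (complex_of_real (c\<^sup>2 - 2) - s) / 2"
  have ab: "\<alpha> + \<beta> = complex_of_real (c\<^sup>2 - 2)" by (simp add: \<alpha>_def \<beta>_def flip: add_divide_distrib)
  have "\<alpha> * \<beta> = ((complex_of_real (c\<^sup>2 - 2))\<^sup>2 - s\<^sup>2) / 4" by (simp add: \<alpha>_def \<beta>_def power2_eq_square algebra_simps)
  then have ab1: "\<alpha> * \<beta> = 1" by (simp add: s_def)
  have "(\<lambda>k. M (M (x k)) - (\<alpha> + \<beta>) *\<^sub>C M (x k) + (\<alpha> * \<beta>) *\<^sub>C x k) \<longlonglongrightarrow> 0"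
  proof -
    have "M (M (x k)) - (\<alpha> + \<beta>) *\<^sub>C M (x k) + (\<alpha> * \<beta>) *\<^sub>C x k = M (x k) + x k + (M (M (x k)) + M (x k)) - c\<^sup>2 *\<^sub>R M (x k)" for k
      unfolding ab ab1 scaleC_of_real by (simp add: algebra_simps scaleR_2)
    then show ?thesis using lim by (simp only:)
  qed
  from joint_null_quadratic[OF cE \<B> Mb pr x this] show ?thesis by blast
qed

text \<open>Each constraint gained is a scalar translate of some A j, which commutes with the
  members still to come, so they preserve the enlarged set of constraints.\<close>

lemma joint_null_selfadjoint_family:
  assumes E: "csubspace E" and fin: "finite \<B>" and \<B>: "\<And>B. B \<in> \<B> \<Longrightarrow> bounded_op E E B"
    and jn: "joint_null E \<B>" and I: "finite I"
    and A: "\<And>i. i \<in> I \<Longrightarrow> bounded_op E E (A i)" and pr: "\<And>i. i \<in> I \<Longrightarrow> preserves E \<B> (A i)"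
    and sa: "\<And>i x y. i \<in> I \<Longrightarrow> x \<in> E \<Longrightarrow> y \<in> E \<Longrightarrow> inner (A i x) y = inner x (A i y)"
    and comm: "\<And>i j x. i \<in> I \<Longrightarrow> j \<in> I \<Longrightarrow> x \<in> E \<Longrightarrow> A i (A j x) = A j (A i x)"
  shows "\<exists>\<gamma>. joint_null E (\<B> \<union> (\<lambda>i v. A i v - complex_of_real (\<gamma> i) *\<^sub>C v) ` I)"
  using I A pr sa comm
proof (induction I)
  case empty
  then show ?case using jn by simp
next
  case (insert i I)
  obtain \<gamma> where g: "joint_null E (\<B> \<union> (\<lambda>i v. A i v - complex_of_real (\<gamma> i) *\<^sub>C v) ` I)"
    using insert.IH[OF insert.prems(1) insert.prems(2) insert.prems(3) insert.prems(4)] by blast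
  let ?Z = "(\<lambda>i v. A i v - complex_of_real (\<gamma> i) *\<^sub>C v) ` I"
  have Ai: "bounded_op E E (A i)" using insert.prems(1) by blast
  have Zb: "bounded_op E E Z" if "Z \<in> ?Z" for Z
    using that insert.prems(1) bounded_op_diff[OF _ bounded_op_scaleC[OF bounded_op_id E] E] by auto
  have "\<exists>c. joint_null E (insert (\<lambda>v. A i v - complex_of_real c *\<^sub>C v) (\<B> \<union> ?Z))"
  proof (rule joint_null_selfadjoint[OF E _ _ g Ai])
    show "finite (\<B> \<union> ?Z)" using fin insert.hyps by simp
    show "bounded_op E E B" if "B \<in> \<B> \<union> ?Z" for B using that \<B> Zb by blast
    show "preserves E (\<B> \<union> ?Z) (A i)"
    proof (rule preserves_union[OF _ Ai])
      show "preserves E \<B> (A i)" using insert.prems(2) by blast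
      show "Z x \<in> E" if "Z \<in> ?Z" "x \<in> E" for Z x using bounded_opD(1)[OF Zb] that by blast
      fix Z x assume Z: "Z \<in> ?Z" and x: "x \<in> E"
      then obtain j where j: "j \<in> I" "Z = (\<lambda>v. A j v - complex_of_real (\<gamma> j) *\<^sub>C v)" by blast
      have Aj: "bounded_op E E (A j)" using insert.prems(1) j(1) by blast
      show "Z (A i x) = A i (Z x)"
        using insert.prems(4)[of i j x] j x
          bounded_opD(5)[OF Ai E bounded_opD(1)[OF Aj x] csubspaceD(3)[OF E x]] bounded_opD(3)[OF Ai x] by simp
    qed
    show "inner (A i x) y = inner x (A i y)" if "x \<in> E" "y \<in> E" for x y using insert.prems(3) that by blast
  qed
  then obtain c where c: "joint_null E (insert (\<lambda>v. A i v - complex_of_real c *\<^sub>C v) (\<B> \<union> ?Z))" by blast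
  have "(\<lambda>j v. A j v - complex_of_real ((\<gamma>(i := c)) j) *\<^sub>C v) ` I = ?Z"
    by (rule image_cong) (use insert.hyps in auto)
  then have "\<B> \<union> (\<lambda>j v. A j v - complex_of_real ((\<gamma>(i := c)) j) *\<^sub>C v) ` insert i I
      = insert (\<lambda>v. A i v - complex_of_real c *\<^sub>C v) (\<B> \<union> ?Z)" by simp
  then show ?case using c by metis
qed

section \<open>Restrictions of \<open>\<Gamma>\<^sub>n\<close>-unitaries\<close>

text \<open>The vector \<open>y\<close> is built with signs chosen so that the \<open>k\<close>-th step does not decrease
  \<open>\<bar>inner (z k) y\<bar>\<close> (Sokal's proof of the uniform boundedness principle).\<close>

lemma uniform_boundedness_unit:
  fixes z :: "nat \<Rightarrow> 'a::chilbert_space"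
  assumes L: "closed_csubspace L" and z: "\<And>k. z k \<in> L" "\<And>k. norm (z k) = 1" and a: "a \<longlonglongrightarrow> (0::real)"
    and weak: "\<And>y. y \<in> L \<Longrightarrow> \<exists>C. \<forall>k. \<bar>inner (z k) y\<bar> \<le> C * a k"
  shows False
proof -
  note D = closed_csubspaceD[OF L]
  have "\<exists>j. \<bar>a j\<bar> < (1/4) ^ k" for k
  proof -
    have "\<forall>\<^sub>F j in sequentially. \<bar>a j\<bar> < (1/4) ^ k"
      using tendsto_rabs_zero[OF a] by (rule order_tendstoD) simp
    then show ?thesis using eventually_happens'[OF sequentially_bot] by blast
  qed
  then obtain r where r: "\<And>k. \<bar>a (r k)\<bar> < (1/4) ^ k" by metis
  define w where "w k = z (r k)" for k
  \<comment> \<open>Step k secures (1/3)^k for w k, and all later steps together have length at most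
    (1/3)^k / 2, so half of it survives in the limit.\<close>
  define p where "p = rec_nat 0 (\<lambda>k q. q + ((if inner (w k) q \<ge> 0 then 1 else - 1) * (1/3) ^ k) *\<^sub>R w k)"
  have pS: "p (Suc k) = p k + ((if inner (w k) (p k) \<ge> 0 then 1 else - 1) * (1/3) ^ k) *\<^sub>R w k" for k
    by (simp add: p_def)
  have p0: "p 0 = 0" by (simp add: p_def)
  have ww: "norm (w k) = 1" "w k \<in> L" for k using z by (auto simp: w_def)
  have pL: "p k \<in> L" for k by (induction k) (simp_all add: p0 pS D ww)
  define d where "d k = p (Suc k) - p k" for k
  have nd: "norm (d k) = (1/3) ^ k" for k by (simp add: d_def pS ww)
  have sd: "summable (\<lambda>k. norm (d k))" unfolding nd by (rule summable_geometric) simp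
  have psum: "p m = (\<Sum>k<m. d k)" for m unfolding d_def by (simp add: sum_lessThan_telescope p0)
  define y where "y = (\<Sum>k. d k)"
  have py: "p \<longlonglongrightarrow> y" unfolding psum y_def by (rule summable_LIMSEQ[OF summable_norm_cancel[OF sd]])
  have yL: "y \<in> L" using closed_sequentially[OF D(2) pL py] .
  have big: "\<bar>inner (w k) y\<bar> \<ge> (1/3) ^ k / 2" for k
  proof -
    have "inner (w k) (w k) = 1" using ww(1)[of k] by (simp flip: power2_norm_eq_inner)
    then have "inner (w k) (p (Suc k)) = inner (w k) (p k) + (if inner (w k) (p k) \<ge> 0 then 1 else - 1) * (1/3) ^ k"
      by (simp add: pS inner_add_right)
    moreover have "(0::real) < (1/3) ^ k" by simp
    ultimately have 1: "\<bar>inner (w k) (p (Suc k))\<bar> \<ge> (1/3) ^ k" by (auto split: if_splits)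
    have sd': "summable (\<lambda>j. norm (d (j + Suc k)))" using sd by (rule summable_ignore_initial_segment)
    have "y - p (Suc k) = (\<Sum>j. d (j + Suc k))"
      unfolding y_def psum by (rule suminf_minus_initial_segment[OF summable_norm_cancel[OF sd], symmetric])
    also have "norm \<dots> \<le> (\<Sum>j. norm (d (j + Suc k)))" by (rule summable_norm[OF sd'])
    also have "\<dots> = (\<Sum>j. (1/3) ^ Suc k * (1/3) ^ j)" by (simp add: nd power_add mult_ac)
    also have "\<dots> = (1/3) ^ Suc k * (3/2)" by (subst suminf_mult) (auto simp: suminf_geometric intro: summable_geometric)
    finally have "norm (y - p (Suc k)) \<le> (1/3) ^ k / 2" by simp
    moreover have "\<bar>inner (w k) (y - p (Suc k))\<bar> \<le> norm (w k) * norm (y - p (Suc k))" by (rule Cauchy_Schwarz_ineq2)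
    ultimately have 2: "\<bar>inner (w k) (y - p (Suc k))\<bar> \<le> (1/3) ^ k / 2" by (simp add: ww)
    have "inner (w k) y = inner (w k) (p (Suc k)) + inner (w k) (y - p (Suc k))" by (simp add: inner_diff_right)
    with 1 2 show ?thesis by linarith
  qed
  obtain C where C: "\<And>k. \<bar>inner (z k) y\<bar> \<le> C * a k" using weak[OF yL] by blast
  \<comment> \<open>Along r the sequence a decays like (1/4)^k, faster than the surviving (1/3)^k /
    2.\<close>
  obtain k where k: "2 * \<bar>C\<bar> < (4/3) ^ k" using real_arch_pow[of "4/3"] by auto
  have "(1/3) ^ k / 2 \<le> C * a (r k)" using big[of k] C[of "r k"] by (simp add: w_def)
  also have "\<dots> \<le> \<bar>C\<bar> * \<bar>a (r k)\<bar>" by (simp flip: abs_mult)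
  also have "\<dots> \<le> \<bar>C\<bar> * (1/4) ^ k" using r[of k] by (intro mult_left_mono) auto
  finally have "(1/3) ^ k \<le> 2 * \<bar>C\<bar> * (1/4) ^ k" by simp
  also have "\<dots> < (4/3) ^ k * (1/4) ^ k" using k by (intro mult_strict_right_mono) auto
  also have "\<dots> = (1/3) ^ k" by (simp flip: power_mult_distrib)
  finally show False by simp
qed

lemma inner_scaleC_left: "inner (c *\<^sub>C x) y = inner x (cnj c *\<^sub>C y)"
  by (metis Re_cinner cinner_scaleC_left cinner_scaleC_right complex_cnj_cnj)

text \<open>Subtracting a scalar keeps normality, and a normal operator and its adjoint have equal
  norms at each vector.\<close>

lemma normal_norm_shift:
  assumes E: "csubspace E" and N: "bounded_op E E N" and N': "bounded_op E E N'"
    and adj: "\<And>x y. x \<in> E \<Longrightarrow> y \<in> E \<Longrightarrow> inner (N x) y = inner x (N' y)"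
    and comm: "N (N' x) = N' (N x)" and x: "x \<in> E"
  shows "norm (N' x - cnj \<mu> *\<^sub>C x) = norm (N x - \<mu> *\<^sub>C x)"
proof -
  define T T' where "T v = N v - \<mu> *\<^sub>C v" and "T' v = N' v - cnj \<mu> *\<^sub>C v" for v
  have T: "bounded_op E E T" "bounded_op E E T'"
    unfolding T_def T'_def by (intro bounded_op_diff N N' bounded_op_scaleC bounded_op_id E)+
  have a: "inner (T u) v = inner u (T' v)" if "u \<in> E" "v \<in> E" for u v
    using adj[OF that] by (simp add: T_def T'_def inner_diff_left inner_diff_right inner_scaleC_left)
  have c: "T (T' x) = T' (T x)"
    unfolding T_def T'_def using comm x
    by (simp add: bounded_opD(5)[OF N E] bounded_opD(5)[OF N' E] bounded_opD(1,3)[OF N] bounded_opD(1,3)[OF N']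
        csubspaceD(3)[OF E] scaleC_diff_right scaleC_scaleC mult.commute)
  have "(norm (T' x))\<^sup>2 = inner (T (T' x)) x"
    using a[OF bounded_opD(1)[OF T(2) x] x] by (simp add: power2_norm_eq_inner)
  also have "\<dots> = (norm (T x))\<^sup>2"
    unfolding c using a[OF x bounded_opD(1)[OF T(1) x]] by (simp add: power2_norm_eq_inner inner_commute)
  finally show ?thesis by (simp add: T_def T'_def power2_eq_iff_nonneg)
qed

text \<open>Exactness fails in top degree: it would write every y as a signed sum of values T j (h
  j). By normality the adjoint of T j is as small at z k as T j itself, so the inner product of z k
  with any y would be O(a k), against uniform boundedness.\<close>

lemma approximate_point_in_taylor_spectrum:
  fixes L :: "'a::chilbert_space set"
  assumes L: "closed_csubspace L" and N: "\<And>i. i \<in> {1..n} \<Longrightarrow> bounded_op L L (N i)"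
    and nm: "\<And>i. i \<in> {1..n} \<Longrightarrow> normal_op L (N i)" and \<mu>: "\<And>i. i \<notin> {1..n} \<Longrightarrow> \<mu> i = 0"
    and z: "\<And>k. z k \<in> L" "\<And>k. norm (z k) = 1"
    and lim: "\<And>i. i \<in> {1..n} \<Longrightarrow> (\<lambda>k. N i (z k) - \<mu> i *\<^sub>C z k) \<longlonglongrightarrow> 0"
  shows "\<mu> \<in> taylor_spectrum n L N"
proof (rule ccontr)
  note D = closed_csubspaceD[OF L]
  define T where "T i x = N i x - \<mu> i *\<^sub>C x" for i x
  assume "\<mu> \<notin> taylor_spectrum n L N"
  then have ex: "koszul_exact n L T" using \<mu> by (simp add: taylor_spectrum_def T_def[abs_def])
  define a where "a k = (\<Sum>i=1..n. norm (T i (z k)))" for k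
  show False
  proof (rule uniform_boundedness_unit[OF L z])
    have "a \<longlonglongrightarrow> (\<Sum>i=1..n. 0)" unfolding a_def
      by (intro tendsto_sum tendsto_norm_zero) (use lim in \<open>simp add: T_def\<close>)
    then show "a \<longlonglongrightarrow> 0" by simp
    fix y assume y: "y \<in> L"
    \<comment> \<open>A form of top degree is closed: J - {j} with j in J is never all of
      {1..n}.\<close>
    define \<omega> where "\<omega> I = (if I = {1..n} then y else 0)" for I
    have "koszul_form n L \<omega>" using y D(3) by (auto simp: koszul_form_def \<omega>_def)
    moreover have "koszul_d n T \<omega> = (\<lambda>_. 0)"
    proof
      fix J
      have "T j (\<omega> (J - {j})) = 0" if "J \<subseteq> {1..n}" "j \<in> J" for j
      proof -
        have "j \<in> {1..n}" using that by blast
        then have "J - {j} \<noteq> {1..n}" by blast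
        then show ?thesis using bounded_opD(7)[OF N[OF \<open>j \<in> {1..n}\<close>] D(1)] by (simp add: \<omega>_def T_def)
      qed
      then show "koszul_d n T \<omega> J = 0" by (simp add: koszul_d_def)
    qed
    ultimately obtain \<eta> where \<eta>: "koszul_form n L \<eta>" "koszul_d n T \<eta> = \<omega>" using ex by (auto simp: koszul_exact_def)
    define h where "h j = \<eta> ({1..n} - {j})" for j
    have hL: "h j \<in> L" for j using \<eta>(1) by (auto simp: koszul_form_def h_def)
    have "y = koszul_d n T \<eta> {1..n}" using \<eta>(2) by (simp add: \<omega>_def)
    then have y_eq: "y = (\<Sum>j=1..n. (- 1) ^ card {i\<in>{1..n}. i < j} *\<^sub>R T j (h j))" by (simp add: koszul_d_def h_def)
    have "\<bar>inner (z k) y\<bar> \<le> (\<Sum>j=1..n. norm (h j)) * a k" for k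
    proof -
      have "\<bar>inner (z k) y\<bar> \<le> (\<Sum>j=1..n. \<bar>inner (z k) ((- 1) ^ card {i\<in>{1..n}. i < j} *\<^sub>R T j (h j))\<bar>)"
        unfolding y_eq inner_sum_right by (rule sum_abs)
      also have "\<dots> \<le> (\<Sum>j=1..n. norm (h j) * a k)"
      proof (rule sum_mono)
        fix j assume j: "j \<in> {1..n}"
        define N' where "N' = adjoint_on L (N j)"
        have N': "bounded_op L L N'" unfolding N'_def by (rule bounded_op_adjoint'[OF L N[OF j]])
        note adj = adjoint_on(2)[OF L N[OF j], folded N'_def]
        have "\<bar>inner (z k) ((- 1) ^ card {i\<in>{1..n}. i < j} *\<^sub>R T j (h j))\<bar> = \<bar>inner (T j (h j)) (z k)\<bar>"
          by (simp add: abs_mult power_abs inner_commute)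
        also have "inner (T j (h j)) (z k) = inner (h j) (N' (z k) - cnj (\<mu> j) *\<^sub>C z k)"
          using adj[OF hL, of j "z k"] by (simp add: T_def inner_diff_left inner_diff_right inner_scaleC_left)
        also have "\<bar>\<dots>\<bar> \<le> norm (h j) * norm (N' (z k) - cnj (\<mu> j) *\<^sub>C z k)" by (rule Cauchy_Schwarz_ineq2)
        also have "norm (N' (z k) - cnj (\<mu> j) *\<^sub>C z k) = norm (T j (z k))"
          unfolding T_def by (rule normal_norm_shift[OF D(1) N[OF j] N' adj _ z(1)])
            (use nm[OF j] z(1) in \<open>auto simp: normal_op_def N'_def\<close>)
        also have "\<dots> \<le> a k" unfolding a_def using j by (intro member_le_sum) auto
        finally show "\<bar>inner (z k) ((- 1) ^ card {i\<in>{1..n}. i < j} *\<^sub>R T j (h j))\<bar> \<le> norm (h j) * a k"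
          by (simp add: mult_left_mono)
      qed
      finally show ?thesis by (simp add: sum_distrib_right)
    qed
    then show "\<exists>C. \<forall>k. \<bar>inner (z k) y\<bar> \<le> C * a k" by blast
  qed
qed

text \<open>The product of the z j has modulus 1, so each factor has. Hence a product over I is the
  conjugate of the product over the complement times s n, and complementation exchanges the sizes i
  and n - i.\<close>

lemma bGamma_conj:
  assumes s: "s \<in> bGamma n" and i: "i \<in> {1..<n}"
  shows "s i = cnj (s (n - i)) * s n"
proof -
  obtain z where z': "\<forall>j\<in>{1..n}. cmod (z j) \<le> 1" and s_eq: "s = symmetrization n z" and sn: "cmod (s n) = 1"
    using s unfolding bGamma_def Gamma_def by blast
  from z' have z: "\<And>j. j \<in> {1..n} \<Longrightarrow> cmod (z j) \<le> 1" by blast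
  have "{I. I \<subseteq> {1..n} \<and> card I = n} = {{1..n}}"
    using card_subset_eq[of "{1..n}"] by auto
  then have sn_eq: "s n = (\<Prod>j\<in>{1..n}. z j)" using i by (simp add: s_eq symmetrization_def)
  have z1: "cmod (z j) = 1" if j: "j \<in> {1..n}" for j
  proof -
    have "cmod (s n) = cmod (z j) * (\<Prod>l\<in>{1..n} - {j}. cmod (z l))"
      unfolding sn_eq prod_norm[symmetric] using j by (intro prod.remove) auto
    also have "\<dots> \<le> cmod (z j) * 1" by (intro mult_left_mono prod_le_1) (use z in auto)
    finally show ?thesis using sn z[OF j] by simp
  qed
  have comp: "(\<Prod>j\<in>I. z j) = cnj (\<Prod>j\<in>{1..n} - I. z j) * s n" if I: "I \<subseteq> {1..n}" for I
  proof -
    have "cnj (\<Prod>j\<in>{1..n} - I. z j) * (\<Prod>j\<in>{1..n} - I. z j) = complex_of_real ((cmod (\<Prod>j\<in>{1..n} - I. z j))\<^sup>2)"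
      by (simp add: complex_norm_square mult.commute del: of_real_power)
    also have "cmod (\<Prod>j\<in>{1..n} - I. z j) = (\<Prod>j\<in>{1..n} - I. cmod (z j))" by (simp flip: prod_norm)
    also have "\<dots> = 1" by (rule prod.neutral) (use z1 in auto)
    finally have "cnj (\<Prod>j\<in>{1..n} - I. z j) * (\<Prod>j\<in>{1..n} - I. z j) = 1" by simp
    moreover have "s n = (\<Prod>j\<in>{1..n} - I. z j) * (\<Prod>j\<in>I. z j)"
      unfolding sn_eq using prod.subset_diff[OF I] by simp
    ultimately show ?thesis by (simp flip: mult.assoc)
  qed
  have "s i = (\<Sum>I | I \<subseteq> {1..n} \<and> card I = i. \<Prod>j\<in>I. z j)" using i by (simp add: s_eq symmetrization_def)
  also have "\<dots> = (\<Sum>I | I \<subseteq> {1..n} \<and> card I = i. cnj (\<Prod>j\<in>{1..n} - I. z j) * s n)"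
    by (rule sum.cong[OF refl], rule comp) blast
  also have "\<dots> = (\<Sum>I | I \<subseteq> {1..n} \<and> card I = n - i. cnj (\<Prod>j\<in>I. z j) * s n)"
  proof (rule sum.reindex_bij_witness[where i = "\<lambda>I. {1..n} - I" and j = "\<lambda>I. {1..n} - I"])
    fix I assume "I \<in> {I. I \<subseteq> {1..n} \<and> card I = i}"
    then show "{1..n} - ({1..n} - I) = I" "{1..n} - I \<in> {I. I \<subseteq> {1..n} \<and> card I = n - i}"
      using card_Diff_subset[of I "{1..n}"] finite_subset[of I "{1..n}"] by auto
  next
    fix I assume "I \<in> {I. I \<subseteq> {1..n} \<and> card I = n - i}"
    then show "{1..n} - ({1..n} - I) = I" "{1..n} - I \<in> {I. I \<subseteq> {1..n} \<and> card I = i}"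
      using card_Diff_subset[of I "{1..n}"] finite_subset[of I "{1..n}"] i by auto
  qed simp
  also have "\<dots> = cnj (s (n - i)) * s n"
  proof -
    have "n - i \<in> {1..n}" using i by auto
    then have "s (n - i) = (\<Sum>I | I \<subseteq> {1..n} \<and> card I = n - i. \<Prod>j\<in>I. z j)" by (simp add: s_eq symmetrization_def)
    then show ?thesis by (simp add: sum_distrib_right)
  qed
  finally show ?thesis .
qed

text \<open>The adjoints are arguments in their own right, so that the members of a pair can be
  exchanged.\<close>

lemma adjoint_commute:
  fixes E :: "'a::chilbert_space set"
  assumes E: "csubspace E"
    and A: "bounded_op E E A" "bounded_op E E A'" "\<And>x y. x \<in> E \<Longrightarrow> y \<in> E \<Longrightarrow> inner (A x) y = inner x (A' y)"
    and C: "bounded_op E E C" "bounded_op E E C'" "\<And>x y. x \<in> E \<Longrightarrow> y \<in> E \<Longrightarrow> inner (C x) y = inner x (C' y)"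
    and comm: "\<And>x. x \<in> E \<Longrightarrow> A (C x) = C (A x)" and x: "x \<in> E"
  shows "A' (C' x) = C' (A' x)"
proof (rule inner_ext[OF E])
  note mem = bounded_opD(1)[OF A(1)] bounded_opD(1)[OF A(2)] bounded_opD(1)[OF C(1)] bounded_opD(1)[OF C(2)]
  show "A' (C' x) \<in> E" "C' (A' x) \<in> E" using mem x by blast+
  fix m assume m: "m \<in> E"
  have "inner m (A' (C' x)) = inner (C (A m)) x" using A(3)[of m "C' x"] C(3)[of "A m" x] mem m x by simp
  also have "\<dots> = inner m (C' (A' x))" using A(3)[of "C m" x] C(3)[of m "A' x"] mem m x comm[OF m] by simp
  finally show "inner m (A' (C' x)) = inner m (C' (A' x))" .
qed


text \<open>On a subspace that reduces the first \<open>n - 1\<close> entries to doubly commuting normal operators,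
  the defining relations of \<open>b\<Gamma>\<^sub>n\<close> pass to the operators without the spectral theorem: where the
  difference \<open>T\<close> of both sides nearly attains its norm one finds joint approximate eigenvectors,
  and there \<open>T\<close> is small because their eigenvalues lie in \<open>b\<Gamma>\<^sub>n\<close>.\<close>

lemma Gamma_unitary_restriction_relation:
  fixes E :: "'a::chilbert_space set" and L :: "'b::chilbert_space set"
  assumes G: "Gamma_unitary n L N" and E: "closed_csubspace E" and \<Phi>: "isometric_op E L \<Phi>"
    and R: "\<And>j. j \<in> {1..<n} \<Longrightarrow> bounded_op E E (R j)"
    and comm: "\<And>j k x. j \<in> {1..<n} \<Longrightarrow> k \<in> {1..<n} \<Longrightarrow> x \<in> E \<Longrightarrow> R j (R k x) = R k (R j x)"
    and dcomm: "\<And>j k x. j \<in> {1..<n} \<Longrightarrow> k \<in> {1..<n} \<Longrightarrow> x \<in> E \<Longrightarrow>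
      R j (adjoint_on E (R k) x) = adjoint_on E (R k) (R j x)"
    and M: "isometric_op E E M"
    and inter: "\<And>j x. j \<in> {1..<n} \<Longrightarrow> x \<in> E \<Longrightarrow> N j (\<Phi> x) = \<Phi> (R j x)" "\<And>x. x \<in> E \<Longrightarrow> N n (\<Phi> x) = \<Phi> (M x)"
    and i: "i \<in> {1..<n}" and x: "x \<in> E"
  shows "R i x = M (adjoint_on E (R (n - i)) x)"
proof -
  define R' where "R' j = adjoint_on E (R j)" for j
  note D = closed_csubspaceD[OF E] and cE = closed_csubspaceD(1)[OF E]
  have L: "closed_csubspace L" and Nb: "\<And>j. j \<in> {1..n} \<Longrightarrow> bounded_op L L (N j)"
    and Nc: "\<And>j k x. j \<in> {1..n} \<Longrightarrow> k \<in> {1..n} \<Longrightarrow> x \<in> L \<Longrightarrow> N j (N k x) = N k (N j x)"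
    and Nn: "\<And>j. j \<in> {1..n} \<Longrightarrow> normal_op L (N j)" and sp: "taylor_spectrum n L N \<subseteq> bGamma n"
    using G by (auto simp: Gamma_unitary_def commuting_tuple_def)
  have \<Phi>b: "bounded_op E L \<Phi>" and \<Phi>n: "\<And>x. x \<in> E \<Longrightarrow> norm (\<Phi> x) = norm x"
    and Mb: "bounded_op E E M" and Mn: "\<And>x. x \<in> E \<Longrightarrow> norm (M x) = norm x"
    using \<Phi> M by (auto simp: isometric_op_def)
  have \<Phi>inj: "x = y" if "x \<in> E" "y \<in> E" "\<Phi> x = \<Phi> y" for x y
  proof -
    have "norm (x - y) = 0" using \<Phi>n[OF D(7)[OF that(1,2)]] bounded_opD(5)[OF \<Phi>b cE that(1,2)] that(3) by simp
    then show ?thesis by simp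
  qed
  have R'b: "bounded_op E E (R' j)" if "j \<in> {1..<n}" for j
    unfolding R'_def by (rule bounded_op_adjoint'[OF E R[OF that]])
  have adj: "inner (R j x) y = inner x (R' j y)" if "j \<in> {1..<n}" "x \<in> E" "y \<in> E" for j x y
    unfolding R'_def by (rule adjoint_on(2)[OF E R[OF that(1)] that(2)])
  have adj': "inner (R' j x) y = inner x (R j y)" if "j \<in> {1..<n}" "x \<in> E" "y \<in> E" for j x y
    using adj[OF that(1,3,2)] by (simp add: inner_commute)
  note mem = bounded_opD(1)[OF R] bounded_opD(1)[OF R'b] bounded_opD(1)[OF Mb]
  note dcomm = dcomm[folded R'_def]
  have comm': "R' j (R' k x) = R' k (R' j x)" if "j \<in> {1..<n}" "k \<in> {1..<n}" "x \<in> E" for j k x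
    by (rule adjoint_commute[OF cE R[OF that(1)] R'b[OF that(1)] adj[OF that(1)] R[OF that(2)] R'b[OF that(2)]
          adj[OF that(2)] comm[OF that(1,2)] that(3)])
  have MR: "M (R j x) = R j (M x)" if j: "j \<in> {1..<n}" and x: "x \<in> E" for j x
  proof (rule \<Phi>inj)
    have jn: "j \<in> {1..n}" "n \<in> {1..n}" using j by auto
    have "\<Phi> (M (R j x)) = N n (N j (\<Phi> x))" using inter mem j x by simp
    also have "\<dots> = N j (N n (\<Phi> x))" by (rule Nc[OF jn(2,1) bounded_opD(1)[OF \<Phi>b x]])
    finally show "\<Phi> (M (R j x)) = \<Phi> (R j (M x))" using inter mem j x by simp
  qed (use mem j x in auto)
  \<comment> \<open>Fuglede's theorem by hand: normality of R j gives M (R' j x) and R' j (M x) the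
    same norm, and their inner product equals the square of that norm.\<close>
  have MR': "M (R' j x) = R' j (M x)" if j: "j \<in> {1..<n}" and x: "x \<in> E" for j x
  proof -
    have R'n: "norm (R' j v) = norm (R j v)" if "v \<in> E" for v
      using normal_norm_shift[OF cE R[OF j] R'b[OF j] adj[OF j] dcomm[OF j j that] that, of 0] by simp
    have "inner (R' j (M x)) (M (R' j x)) = inner (M x) (M (R j (R' j x)))"
      using adj'[OF j mem(3)[OF x] mem(3)[OF mem(2)[OF j x]]] MR[OF j mem(2)[OF j x]] by simp
    also have "\<dots> = inner x (R j (R' j x))"
      by (rule isometric_op_inner[OF M cE x mem(1)[OF j mem(2)[OF j x]]])
    also have "\<dots> = (norm (R' j x))\<^sup>2" using adj'[OF j x mem(2)[OF j x]] by (simp add: power2_norm_eq_inner)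
    finally have 1: "inner (R' j (M x)) (M (R' j x)) = (norm (R' j x))\<^sup>2" .
    have 2: "norm (R' j (M x)) = norm (R' j x)" "norm (M (R' j x)) = norm (R' j x)"
      using R'n[OF mem(3)[OF x]] R'n[OF x] MR[OF j x] Mn[OF mem(1)[OF j x]] Mn[OF mem(2)[OF j x]] by simp_all
    have "(norm (M (R' j x) - 1 *\<^sub>R R' j (M x)))\<^sup>2 = 0"
      unfolding norm_sq_diff_scaleR using 1 2 by (simp add: inner_commute)
    then show ?thesis by simp
  qed
  have ni: "n - i \<in> {1..<n}" using i by auto
  define T where "T v = R i v - M (R' (n - i) v)" for v
  have Tb: "bounded_op E E T" unfolding T_def by (intro bounded_op_diff R[OF i] bounded_op_comp[OF R'b[OF ni] Mb] cE)
  define T' where "T' = adjoint_on E T"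
  have T'b: "bounded_op E E T'" unfolding T'_def by (rule bounded_op_adjoint'[OF E Tb])
  note Tadj = adjoint_on(2)[OF E Tb, folded T'_def]
  note Tmem = bounded_opD(1)[OF Tb] bounded_opD(1)[OF T'b]
  have TR: "T (R j v) = R j (T v)" if "j \<in> {1..<n}" "v \<in> E" for j v
    unfolding T_def using that ni i mem by (simp add: bounded_opD(5)[OF R cE] comm[of i j] dcomm flip: MR)
  have TR': "T (R' j v) = R' j (T v)" if "j \<in> {1..<n}" "v \<in> E" for j v
    unfolding T_def using that ni i mem by (simp add: bounded_opD(5)[OF R'b cE] comm'[of _ j] MR' dcomm)
  have TM: "T (M v) = M (T v)" if "v \<in> E" for v
    unfolding T_def using that ni i mem by (simp add: bounded_opD(5)[OF Mb cE] MR MR')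
  have T'R: "T' (R j v) = R j (T' v)" if "j \<in> {1..<n}" "v \<in> E" for j v
    by (rule adjoint_commute[OF cE Tb T'b Tadj R'b[OF that(1)] R[OF that(1)] adj'[OF that(1)] TR'[OF that(1)] that(2)])
  have T'R': "T' (R' j v) = R' j (T' v)" if "j \<in> {1..<n}" "v \<in> E" for j v
    by (rule adjoint_commute[OF cE Tb T'b Tadj R[OF that(1)] R'b[OF that(1)] adj[OF that(1)] TR[OF that(1)] that(2)])
  have "T x = 0"
  proof (rule ccontr)
    assume Tx: "T x \<noteq> 0"
    then have x0: "norm x > 0" using bounded_opD(7)[OF Tb cE] by auto
    have "(\<lambda>_. (1 / norm x) *\<^sub>R x) \<in> null_seqs E {}" using D(8)[OF x] by (simp add: null_seqs_def)
    then have "joint_null E {}" unfolding joint_null_def using x0 by (intro bexI) auto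
    \<comment> \<open>Without constraints the maximal value c is the operator norm of T on
      E.\<close>
    from joint_null_maximizer[OF cE _ _ this Tb]
    obtain c w where c0: "c \<ge> 0" and w: "w \<in> null_seqs E {}" "\<And>k. norm (w k) = 1" "(\<lambda>k. norm (T (w k))) \<longlonglongrightarrow> c"
      and ub: "\<And>y \<eta>. y\<in>null_seqs E {} \<Longrightarrow> \<eta> > 0 \<Longrightarrow> \<forall>\<^sub>F k in sequentially. norm (T (y k)) \<le> (c + \<eta>) * norm (y k) + \<eta>"
      by blast
    have Tle: "norm (T v) \<le> c * norm v" if v: "v \<in> E" for v
    proof (rule field_le_epsilon)
      fix e :: real assume e: "e > 0"
      define \<eta> where "\<eta> = e / (norm v + 1)"
      have "norm v + 1 > 0" using norm_ge_zero[of v] by linarith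
      then have \<eta>: "\<eta> > 0" "\<eta> * (norm v + 1) = e" using e by (auto simp: \<eta>_def)
      have "(\<lambda>_. v) \<in> null_seqs E {}" using v by (simp add: null_seqs_def)
      from ub[OF this \<eta>(1)] have "norm (T v) \<le> (c + \<eta>) * norm v + \<eta>" by simp
      then show "norm (T v) \<le> c * norm v + e" unfolding \<eta>(2)[symmetric] by (simp add: algebra_simps)
    qed
    have c: "c > 0" using Tle[OF x] Tx c0 by (cases "c = 0") auto
    have T'le: "norm (T' v) \<le> c * norm v" if v: "v \<in> E" for v
    proof -
      have "(norm (T' v))\<^sup>2 = inner (T (T' v)) v" using Tadj[of "T' v" v] Tmem v by (simp add: power2_norm_eq_inner)
      also have "\<dots> \<le> norm (T (T' v)) * norm v" by (rule norm_cauchy_schwarz)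
      also have "\<dots> \<le> c * norm (T' v) * norm v" by (intro mult_right_mono Tle Tmem v) simp
      finally have "norm (T' v) * norm (T' v) \<le> norm (T' v) * (c * norm v)" by (simp add: power2_eq_square mult_ac)
      then show ?thesis using c by (cases "T' v = 0") auto
    qed
    \<comment> \<open>The kernel of Z is where T attains its norm. For bounded sequences, Z y -> 0
      holds exactly if c^2 |y|^2 - |T y|^2 -> 0: \<open>Zle\<close> gives one direction, and the
      other holds because this difference is minus the inner product of Z y and y.\<close>
    define Z where "Z v = T' (T v) - c\<^sup>2 *\<^sub>R v" for v
    have Zb: "bounded_op E E Z" unfolding Z_def
      by (intro bounded_op_diff bounded_op_comp[OF Tb T'b] bounded_op_scaleR bounded_op_id cE)
    have TT: "inner (T' (T v)) v = (norm (T v))\<^sup>2" if v: "v \<in> E" for v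
      using Tadj[OF v, of "T v"] by (simp add: power2_norm_eq_inner inner_commute)
    have Zle: "(norm (Z v))\<^sup>2 \<le> c\<^sup>2 * (c\<^sup>2 * (norm v)\<^sup>2 - (norm (T v))\<^sup>2)" if v: "v \<in> E" for v
    proof -
      have "(norm (T' (T v)))\<^sup>2 \<le> c\<^sup>2 * (norm (T v))\<^sup>2"
        using power_mono[OF T'le[OF Tmem(1)[OF v]] norm_ge_zero, of 2] by (simp add: power_mult_distrib)
      then show ?thesis unfolding Z_def norm_sq_diff_scaleR TT[OF v] by (simp add: algebra_simps power2_eq_square)
    qed
    have Zlim: "(\<lambda>k. Z (y k)) \<longlonglongrightarrow> 0" if "\<And>k. y k \<in> E" "(\<lambda>k. c\<^sup>2 * (c\<^sup>2 * (norm (y k))\<^sup>2 - (norm (T (y k)))\<^sup>2)) \<longlonglongrightarrow> 0" for y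
    proof -
      have "(\<lambda>k. (norm (Z (y k)))\<^sup>2) \<longlonglongrightarrow> 0"
        by (rule Lim_null_comparison[OF always_eventually that(2)]) (use Zle[OF that(1)] in simp)
      from tendsto_real_sqrt[OF this] show ?thesis by (simp add: tendsto_norm_zero_iff)
    qed
    note wE = null_seqsD(1)[OF w(1)]
    have "(\<lambda>k. c\<^sup>2 * (c\<^sup>2 * (norm (w k))\<^sup>2 - (norm (T (w k)))\<^sup>2)) \<longlonglongrightarrow> c\<^sup>2 * (c\<^sup>2 * 1\<^sup>2 - c\<^sup>2)"
      unfolding w(2) by (intro tendsto_intros w(3))
    then have "(\<lambda>k. Z (w k)) \<longlonglongrightarrow> 0" by (intro Zlim wE) simp
    then have "w \<in> null_seqs E {Z}" using w(1) by (simp add: null_seqs_def)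
    then have jnZ: "joint_null E {Z}" using w(2) by (auto simp: joint_null_def)
    \<comment> \<open>M commutes with T but perhaps not with T', hence perhaps not with Z. It does
      preserve the norms of y and of T y, which by the preceding criterion suffices.\<close>
    have MZ: "preserves E {Z} M"
      unfolding preserves_def
    proof
      fix y assume y: "y \<in> null_seqs E {Z}"
      note yE = null_seqsD(1)[OF y]
      obtain K where K: "\<And>k. norm (y k) \<le> K" using null_seqsD(2)[OF y] by (auto simp: Bseq_def)
      have eq: "c\<^sup>2 * (norm (M (y k)))\<^sup>2 - (norm (T (M (y k))))\<^sup>2 = - inner (Z (y k)) (y k)" for k
        unfolding Z_def inner_diff_left TT[OF yE] TM[OF yE] Mn[OF yE] Mn[OF Tmem(1)[OF yE]]
        by (simp add: power2_norm_eq_inner)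
      have "(\<lambda>k. inner (Z (y k)) (y k)) \<longlonglongrightarrow> 0"
      proof (rule Lim_null_comparison[OF always_eventually])
        show "\<forall>k. norm (inner (Z (y k)) (y k)) \<le> norm (Z (y k)) * K"
          using Cauchy_Schwarz_ineq2 K by (metis mult_left_mono norm_ge_zero order_trans real_norm_def)
        show "(\<lambda>k. norm (Z (y k)) * K) \<longlonglongrightarrow> 0"
          using null_seqsD(3)[OF y] by (intro tendsto_mult_left_zero tendsto_norm_zero) simp
      qed
      from tendsto_mult_right_zero[OF tendsto_minus[OF this, simplified], of "c\<^sup>2"]
      have "(\<lambda>k. Z (M (y k))) \<longlonglongrightarrow> 0" by (intro Zlim mem(3)[OF yE]) (simp add: eq)
      then show "(\<lambda>k. M (y k)) \<in> null_seqs E {Z}"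
        using mem(3)[OF yE] Bseq_bounded_op[OF Mb yE null_seqsD(2)[OF y]] by (simp add: null_seqs_def)
    qed
    \<comment> \<open>Real (True) and imaginary (False) parts of the R j: self-adjoint, and
      commuting with one another because the R j commute doubly.\<close>
    define A where "A = (\<lambda>(j, b) v. if b then (1/2) *\<^sub>C (R j v + R' j v) else (- \<i> / 2) *\<^sub>C (R j v - R' j v))"
    let ?I = "{1..<n} \<times> (UNIV::bool set)"
    have Ab: "bounded_op E E (A p)" if p: "p \<in> ?I" for p
    proof -
      obtain j b where pj: "p = (j, b)" "j \<in> {1..<n}" using p by blast
      have "bounded_op E E (\<lambda>v. (1/2) *\<^sub>C (R j v + R' j v))" "bounded_op E E (\<lambda>v. (- \<i> / 2) *\<^sub>C (R j v - R' j v))"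
        by (intro bounded_op_scaleC bounded_op_add bounded_op_diff R[OF pj(2)] R'b[OF pj(2)] cE)+
      then show ?thesis by (cases b) (simp_all add: A_def pj(1))
    qed
    have Asa: "inner (A p u) v = inner u (A p v)" if p: "p \<in> ?I" and uv: "u \<in> E" "v \<in> E" for p u v
    proof -
      obtain j b where pj: "p = (j, b)" "j \<in> {1..<n}" using p by blast
      have "inner (R j u - R' j u) w = - inner u (R j w - R' j w)" if "w \<in> E" for w
        using adj[OF pj(2) uv(1) that] adj'[OF pj(2) uv(1) that] by (simp add: inner_diff_left inner_diff_right)
      from this[OF D(5)[OF uv(2)], of "\<i> / 2"]
      have "inner (R j u - R' j u) ((\<i> / 2) *\<^sub>C v) = inner u ((- \<i> / 2) *\<^sub>C (R j v - R' j v))"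
        using uv pj(2) by (simp add: bounded_opD(3)[OF R] bounded_opD(3)[OF R'b] scaleC_diff_right scaleC_minus_left inner_diff_right)
      moreover have "inner (R j u + R' j u) v = inner u (R j v + R' j v)"
        using adj[OF pj(2) uv] adj'[OF pj(2) uv] by (simp add: inner_add_left inner_add_right)
      moreover have "(1/2) *\<^sub>C w = (1/2) *\<^sub>R w" for w :: 'a using scaleC_of_real[of "1/2" w] by simp
      ultimately show ?thesis by (simp add: A_def pj(1) inner_scaleC_left)
    qed
    have comA: "A p (C v) = C (A p v)" if "p \<in> ?I" "v \<in> E" "bounded_op E E C"
      "\<And>j. j \<in> {1..<n} \<Longrightarrow> R j (C v) = C (R j v)" "\<And>j. j \<in> {1..<n} \<Longrightarrow> R' j (C v) = C (R' j v)" for p C v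
    proof -
      obtain j b where pj: "p = (j, b)" "j \<in> {1..<n}" using \<open>p \<in> ?I\<close> by blast
      note C = bounded_opD[OF that(3)]
      have e: "R j v \<in> E" "R' j v \<in> E" using mem pj(2) that(2) by auto
      show ?thesis
        using that(4,5)[OF pj(2)] C(2)[OF e] C(5)[OF cE e] C(3)[OF D(4)[OF e]] C(3)[OF D(7)[OF e]]
        by (simp add: A_def pj(1))
    qed
    have AR: "A p (R j v) = R j (A p v)" if "p \<in> ?I" "j \<in> {1..<n}" "v \<in> E" for p j v
      by (rule comA[OF that(1,3) R[OF that(2)]]) (use that comm dcomm in auto)
    have AR': "A p (R' j v) = R' j (A p v)" if "p \<in> ?I" "j \<in> {1..<n}" "v \<in> E" for p j v
      by (rule comA[OF that(1,3) R'b[OF that(2)]]) (use that comm' dcomm in auto)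
    have AA: "A p (A q v) = A q (A p v)" if "p \<in> ?I" "q \<in> ?I" "v \<in> E" for p q v
      by (rule comA[OF that(1,3) Ab[OF that(2)]]) (use that AR AR' in auto)
    have AZ: "A p (Z v) = Z (A p v)" if p: "p \<in> ?I" and v: "v \<in> E" for p v
    proof (rule comA[OF p v Zb])
      fix j assume j: "j \<in> {1..<n}"
      note e = Tmem(2)[OF Tmem(1)[OF v]] D(8)[OF v]
      show "R j (Z v) = Z (R j v)" "R' j (Z v) = Z (R' j v)"
        unfolding Z_def bounded_opD(5)[OF R[OF j] cE e] bounded_opD(5)[OF R'b[OF j] cE e]
        using TR[OF j v] TR'[OF j v] T'R[OF j Tmem(1)[OF v]] T'R'[OF j Tmem(1)[OF v]]
        by (simp_all add: bounded_opD(4)[OF R[OF j] v] bounded_opD(4)[OF R'b[OF j] v])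
    qed
    have AM: "A p (M v) = M (A p v)" if p: "p \<in> ?I" and v: "v \<in> E" for p v
      by (rule comA[OF p v Mb]) (use MR MR' v in auto)
    have pres0: "preserves E {} C" if "bounded_op E E C" for C
      unfolding preserves_def
      using bounded_opD(1)[OF that] Bseq_bounded_op[OF that] by (auto simp: null_seqs_def)
    have presA: "preserves E {Z} (A p)" if p: "p \<in> ?I" for p
      using preserves_union[OF pres0[OF Ab[OF p]] Ab[OF p], of "{Z}"] AZ[OF p] bounded_opD(1)[OF Zb] by auto
    have "\<exists>\<gamma>. joint_null E ({Z} \<union> (\<lambda>p v. A p v - complex_of_real (\<gamma> p) *\<^sub>C v) ` ?I)"
    proof (rule joint_null_selfadjoint_family[OF cE _ _ jnZ])
      show "bounded_op E E B" if "B \<in> {Z}" for B using that Zb by simp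
      show "bounded_op E E (A p)" "preserves E {Z} (A p)" if "p \<in> ?I" for p
        using Ab[OF that] presA[OF that] .
      show "inner (A p v) y = inner v (A p y)" if "p \<in> ?I" "v \<in> E" "y \<in> E" for p v y by (rule Asa[OF that])
      show "A p (A q v) = A q (A p v)" if "p \<in> ?I" "q \<in> ?I" "v \<in> E" for p q v by (rule AA[OF that])
    qed simp_all
    then obtain \<gamma> where g: "joint_null E ({Z} \<union> (\<lambda>p v. A p v - complex_of_real (\<gamma> p) *\<^sub>C v) ` ?I)" by blast
    let ?Y = "(\<lambda>p v. A p v - complex_of_real (\<gamma> p) *\<^sub>C v) ` ?I"
    have Yb: "bounded_op E E Y" if "Y \<in> ?Y" for Y
      using that Ab bounded_op_diff[OF _ bounded_op_scaleC[OF bounded_op_id cE] cE] by auto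
    \<comment> \<open>M commutes with every A p, so the constraints in \<open>?Y\<close> follow by
      commutation; for Z the norm argument \<open>MZ\<close> takes its place.\<close>
    have "\<exists>\<delta>. joint_null E (insert (\<lambda>v. M v - \<delta> *\<^sub>C v) ({Z} \<union> ?Y))"
    proof (rule joint_null_isometry[OF E _ _ g M])
      show "bounded_op E E B" if "B \<in> {Z} \<union> ?Y" for B using that Zb Yb by blast
      show "preserves E ({Z} \<union> ?Y) M"
      proof (rule preserves_union[OF MZ Mb])
        fix Y v assume Y: "Y \<in> ?Y" and v: "v \<in> E"
        show "Y v \<in> E" by (rule bounded_opD(1)[OF Yb[OF Y] v])
        obtain p where p: "p \<in> ?I" "Y = (\<lambda>v. A p v - complex_of_real (\<gamma> p) *\<^sub>C v)" using Y by blast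
        show "Y (M v) = M (Y v)"
          unfolding p(2) bounded_opD(5)[OF Mb cE bounded_opD(1)[OF Ab[OF p(1)] v] D(5)[OF v]] bounded_opD(3)[OF Mb v] AM[OF p(1) v] ..
      qed
    qed simp
    then obtain \<delta> u where u: "u \<in> null_seqs E (insert (\<lambda>v. M v - \<delta> *\<^sub>C v) ({Z} \<union> ?Y))" "\<And>k. norm (u k) = 1"
      by (auto simp: joint_null_def)
    note uE = null_seqsD(1)[OF u(1)]
    have limM: "(\<lambda>k. M (u k) - \<delta> *\<^sub>C u k) \<longlonglongrightarrow> 0" using null_seqsD(3)[OF u(1), of "\<lambda>v. M v - \<delta> *\<^sub>C v"] by simp
    have limZ: "(\<lambda>k. Z (u k)) \<longlonglongrightarrow> 0" using null_seqsD(3)[OF u(1), of Z] by simp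
    have limA: "(\<lambda>k. A p (u k) - complex_of_real (\<gamma> p) *\<^sub>C u k) \<longlonglongrightarrow> 0" if "p \<in> ?I" for p
      using null_seqsD(3)[OF u(1), of "\<lambda>v. A p v - complex_of_real (\<gamma> p) *\<^sub>C v"] that by blast
    define \<mu> where "\<mu> j = (if j \<in> {1..<n} then Complex (\<gamma> (j, True)) (\<gamma> (j, False)) else if j = n then \<delta> else 0)" for j
    have Areim: "A (j, True) v + \<i> *\<^sub>C A (j, False) v = R j v" "A (j, True) v - \<i> *\<^sub>C A (j, False) v = R' j v" for j v
    proof -
      have h: "(1/2) *\<^sub>C a + (1/2) *\<^sub>C a = a" for a :: 'a by (simp flip: scaleC_add_left)
      show "A (j, True) v + \<i> *\<^sub>C A (j, False) v = R j v"
        using h[of "R j v"] by (simp add: A_def scaleC_scaleC scaleC_add_right scaleC_diff_right)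
      show "A (j, True) v - \<i> *\<^sub>C A (j, False) v = R' j v"
        using h[of "R' j v"] by (simp add: A_def scaleC_scaleC scaleC_add_right scaleC_diff_right)
    qed
    have \<mu>_eq: "\<mu> j = complex_of_real (\<gamma> (j, True)) + \<i> * complex_of_real (\<gamma> (j, False))"
      "cnj (\<mu> j) = complex_of_real (\<gamma> (j, True)) - \<i> * complex_of_real (\<gamma> (j, False))" if "j \<in> {1..<n}" for j
      using that by (simp_all add: \<mu>_def complex_eq_iff)
    have limR: "(\<lambda>k. R j (u k) - \<mu> j *\<^sub>C u k) \<longlonglongrightarrow> 0" "(\<lambda>k. R' j (u k) - cnj (\<mu> j) *\<^sub>C u k) \<longlonglongrightarrow> 0"
      if j: "j \<in> {1..<n}" for j
    proof -
      let ?a = "\<lambda>b k. A (j, b) (u k) - complex_of_real (\<gamma> (j, b)) *\<^sub>C u k"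
      have a: "?a b \<longlonglongrightarrow> 0" for b using limA j by simp
      have "(\<lambda>k. ?a True k + \<i> *\<^sub>C ?a False k) \<longlonglongrightarrow> 0 + \<i> *\<^sub>C 0" "(\<lambda>k. ?a True k - \<i> *\<^sub>C ?a False k) \<longlonglongrightarrow> 0 - \<i> *\<^sub>C 0"
        by (intro tendsto_add tendsto_diff bounded_linear.tendsto[OF bounded_linear_scaleC] a)+
      moreover have "?a True k + \<i> *\<^sub>C ?a False k = R j (u k) - \<mu> j *\<^sub>C u k"
        "?a True k - \<i> *\<^sub>C ?a False k = R' j (u k) - cnj (\<mu> j) *\<^sub>C u k" for k
        unfolding \<mu>_eq[OF j] Areim(1)[of j, symmetric] Areim(2)[of j, symmetric]
        by (simp_all add: scaleC_diff_right scaleC_add_left scaleC_diff_left scaleC_scaleC)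
      ultimately show "(\<lambda>k. R j (u k) - \<mu> j *\<^sub>C u k) \<longlonglongrightarrow> 0" "(\<lambda>k. R' j (u k) - cnj (\<mu> j) *\<^sub>C u k) \<longlonglongrightarrow> 0"
        by simp_all
    qed
    have n: "n \<in> {1..n}" and \<mu>n: "\<mu> n = \<delta>" using i by (auto simp: \<mu>_def)
    have "\<mu> \<in> taylor_spectrum n L N"
    proof (rule approximate_point_in_taylor_spectrum[OF L Nb Nn])
      show "\<Phi> (u k) \<in> L" "norm (\<Phi> (u k)) = 1" for k using bounded_opD(1)[OF \<Phi>b uE] \<Phi>n[OF uE] u(2) by auto
      show "\<mu> j = 0" if "j \<notin> {1..n}" for j using that n by (auto simp: \<mu>_def)
      fix j assume j: "j \<in> {1..n}"
      have sc: "\<Phi> (v - c *\<^sub>C u k) = \<Phi> v - c *\<^sub>C \<Phi> (u k)" if "v \<in> E" for v c k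
        using bounded_opD(5)[OF \<Phi>b cE that D(5)[OF uE]] bounded_opD(3)[OF \<Phi>b uE] by simp
      show "(\<lambda>k. N j (\<Phi> (u k)) - \<mu> j *\<^sub>C \<Phi> (u k)) \<longlonglongrightarrow> 0"
      proof (cases "j = n")
        case True
        have "(\<lambda>k. \<Phi> (M (u k) - \<delta> *\<^sub>C u k)) \<longlonglongrightarrow> 0"
          by (rule tendsto_bounded_op_zero[OF \<Phi>b _ limM]) (intro D mem uE)
        then show ?thesis using inter(2)[OF uE] sc[OF mem(3)[OF uE]] by (simp add: True \<mu>n)
      next
        case False
        then have j': "j \<in> {1..<n}" using j by auto
        have "(\<lambda>k. \<Phi> (R j (u k) - \<mu> j *\<^sub>C u k)) \<longlonglongrightarrow> 0"
          by (rule tendsto_bounded_op_zero[OF \<Phi>b _ limR(1)[OF j']]) (intro D mem(1)[OF j'] uE)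
        then show ?thesis using inter(1)[OF j' uE] sc[OF mem(1)[OF j' uE]] by simp
      qed
    qed
    then have \<mu>rel: "\<mu> i = cnj (\<mu> (n - i)) * \<delta>" using sp bGamma_conj[OF _ i] \<mu>n by auto
    \<comment> \<open>T (u k) is split into three eigenvector errors; the remaining scalar multiples
      of u k cancel by \<open>\<mu>rel\<close>.\<close>
    have "(\<lambda>k. (R i (u k) - \<mu> i *\<^sub>C u k) - M (R' (n - i) (u k) - cnj (\<mu> (n - i)) *\<^sub>C u k)
        - cnj (\<mu> (n - i)) *\<^sub>C (M (u k) - \<delta> *\<^sub>C u k)) \<longlonglongrightarrow> 0 - 0 - cnj (\<mu> (n - i)) *\<^sub>C 0"
      by (intro tendsto_diff limR(1)[OF i] tendsto_bounded_op_zero[OF Mb _ limR(2)[OF ni]]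
          bounded_linear.tendsto[OF bounded_linear_scaleC] limM D mem(2)[OF ni] uE)
    moreover have "(R i (u k) - \<mu> i *\<^sub>C u k) - M (R' (n - i) (u k) - cnj (\<mu> (n - i)) *\<^sub>C u k)
        - cnj (\<mu> (n - i)) *\<^sub>C (M (u k) - \<delta> *\<^sub>C u k) = T (u k)" for k
      unfolding \<mu>rel bounded_opD(5)[OF Mb cE mem(2)[OF ni uE] D(5)[OF uE]] bounded_opD(3)[OF Mb uE] T_def
      by (simp add: scaleC_diff_right scaleC_scaleC)
    ultimately have "(\<lambda>k. T (u k)) \<longlonglongrightarrow> 0" by simp
    \<comment> \<open>T' (T (u k)) tends to 0, whereas \<open>limZ\<close> makes it asymptotic to
      c^2 u k.\<close>
    then have "(\<lambda>k. T' (T (u k))) \<longlonglongrightarrow> 0" by (rule tendsto_bounded_op_zero[OF T'b Tmem(1)[OF uE]])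
    from tendsto_diff[OF this limZ] have "(\<lambda>k. c\<^sup>2 *\<^sub>R u k) \<longlonglongrightarrow> 0" by (simp add: Z_def)
    from tendsto_norm[OF this] show False using c u(2) by (simp add: tendsto_const_iff)
  qed
  then show ?thesis by (simp add: T_def R'_def)
qed

section \<open>The last entry of a \<open>\<Gamma>\<^sub>n\<close>-contraction\<close>

lemma foldr_compose_single:
  "distinct xs \<Longrightarrow> foldr (\<lambda>j f. (T j ^^ (if j = i then 1 else 0)) \<circ> f) xs id = (if i \<in> set xs then T i else id)"
  by (induction xs) (auto simp: id_def o_def)

lemma tuple_monomial_single:
  "i \<in> {1..n} \<Longrightarrow> tuple_monomial n T (\<lambda>j. if j = i then 1 else 0) = T i"
  unfolding tuple_monomial_def by (subst foldr_compose_single) auto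

lemma tuple_monomial_zero: "tuple_monomial n T (\<lambda>_. 0) = id"
proof -
  have "foldr (\<lambda>i f. (T i ^^ 0) \<circ> f) xs id = id" for xs by (induction xs) auto
  then show ?thesis by (simp add: tuple_monomial_def)
qed

text \<open>The spectral set inequality for the last coordinate polynomial p and q = 1. On
  \<open>Gamma n\<close> that coordinate is a product of numbers of modulus at most 1.\<close>

lemma Gamma_contraction_last:
  fixes T :: "nat \<Rightarrow> 'a::complex_inner \<Rightarrow> 'a" and x :: 'a
  assumes T: "Gamma_contraction n UNIV T" and n: "n \<ge> 1"
  shows "bounded_op UNIV UNIV (T n)" "norm (T n x) \<le> norm x"
proof -
  show b: "bounded_op UNIV UNIV (T n)" using T n by (auto simp: Gamma_contraction_def commuting_tuple_def)
  define p where "p = (Poly_Mapping.single (Poly_Mapping.single n 1) 1 :: mpolynomial)"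
  define q where "q = (Poly_Mapping.single 0 1 :: mpolynomial)"
  have q: "in_vars n q" "mpoly_eval n q s = 1" "mpoly_op n q T = id" for s
  proof -
    show "in_vars n q" by (simp add: in_vars_def q_def)
    show "mpoly_eval n q s = 1" by (simp add: mpoly_eval_def q_def)
    have "mpoly_op n q T x = x" for x
      using tuple_monomial_zero[of n T] by (simp add: mpoly_op_def q_def lookup_zero[abs_def])
    then show "mpoly_op n q T = id" by (simp add: fun_eq_iff)
  qed
  have l: "Poly_Mapping.lookup (Poly_Mapping.single n (1::nat)) = (\<lambda>j. if j = n then 1 else 0)"
    by (auto simp: lookup_single when_def fun_eq_iff)
  have p: "in_vars n p" "mpoly_op n p T = T n"
  proof -
    show "in_vars n p" using n by (simp add: in_vars_def p_def)
    show "mpoly_op n p T = T n"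
      using tuple_monomial_single[of n n T] n by (simp add: mpoly_op_def p_def l[simplified] fun_eq_iff)
  qed
  have pe: "mpoly_eval n p s = s n" for s
  proof -
    have "(\<Prod>i\<in>{1..n}. s i ^ (if i = n then 1 else 0)) = (\<Prod>i\<in>{1..n}. if i = n then s i else 1)"
      by (intro prod.cong) auto
    also have "\<dots> = s n" using n by (subst prod.delta) auto
    finally show ?thesis by (simp add: mpoly_eval_def p_def l[simplified])
  qed
  have "spectral_set n UNIV T (Gamma n)" using T by (simp add: Gamma_contraction_def)
  note sp = conjunct2[OF this[unfolded spectral_set_def], rule_format, of p q]
  have "op_norm UNIV (mpoly_op n p T \<circ> inv_into UNIV (mpoly_op n q T)) \<le> (SUP s\<in>Gamma n. cmod (mpoly_eval n p s / mpoly_eval n q s))"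
    by (rule sp) (simp add: p(1) q(1,2))
  also have "\<dots> \<le> 1"
  proof (rule cSUP_least)
    show "Gamma n \<noteq> {}" unfolding Gamma_def by (auto intro: exI[of _ "\<lambda>_. 0"])
    fix s assume "s \<in> Gamma n"
    then obtain z where z: "\<forall>i\<in>{1..n}. cmod (z i) \<le> 1" "s = symmetrization n z" by (auto simp: Gamma_def)
    have "{I. I \<subseteq> {1..n} \<and> card I = n} = {{1..n}}" using card_subset_eq[of "{1..n}"] by auto
    then have "s n = (\<Prod>j\<in>{1..n}. z j)" using n z(2) by (simp add: symmetrization_def)
    also have "cmod \<dots> \<le> 1" unfolding prod_norm[symmetric] by (rule prod_le_1) (use z(1) in auto)
    finally show "cmod (mpoly_eval n p s / mpoly_eval n q s) \<le> 1" by (simp add: pe q)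
  qed
  finally have le: "op_norm UNIV (T n) \<le> 1" by (simp add: p(2) q(3))
  obtain K where K: "K > 0" "\<And>x. norm (T n x) \<le> K * norm x" using bounded_op_bound[OF b] by auto
  have bdd: "bdd_above ((\<lambda>x. norm (T n x)) ` {x \<in> UNIV. norm x \<le> 1})"
  proof (rule bdd_aboveI2[where M = K])
    fix x :: 'a assume "x \<in> {x \<in> UNIV. norm x \<le> 1}"
    then have "K * norm x \<le> K * 1" using K(1) by (intro mult_left_mono) auto
    then show "norm (T n x) \<le> K" using K(2)[of x] by linarith
  qed
  show "norm (T n x) \<le> norm x"
  proof (cases "x = 0")
    case True then show ?thesis using bounded_opD(7)[OF b] by (simp add: csubspace_def)
  next
    case False
    have "norm (T n ((1 / norm x) *\<^sub>R x)) \<le> op_norm UNIV (T n)"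
      unfolding op_norm_def by (rule cSUP_upper[OF _ bdd]) (use False in simp)
    then have "norm (T n x) / norm x \<le> 1" using le by (simp add: bounded_opD(4)[OF b])
    then show ?thesis using False by (simp add: divide_le_eq_1)
  qed
qed

section \<open>The operators on \<open>M \<oplus> D\<^sub>P \<oplus> D\<^sub>P \<oplus> \<dots>\<close>\<close>

lemma bounded_linear_ell2_nth: "bounded_linear (\<lambda>h. ell2_nth h k)"
  by (rule bounded_linear_intro[where K = 1]) (simp_all add: ell2_nth_add ell2_nth_scaleR norm_ell2_nth_le)

lemma ell2_eqI: "(\<And>k. ell2_nth a k = ell2_nth b k) \<Longrightarrow> a = b"
  by (metis ell2_nth_inject ext)

lemma inner_ell2_sums: "(\<lambda>k. inner (ell2_nth a k) (ell2_nth b k)) sums inner a b"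
  using summable_sums[OF summable_inner[OF summable_ell2 summable_ell2, of a b]] by (simp add: inner_ell2.rep_eq)

lemma ell2_nth_tendsto_0: "(\<lambda>k. norm (ell2_nth a k)) \<longlonglongrightarrow> 0"
  using tendsto_real_sqrt[OF summable_LIMSEQ_zero[OF summable_ell2[of a]]] by simp

lemma closed_csubspace_Schaffer_space:
  assumes "closed_csubspace (defect_space UNIV P)"
  shows "closed_csubspace (Schaffer_space UNIV P)"
proof -
  note D = closed_csubspaceD[OF assms]
  have "csubspace (Schaffer_space UNIV P)"
    unfolding csubspace_def by (auto simp: Schaffer_space_def ell2_nth_zero ell2_nth_add ell2_nth_scaleC D)
  moreover have "closed (Schaffer_space UNIV P)"
  proof -
    have eq: "Schaffer_space UNIV P = (\<Inter>k\<in>{1..}. (\<lambda>h. ell2_nth h k) -` defect_space UNIV P)"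
      by (auto simp: Schaffer_space_def)
    show ?thesis unfolding eq
      by (intro closed_INT ballI continuous_closed_vimage D(2)
          linear_continuous_at bounded_linear_ell2_nth)
  qed
  ultimately show ?thesis by (simp add: closed_csubspace_def)
qed

lemma summable_sq_bounded_op:
  assumes A: "bounded_op M N A" and f: "\<And>k. f k \<in> M" "summable (\<lambda>k. (norm (f k))\<^sup>2)"
  shows "summable (\<lambda>k::nat. (norm (A (f k)))\<^sup>2)"
proof -
  obtain K where K: "\<And>x. x \<in> M \<Longrightarrow> norm (A x) \<le> K * norm x" using bounded_op_bound[OF A] by blast
  show ?thesis
  proof (rule summable_comparison_test'[OF summable_mult[OF f(2), of "K\<^sup>2"]])
    show "norm ((norm (A (f k)))\<^sup>2) \<le> K\<^sup>2 * (norm (f k))\<^sup>2" for k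
      using power_mono[OF K[OF f(1)] norm_ge_zero, of k 2] by (simp add: power_mult_distrib)
  qed
qed

text \<open>In terms of the sequence \<open>D\<^sub>P h\<^sub>0, h\<^sub>1, h\<^sub>2, \<dots>\<close> all entries of \<open>Schaffer_R\<close> and \<open>Schaffer_V\<close>
  but the first are given by a single formula.\<close>

definition Schaffer_tail :: "('a::chilbert_space \<Rightarrow> 'a) \<Rightarrow> 'a ell2 \<Rightarrow> nat \<Rightarrow> 'a"
  where "Schaffer_tail P h k = (if k = 0 then defect_op UNIV P (ell2_nth h 0) else ell2_nth h k)"

lemma summable_Schaffer_tail: "summable (\<lambda>k. (norm (Schaffer_tail P h k))\<^sup>2)"
proof -
  have "summable (\<lambda>k. (norm (Schaffer_tail P h (Suc k)))\<^sup>2)"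
    using summable_ell2[of h] by (simp add: Schaffer_tail_def summable_Suc_iff[of "\<lambda>k. (norm (ell2_nth h k))\<^sup>2"])
  then show ?thesis by (simp add: summable_Suc_iff[of "\<lambda>k. (norm (Schaffer_tail P h k))\<^sup>2"])
qed

lemma defect_op_mem: "x \<in> M \<Longrightarrow> defect_op M P x \<in> defect_space M P"
  unfolding defect_space_def by (rule subsetD[OF closure_subset]) (rule imageI)

lemma Schaffer_tail_mem: "h \<in> Schaffer_space UNIV P \<Longrightarrow> Schaffer_tail P h k \<in> defect_space UNIV P"
  by (auto simp: Schaffer_space_def Schaffer_tail_def defect_op_mem)

lemma Schaffer_V_nth:
  "ell2_nth (Schaffer_V UNIV P h) 0 = P (ell2_nth h 0)"
  "ell2_nth (Schaffer_V UNIV P h) (Suc k) = Schaffer_tail P h k"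
proof -
  define f where "f = (\<lambda>k::nat. if k = 0 then P (ell2_nth h 0) else if k = 1 then defect_op UNIV P (ell2_nth h 0) else ell2_nth h (k - 1))"
  have f: "f (Suc k) = Schaffer_tail P h k" for k by (simp add: f_def Schaffer_tail_def)
  have "summable (\<lambda>k. (norm (f (Suc k)))\<^sup>2)" unfolding f by (rule summable_Schaffer_tail)
  then have "summable (\<lambda>k. (norm (f k))\<^sup>2)" using summable_Suc_iff[of "\<lambda>k. (norm (f k))\<^sup>2"] by simp
  then have "ell2_nth (Schaffer_V UNIV P h) = f"
    unfolding Schaffer_V_def f_def[symmetric] by (intro Abs_ell2_inverse) simp
  then show "ell2_nth (Schaffer_V UNIV P h) 0 = P (ell2_nth h 0)"
    "ell2_nth (Schaffer_V UNIV P h) (Suc k) = Schaffer_tail P h k" using f by (simp_all add: f_def)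
qed

text \<open>The squared norms of P x and of the defect operator at x add up to that of x, so
  splitting the zeroth entry preserves the norm.\<close>

lemma isometric_op_Schaffer_V:
  fixes P :: "'a::chilbert_space \<Rightarrow> 'a"
  assumes P: "bounded_op UNIV UNIV P" and le: "\<And>x. norm (P x) \<le> norm x"
  shows "isometric_op (Schaffer_space UNIV P) (Schaffer_space UNIV P) (Schaffer_V UNIV P)"
proof -
  note D = defect_op_contraction[OF P le]
  let ?K = "Schaffer_space UNIV P" and ?V = "Schaffer_V UNIV P"
  have n: "norm (?V h) = norm h" for h
  proof -
    let ?x = "ell2_nth h 0"
    have "(norm (defect_op UNIV P ?x))\<^sup>2 = (norm ?x)\<^sup>2 - (norm (P ?x))\<^sup>2"
      using D(2)[of ?x "defect_op UNIV P ?x"] adjoint_on(2)[OF closed_csubspace_UNIV P, of ?x "P ?x"]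
      by (simp add: D(3) inner_diff_right power2_norm_eq_inner)
    moreover have "(\<Sum>k. (norm (ell2_nth (?V h) k))\<^sup>2) = (norm (P ?x))\<^sup>2 + ((norm (defect_op UNIV P ?x))\<^sup>2 + (\<Sum>k. (norm (ell2_nth h (Suc k)))\<^sup>2))"
      using suminf_split_head[OF summable_ell2[of "?V h"]] suminf_split_head[OF summable_Schaffer_tail[of P h]]
      by (simp add: Schaffer_V_nth Schaffer_tail_def)
    moreover have "(\<Sum>k. (norm (ell2_nth h k))\<^sup>2) = (norm ?x)\<^sup>2 + (\<Sum>k. (norm (ell2_nth h (Suc k)))\<^sup>2)"
      using suminf_split_head[OF summable_ell2[of h]] by simp
    ultimately have "(norm (?V h))\<^sup>2 = (norm h)\<^sup>2" by (simp add: norm_ell2_sq)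
    then show ?thesis by (simp add: power2_eq_iff_nonneg)
  qed
  have "bounded_op ?K ?K ?V"
  proof (rule bounded_opI[where K = 1])
    show "?V h \<in> ?K" if "h \<in> ?K" for h
    proof -
      have "ell2_nth (?V h) k \<in> defect_space UNIV P" if "k \<ge> 1" for k
        using that Schaffer_V_nth(2)[of P h "k - 1"] Schaffer_tail_mem[OF \<open>h \<in> ?K\<close>, of "k - 1"] by simp
      then show ?thesis by (simp add: Schaffer_space_def)
    qed
    show "?V (x + y) = ?V x + ?V y" for x y
    proof (rule ell2_eqI)
      show "ell2_nth (?V (x + y)) k = ell2_nth (?V x + ?V y) k" for k
        by (cases k) (simp_all add: Schaffer_V_nth Schaffer_tail_def ell2_nth_add bounded_opD(2)[OF P] bounded_opD(2)[OF D(1)])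
    qed
    show "?V (c *\<^sub>C x) = c *\<^sub>C ?V x" for c x
    proof (rule ell2_eqI)
      show "ell2_nth (?V (c *\<^sub>C x)) k = ell2_nth (c *\<^sub>C ?V x) k" for k
        by (cases k) (simp_all add: Schaffer_V_nth Schaffer_tail_def ell2_nth_scaleC bounded_opD(3)[OF P] bounded_opD(3)[OF D(1)])
    qed
    show "norm (?V h) \<le> 1 * norm h" for h by (simp add: n)
  qed
  then show ?thesis using n by (simp add: isometric_op_def)
qed

lemma Schaffer_R_nth:
  fixes P :: "'a::chilbert_space \<Rightarrow> 'a"
  assumes DP: "closed_csubspace (defect_space UNIV P)"
    and A: "bounded_op (defect_space UNIV P) (defect_space UNIV P) (A i)"
      "bounded_op (defect_space UNIV P) (defect_space UNIV P) (A (n - i))"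
    and h: "h \<in> Schaffer_space UNIV P"
  shows "ell2_nth (Schaffer_R n UNIV S P A i h) 0 = S i (ell2_nth h 0)"
    "ell2_nth (Schaffer_R n UNIV S P A i h) (Suc k)
      = adjoint_on (defect_space UNIV P) (A (n - i)) (Schaffer_tail P h k) + A i (ell2_nth h (Suc k))"
proof -
  let ?D = "defect_space UNIV P" and ?A' = "adjoint_on (defect_space UNIV P) (A (n - i))"
  define f where "f = (\<lambda>k::nat. if k = 0 then S i (ell2_nth h 0)
      else if k = 1 then ?A' (defect_op UNIV P (ell2_nth h 0)) + A i (ell2_nth h 1)
      else ?A' (ell2_nth h (k - 1)) + A i (ell2_nth h k))"
  have f: "f (Suc k) = ?A' (Schaffer_tail P h k) + A i (ell2_nth h (Suc k))" for k
    by (simp add: f_def Schaffer_tail_def)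
  have hD: "ell2_nth h (Suc k) \<in> ?D" for k using h by (simp add: Schaffer_space_def)
  have "summable (\<lambda>k. (norm (ell2_nth h (Suc k)))\<^sup>2)"
    using summable_Suc_iff[of "\<lambda>k. (norm (ell2_nth h k))\<^sup>2"] summable_ell2[of h] by simp
  then have "summable (\<lambda>k. (norm (f (Suc k)))\<^sup>2)"
    unfolding f by (intro summable_sq_add summable_sq_bounded_op[OF bounded_op_adjoint'[OF DP A(2)] Schaffer_tail_mem[OF h]]
      summable_sq_bounded_op[OF A(1) hD] summable_Schaffer_tail)
  then have "summable (\<lambda>k. (norm (f k))\<^sup>2)" using summable_Suc_iff[of "\<lambda>k. (norm (f k))\<^sup>2"] by simp
  then have "ell2_nth (Schaffer_R n UNIV S P A i h) = f"
    unfolding Schaffer_R_def Let_def f_def[symmetric] by (intro Abs_ell2_inverse) simp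
  then show "ell2_nth (Schaffer_R n UNIV S P A i h) 0 = S i (ell2_nth h 0)"
    "ell2_nth (Schaffer_R n UNIV S P A i h) (Suc k) = ?A' (Schaffer_tail P h k) + A i (ell2_nth h (Suc k))"
    using f by (simp_all add: f_def)
qed

text \<open>Entry by entry the difference of both sides telescopes.\<close>

lemma Schaffer_R_V_relation:
  fixes P :: "'a::chilbert_space \<Rightarrow> 'a"
  assumes P: "bounded_op UNIV UNIV P" and le: "\<And>x. norm (P x) \<le> norm x"
    and S: "\<And>j. j \<in> {1..<n} \<Longrightarrow> bounded_op UNIV UNIV (S j)"
    and FO: "FO_tuple n UNIV (S(n := P)) A" and i: "i \<in> {1..<n}"
    and h: "h \<in> Schaffer_space UNIV P" and k: "k \<in> Schaffer_space UNIV P"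
  shows "inner (Schaffer_R n UNIV S P A i h) k = inner (Schaffer_V UNIV P h) (Schaffer_R n UNIV S P A (n - i) k)"
proof -
  let ?D = "defect_space UNIV P" and ?d = "defect_op UNIV P"
  note D = defect_op_contraction[OF P le]
  have A: "bounded_op ?D ?D (A j)" if "j \<in> {1..<n}" for j using FO that by (auto simp: FO_tuple_def)
  have ni: "n - i \<in> {1..<n}" "n - (n - i) = i" using i by auto
  have rel: "S i x - adjoint_on UNIV (S (n - i)) (P x) = ?d (A i (?d x))" for x
  proof -
    have "i \<in> {1..n - 1}" "i \<noteq> n" "n - i \<noteq> n" using i by auto
    then show ?thesis using FO unfolding FO_tuple_def by force
  qed
  let ?R = "Schaffer_R n UNIV S P A" and ?V = "Schaffer_V UNIV P"
  have Rh: "ell2_nth (?R i h) 0 = S i (ell2_nth h 0)"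
    "ell2_nth (?R i h) (Suc m) = adjoint_on ?D (A (n - i)) (Schaffer_tail P h m) + A i (ell2_nth h (Suc m))" for m
    by (rule Schaffer_R_nth[where A = A and i = i and n = n, OF D(4) A[OF i] A[OF ni(1)] h])+
  have Rk: "ell2_nth (?R (n - i) k) 0 = S (n - i) (ell2_nth k 0)"
    "ell2_nth (?R (n - i) k) (Suc m) = adjoint_on ?D (A i) (Schaffer_tail P k m) + A (n - i) (ell2_nth k (Suc m))" for m
    using Schaffer_R_nth[where A = A and i = "n - i" and n = n, OF D(4) A[OF ni(1)] _ k] A[OF i] by (simp_all add: ni(2))
  note u = Schaffer_tail_mem[OF h] and v = Schaffer_tail_mem[OF k]
  have kD: "ell2_nth k (Suc m) \<in> ?D" for m using k by (simp add: Schaffer_space_def)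
  \<comment> \<open>Entry 0 contributes t 0, by the defining equation of the \<open>A i\<close>
    paired with the zeroth entry of k; entry N + 1 contributes t (N + 1) - t N.\<close>
  define t where "t m = inner (A i (Schaffer_tail P h m)) (Schaffer_tail P k m)" for m
  define F where "F m = inner (ell2_nth (?R i h) m) (ell2_nth k m) - inner (ell2_nth (?V h) m) (ell2_nth (?R (n - i) k) m)" for m
  have F: "F sums (inner (?R i h) k - inner (?V h) (?R (n - i) k))"
    unfolding F_def by (intro sums_diff inner_ell2_sums)
  have part: "(\<Sum>m<Suc N. F m) = t N" for N
  proof (induction N)
    case 0
    let ?x = "ell2_nth h 0" and ?y = "ell2_nth k 0"
    have "t 0 = inner (?d (A i (?d ?x))) ?y" by (simp add: t_def Schaffer_tail_def D(2))
    also have "\<dots> = inner (S i ?x) ?y - inner (adjoint_on UNIV (S (n - i)) (P ?x)) ?y"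
      by (simp add: inner_diff_left flip: rel)
    also have "inner (adjoint_on UNIV (S (n - i)) (P ?x)) ?y = inner (P ?x) (S (n - i) ?y)"
      using adjoint_on(2)[OF closed_csubspace_UNIV S[OF ni(1)], of ?y "P ?x"] by (simp add: inner_commute)
    finally show ?case by (simp add: F_def Rh Rk Schaffer_V_nth)
  next
    case (Suc N)
    have 1: "inner (adjoint_on ?D (A (n - i)) (Schaffer_tail P h N)) (ell2_nth k (Suc N))
      = inner (Schaffer_tail P h N) (A (n - i) (ell2_nth k (Suc N)))"
      using adjoint_on(2)[OF D(4) A[OF ni(1)] kD, of N "Schaffer_tail P h N"] by (simp add: inner_commute)
    have 2: "inner (Schaffer_tail P h N) (adjoint_on ?D (A i) (Schaffer_tail P k N)) = t N"
      using adjoint_on(2)[OF D(4) A[OF i] u, of N "Schaffer_tail P k N"] by (simp add: t_def)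
    have "F (Suc N) = t (Suc N) - t N"
      unfolding F_def Rh Rk Schaffer_V_nth inner_add_left inner_add_right 1 2
      by (simp add: t_def Schaffer_tail_def)
    then show ?case using Suc by simp
  qed
  have "(\<lambda>N. t (Suc N)) \<longlonglongrightarrow> 0"
  proof -
    obtain K where K: "\<And>x. x \<in> ?D \<Longrightarrow> norm (A i x) \<le> K * norm x" using bounded_op_bound[OF A[OF i]] by blast
    show ?thesis
    proof (rule Lim_null_comparison[OF always_eventually])
      show "\<forall>N. norm (t (Suc N)) \<le> K * norm (ell2_nth h (Suc N)) * norm (ell2_nth k (Suc N))"
      proof
        fix N
        have "norm (t (Suc N)) \<le> norm (A i (Schaffer_tail P h (Suc N))) * norm (Schaffer_tail P k (Suc N))"
          unfolding t_def real_norm_def by (rule Cauchy_Schwarz_ineq2)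
        also have "\<dots> \<le> K * norm (Schaffer_tail P h (Suc N)) * norm (Schaffer_tail P k (Suc N))"
          by (intro mult_right_mono K u) simp
        finally show "norm (t (Suc N)) \<le> K * norm (ell2_nth h (Suc N)) * norm (ell2_nth k (Suc N))"
          by (simp add: Schaffer_tail_def)
      qed
      show "(\<lambda>N. K * norm (ell2_nth h (Suc N)) * norm (ell2_nth k (Suc N))) \<longlonglongrightarrow> 0"
        by (rule tendsto_mult_zero[OF tendsto_mult_right_zero[OF LIMSEQ_Suc[OF ell2_nth_tendsto_0]] LIMSEQ_Suc[OF ell2_nth_tendsto_0]])
    qed
  qed
  then have "t \<longlonglongrightarrow> 0" by (rule LIMSEQ_imp_Suc)
  moreover have "t \<longlonglongrightarrow> inner (?R i h) k - inner (?V h) (?R (n - i) k)"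
    using LIMSEQ_Suc[OF F[unfolded sums_def]] unfolding part .
  ultimately show ?thesis using LIMSEQ_unique by fastforce
qed

section \<open>Defect spaces of co-isometries\<close>

text \<open>With V' the adjoint of V, 1 - V V' is a projection on K, hence its own positive root.
  The value 0 off K is the convention of \<open>positive_sqrt\<close>.\<close>

lemma defect_op_coisometry:
  fixes V :: "'a::chilbert_space \<Rightarrow> 'a"
  assumes K: "closed_csubspace K" and V: "isometric_op K K V"
  shows "defect_op K (adjoint_on K V) = (\<lambda>x. if x \<in> K then x - V (adjoint_on K V x) else 0)"
  unfolding defect_op_def
proof (rule positive_sqrt_eqI)
  let ?W = "adjoint_on K V" and ?D = "\<lambda>x. if x \<in> K then x - V (adjoint_on K V x) else 0"
  note cK = closed_csubspaceD(1)[OF K]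
  have b: "bounded_op K K V" using V by (simp add: isometric_op_def)
  note W = bounded_op_adjoint'[OF K b]
  note mem = bounded_opD(1)[OF b] bounded_opD(1)[OF W]
  note WV = isometric_op_adjoint_cancel[OF V K]
  have VW: "x - V (?W x) \<in> K" if "x \<in> K" for x using csubspaceD(5)[OF cK that] mem that by blast
  have WV0: "?W (x - V (?W x)) = 0" if "x \<in> K" for x
    using bounded_opD(5)[OF W cK that mem(1)[OF mem(2)[OF that]]] WV[OF mem(2)[OF that]] by simp
  have ii: "inner (V (?W x)) y = inner (?W x) (?W y)" if "x \<in> K" for x y
    using adjoint_on(2)[OF K b mem(2)[OF that]] .
  show "csubspace K" by (rule cK)
  have "bounded_op K K (\<lambda>x. x - V (?W x))" by (intro bounded_op_diff bounded_op_id bounded_op_comp[OF W b] cK)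
  then show "bounded_op K K ?D" by (simp add: bounded_op_def csubspaceD[OF cK])
  show "inner (?D x) y = inner x (?D y)" if "x \<in> K" "y \<in> K" for x y
    using that ii[of x y] ii[of y x] by (simp add: inner_diff_left inner_diff_right inner_commute)
  show "0 \<le> inner (?D x) x" if x: "x \<in> K" for x
  proof -
    have "inner (x - V (?W x)) (x - V (?W x)) = inner (x - V (?W x)) x"
      using ii[OF x, of "x - V (?W x)"] WV0[OF x] by (simp add: inner_diff_right inner_commute)
    then show ?thesis using x by (metis inner_ge_zero)
  qed
  have A: "x - adjoint_on K ?W (?W x) = x - V (?W x)" if "x \<in> K" for x
    using adjoint_adjoint[OF K K b mem(2)[OF that]] by simp
  show "?D (?D x) = x - adjoint_on K ?W (?W x)" if "x \<in> K" for x
    using that VW[OF that] WV0[OF that] bounded_opD(7)[OF b cK] by (simp add: A)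
  show "?D x = 0" if "x \<notin> K" for x using that by simp
  show "Q (?D x) = ?D (Q x)" if Q: "bounded_op K K Q" and c: "\<And>y. y \<in> K \<Longrightarrow> Q (y - adjoint_on K ?W (?W y)) = Q y - adjoint_on K ?W (?W (Q y))"
    and x: "x \<in> K" for Q x
    using c[OF x] A[OF x] A[OF bounded_opD(1)[OF Q x]] x bounded_opD(1)[OF Q x] by simp
qed

lemma defect_space_coisometry:
  fixes V :: "'a::chilbert_space \<Rightarrow> 'a"
  assumes K: "closed_csubspace K" and V: "isometric_op K K V"
  shows "defect_space K (adjoint_on K V) = closure ((\<lambda>x. x - V (adjoint_on K V x)) ` K)"
    "closed_csubspace (defect_space K (adjoint_on K V))"
proof -
  have b: "bounded_op K K V" using V by (simp add: isometric_op_def)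
  note cK = closed_csubspaceD(1)[OF K]
  show eq: "defect_space K (adjoint_on K V) = closure ((\<lambda>x. x - V (adjoint_on K V x)) ` K)"
    unfolding defect_space_def defect_op_coisometry[OF K V] by (intro arg_cong[where f = closure] image_cong) auto
  have "bounded_op K K (\<lambda>x. x - V (adjoint_on K V x))"
    by (intro bounded_op_diff bounded_op_id bounded_op_comp[OF bounded_op_adjoint'[OF K b] b] cK)
  then show "closed_csubspace (defect_space K (adjoint_on K V))"
    unfolding eq by (rule closed_csubspace_closure_image[OF cK])
qed

lemma reducing_restrict:
  fixes V :: "'a::chilbert_space \<Rightarrow> 'a"
  assumes K: "closed_csubspace K" and V: "isometric_op K K V" and r: "reducing K V N"
  shows "isometric_op N N V" "x \<in> N \<Longrightarrow> adjoint_on N V x = adjoint_on K V x"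
proof -
  have b: "bounded_op K K V" using V by (simp add: isometric_op_def)
  have N: "closed_csubspace N" "N \<subseteq> K" "\<And>x. x \<in> N \<Longrightarrow> V x \<in> N" "\<And>x. x \<in> N \<Longrightarrow> adjoint_on K V x \<in> N"
    using r by (auto simp: reducing_def)
  have bN: "bounded_op N N V" using bounded_op_mono[OF b N(2,3)] .
  then show "isometric_op N N V" using V N(2) by (auto simp: isometric_op_def)
  show "adjoint_on N V x = adjoint_on K V x" if "x \<in> N"
    by (rule adjoint_on_eqI[OF N(1) bN N(4)[OF that]]) (use adjoint_on(2)[OF K b] N(2) in blast)
qed

text \<open>A normal isometry is unitary, so 1 - V V' vanishes on K2 and its range comes from K1
  alone.\<close>

lemma defect_space_pure_part:
  fixes V :: "'a::chilbert_space \<Rightarrow> 'a"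
  assumes K: "closed_csubspace K" and V: "isometric_op K K V" and sum: "orthogonal_sum K K1 K2"
    and r1: "reducing K V K1" and r2: "reducing K V K2" and nm: "normal_op K2 V"
  shows "defect_space K1 (adjoint_on K1 V) = defect_space K (adjoint_on K V)"
proof -
  have b: "bounded_op K K V" using V by (simp add: isometric_op_def)
  note W = bounded_op_adjoint'[OF K b]
  have K1: "closed_csubspace K1" and K2: "closed_csubspace K2" using r1 r2 by (auto simp: reducing_def)
  have sub: "K1 \<subseteq> K" "K2 \<subseteq> K" using r1 r2 by (auto simp: reducing_def)
  note V1 = reducing_restrict[OF K V r1] and V2 = reducing_restrict[OF K V r2]
  have z: "V (adjoint_on K V y) = y" if y: "y \<in> K2" for y
  proof -
    have "V (adjoint_on K2 V y) = adjoint_on K2 V (V y)" using nm y by (simp add: normal_op_def)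
    also have "\<dots> = y" by (rule isometric_op_adjoint_cancel[OF V2(1) K2 y])
    finally show ?thesis by (simp add: V2(2)[OF y])
  qed
  let ?D = "\<lambda>x. x - V (adjoint_on K V x)"
  have bD: "bounded_op K K ?D" by (intro bounded_op_diff bounded_op_id bounded_op_comp[OF W b] closed_csubspaceD(1)[OF K])
  have "?D ` K = ?D ` K1"
  proof
    show "?D ` K1 \<subseteq> ?D ` K" using sub by blast
    show "?D ` K \<subseteq> ?D ` K1"
    proof
      fix w assume "w \<in> ?D ` K"
      then obtain x y where xy: "x \<in> K1" "y \<in> K2" "w = ?D (x + y)" using sum by (auto simp: orthogonal_sum_def)
      have "w = ?D x + ?D y" unfolding xy(3) by (rule bounded_opD(2)[OF bD]) (use xy sub in auto)
      then have "w = ?D x" using z[OF xy(2)] by simp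
      then show "w \<in> ?D ` K1" using xy(1) by blast
    qed
  qed
  moreover have "(\<lambda>x. x - V (adjoint_on K1 V x)) ` K1 = ?D ` K1" by (rule image_cong) (simp_all add: V1(2))
  ultimately show ?thesis
    unfolding defect_space_coisometry(1)[OF K V] defect_space_coisometry(1)[OF K1 V1(1)] by simp
qed

section \<open>Operators on the Hardy space\<close>

lemma hardy_coeffs_in: "closed_csubspace E \<Longrightarrow> f \<in> hardy_space E \<Longrightarrow> ell2_nth (hardy_coeffs f) k \<in> E"
  by (rule hardy_coeffs_mem) (auto simp: hardy_space_def hardy_eval_conv)

text \<open>Composition with the projection onto E extends X to a bounded linear map of the whole
  type, which can be exchanged with the power series.\<close>

lemma hardy_coeffs_map:
  assumes E: "closed_csubspace E" and X: "bounded_op E E X" and f: "f \<in> hardy_space E"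
  shows "ell2_nth (hardy_coeffs (hardy_map X f)) k = X (ell2_nth (hardy_coeffs f) k)"
proof -
  define a where "a = hardy_coeffs f"
  have aE: "ell2_nth a k \<in> E" for k unfolding a_def by (rule hardy_coeffs_in[OF E f])
  define b where "b = Abs_ell2 (\<lambda>k. X (ell2_nth a k))"
  have b: "ell2_nth b k = X (ell2_nth a k)" for k
    unfolding b_def using summable_sq_bounded_op[OF X aE summable_ell2] by (simp add: Abs_ell2_inverse)
  define T where "T x = X (orth_proj E x)" for x
  have T: "bounded_linear T" unfolding T_def by (rule bounded_linear_extension[OF E X])
  have TX: "T x = X x" if "x \<in> E" for x using that by (simp add: T_def orth_proj_ident[OF E])
  have fE: "hardy_eval f z \<in> E" for z using f by (simp add: hardy_space_def)
  have "hardy_eval (hardy_map X f) z = hardy_series b z" for z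
  proof -
    have "hardy_eval (hardy_map X f) z = T (hardy_series a z)"
      using hardy_eval_map[OF E X f, of z] TX[OF fE[of z]] by (simp add: a_def hardy_eval_conv)
    also have "\<dots> = hardy_series b z"
    proof (cases "cmod z < 1")
      case True
      have "T (z ^ n *\<^sub>C ell2_nth a n) = z ^ n *\<^sub>C ell2_nth b n" for n
        by (simp add: TX aE closed_csubspaceD[OF E] bounded_opD(3)[OF X aE] b)
      then show ?thesis
        using bounded_linear.suminf[OF T summable_hardy_series[OF True, of a]] True by (simp add: hardy_series_def)
    qed (simp add: hardy_series_def bounded_linear.linear[OF T] linear_0)
    finally show ?thesis .
  qed
  then have "hardy_map X f = hardy_of_coeffs b" by (simp add: hardy_eval_inject[symmetric] hardy_eval_of_coeffs fun_eq_iff)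
  then show ?thesis by (simp add: b a_def)
qed

lemma hardy_eqI: "(\<And>k. ell2_nth (hardy_coeffs f) k = ell2_nth (hardy_coeffs g) k) \<Longrightarrow> f = g"
  using ell2_eqI hardy_coeffs_inject by blast

lemma bounded_op_hardy_map:
  assumes E: "closed_csubspace E" and X: "bounded_op E E X"
  shows "bounded_op (hardy_space E) (hardy_space E) (hardy_map X)"
proof -
  obtain K where K: "K > 0" "\<And>x. x \<in> E \<Longrightarrow> norm (X x) \<le> K * norm x" using bounded_op_bound[OF X] by blast
  note cm = hardy_coeffs_map[OF E X] and ci = hardy_coeffs_in[OF E]
  note H = closed_csubspaceD[OF closed_csubspace_hardy_space[OF E]]
  show ?thesis
  proof (rule bounded_opI[where K = K])
    show "hardy_map X f \<in> hardy_space E" if "f \<in> hardy_space E" for f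
      using that bounded_opD(1)[OF X] by (simp add: hardy_space_def hardy_eval_map[OF E X that])
    show "hardy_map X (f + g) = hardy_map X f + hardy_map X g" if "f \<in> hardy_space E" "g \<in> hardy_space E" for f g
      by (rule hardy_eqI) (simp add: cm that H(4) hardy_coeffs_linear ell2_nth_add bounded_opD(2)[OF X] ci)
    show "hardy_map X (c *\<^sub>C f) = c *\<^sub>C hardy_map X f" if "f \<in> hardy_space E" for c f
      by (rule hardy_eqI) (simp add: cm that H(5) hardy_coeffs_linear ell2_nth_scaleC bounded_opD(3)[OF X] ci)
    show "norm (hardy_map X f) \<le> K * norm f" if f: "f \<in> hardy_space E" for f
    proof -
      let ?a = "hardy_coeffs f"
      have "(norm (hardy_map X f))\<^sup>2 = (\<Sum>k. (norm (X (ell2_nth ?a k)))\<^sup>2)"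
        unfolding norm_hardy_coeffs[symmetric, of "hardy_map X f"] norm_ell2_sq cm[OF f] ..
      also have "\<dots> \<le> (\<Sum>k. K\<^sup>2 * (norm (ell2_nth ?a k))\<^sup>2)"
      proof (intro suminf_le allI)
        show "(norm (X (ell2_nth ?a k)))\<^sup>2 \<le> K\<^sup>2 * (norm (ell2_nth ?a k))\<^sup>2" for k
          using power_mono[OF K(2)[OF ci[OF f]] norm_ge_zero, of k 2] by (simp add: power_mult_distrib)
      qed (intro summable_sq_bounded_op[OF X ci[OF f]] summable_mult summable_ell2)+
      also have "\<dots> = (K * norm f)\<^sup>2"
        by (simp add: suminf_mult[OF summable_ell2] power_mult_distrib norm_hardy_coeffs flip: norm_ell2_sq)
      finally show ?thesis by (rule power2_le_imp_le) (use K(1) in simp)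
    qed
  qed
qed

lemma inner_hardy_map:
  assumes E: "closed_csubspace E" and X: "bounded_op E E X" and Y: "bounded_op E E Y"
    and adj: "\<And>x y. x \<in> E \<Longrightarrow> y \<in> E \<Longrightarrow> inner (X x) y = inner x (Y y)"
    and f: "f \<in> hardy_space E" and g: "g \<in> hardy_space E"
  shows "inner (hardy_map X f) g = inner f (hardy_map Y g)"
proof -
  have "(\<lambda>k. inner (X (ell2_nth (hardy_coeffs f) k)) (ell2_nth (hardy_coeffs g) k)) sums inner (hardy_map X f) g"
    using inner_ell2_sums[of "hardy_coeffs (hardy_map X f)" "hardy_coeffs g"]
    by (simp add: inner_hardy_def hardy_coeffs_map[OF E X f])
  moreover have "(\<lambda>k. inner (ell2_nth (hardy_coeffs f) k) (Y (ell2_nth (hardy_coeffs g) k))) sums inner f (hardy_map Y g)"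
    using inner_ell2_sums[of "hardy_coeffs f" "hardy_coeffs (hardy_map Y g)"]
    by (simp add: inner_hardy_def hardy_coeffs_map[OF E Y g])
  ultimately show ?thesis using adj hardy_coeffs_in[OF E f] hardy_coeffs_in[OF E g] sums_unique2 by simp
qed

lemma norm_L2_mult_exp: "norm (L2_mult_exp g) = norm g"
proof -
  have "inner (L2_mult_exp g) (L2_mult_exp g) = inner g g"
    by transfer (simp add: norm_scaleC flip: power2_norm_eq_inner)
  then show ?thesis by (simp add: norm_eq_sqrt_inner)
qed

section \<open>Dilations\<close>

text \<open>The definition of \<open>Gamma_isometry\<close> asks of the entries that they map M into
  itself; linearity, boundedness and commutation are pulled back from the unitary extension along
  the injective J.\<close>

lemma Gamma_isometry_commuting_tuple:
  assumes "Gamma_isometry TYPE('e::chilbert_space) n M T"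
  shows "commuting_tuple n M T"
proof -
  obtain L :: "'e set" and N J where M: "closed_csubspace M" and TM: "\<And>i x. i \<in> {1..n} \<Longrightarrow> x \<in> M \<Longrightarrow> T i x \<in> M"
    and G: "Gamma_unitary n L N" and J: "isometric_op M L J"
    and NJ: "\<And>i x. i \<in> {1..n} \<Longrightarrow> x \<in> M \<Longrightarrow> N i (J x) = J (T i x)"
    using assms unfolding Gamma_isometry_def by blast
  have Jb: "bounded_op M L J" and Jn: "\<And>x. x \<in> M \<Longrightarrow> norm (J x) = norm x" using J by (auto simp: isometric_op_def)
  note D = closed_csubspaceD[OF M]
  have Jinj: "x = y" if "x \<in> M" "y \<in> M" "J x = J y" for x y
  proof -
    have "norm (x - y) = 0" using Jn[OF D(7)[OF that(1,2)]] bounded_opD(5)[OF Jb D(1) that(1,2)] that(3) by simp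
    then show ?thesis by simp
  qed
  have Nb: "bounded_op L L (N i)" if "i \<in> {1..n}" for i using G that by (auto simp: Gamma_unitary_def commuting_tuple_def)
  have "bounded_op M M (T i)" if i: "i \<in> {1..n}" for i
  proof -
    obtain K where K: "\<And>x. x \<in> L \<Longrightarrow> norm (N i x) \<le> K * norm x" using bounded_op_bound[OF Nb[OF i]] by blast
    show ?thesis
    proof (rule bounded_opI[where K = K])
      show "T i (x + y) = T i x + T i y" if "x \<in> M" "y \<in> M" for x y
        by (rule Jinj) (use that D TM[OF i] NJ[OF i] bounded_opD(1,2)[OF Jb] bounded_opD(2)[OF Nb[OF i]] in \<open>simp_all flip: NJ[OF i]\<close>)
      show "T i (c *\<^sub>C x) = c *\<^sub>C T i x" if "x \<in> M" for c x
        by (rule Jinj) (use that D TM[OF i] NJ[OF i] bounded_opD(1,3)[OF Jb] bounded_opD(3)[OF Nb[OF i]] in \<open>simp_all flip: NJ[OF i]\<close>)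
      show "norm (T i x) \<le> K * norm x" if "x \<in> M" for x
        using K[OF bounded_opD(1)[OF Jb that]] NJ[OF i that] Jn[OF TM[OF i that]] Jn[OF that] by simp
    qed (rule TM[OF i])
  qed
  moreover have "T i (T j x) = T j (T i x)" if "i \<in> {1..n}" "j \<in> {1..n}" "x \<in> M" for i j x
  proof (rule Jinj)
    have "J (T i (T j x)) = N i (N j (J x))" using that TM NJ by simp
    also have "\<dots> = N j (N i (J x))" using G that bounded_opD(1)[OF Jb] by (simp add: Gamma_unitary_def commuting_tuple_def)
    finally show "J (T i (T j x)) = J (T j (T i x))" using that TM NJ by simp
  qed (use that TM in auto)
  ultimately show ?thesis using M by (simp add: commuting_tuple_def)
qed

text \<open>The last entry is the innermost factor of \<open>tuple_monomial\<close>; applied from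
  outside it has to pass all other factors before it raises the exponent.\<close>

lemma tuple_monomial_last:
  assumes T: "commuting_tuple n M T" and n: "n \<ge> 1" and x: "x \<in> M"
  shows "tuple_monomial n T k x \<in> M" "T n (tuple_monomial n T k x) = tuple_monomial n T (k(n := Suc (k n))) x"
proof -
  define g where "g k xs = foldr (\<lambda>i f. (T i ^^ k i) \<circ> f) xs id" for k :: "nat \<Rightarrow> nat" and xs
  have app: "foldr (\<lambda>i f. (T i ^^ k i) \<circ> f) xs h = g k xs \<circ> h" for k :: "nat \<Rightarrow> nat" and xs h
    by (induction xs) (auto simp: g_def)
  have upt: "[1..<Suc n] = [1..<n] @ [n]" using n by simp
  have tm: "tuple_monomial n T k = g k [1..<n] \<circ> (T n ^^ k n)" for k
    unfolding tuple_monomial_def upt foldr_append by (simp add: app)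
  have n1: "n \<in> {1..n}" using n by simp
  have mem: "T i y \<in> M" if "i \<in> {1..n}" "y \<in> M" for i y using T that by (auto simp: commuting_tuple_def dest: bounded_opD(1))
  have comm: "T n (T i y) = T i (T n y)" if "i \<in> {1..n}" "y \<in> M" for i y using T that n1 by (auto simp: commuting_tuple_def)
  have pow: "(T i ^^ m) y \<in> M \<and> T n ((T i ^^ m) y) = (T i ^^ m) (T n y)" if "i \<in> {1..n}" "y \<in> M" for i m y
    by (induction m) (use that mem comm in auto)
  have gm: "set xs \<subseteq> {1..n} \<Longrightarrow> g k xs y \<in> M \<and> T n (g k xs y) = g k xs (T n y)" if "y \<in> M" for k xs y
  proof (induction xs)
    case (Cons i xs)
    then show ?case using pow[of i "g k xs y" "k i"] by (simp add: g_def)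
  qed (use that in \<open>simp add: g_def\<close>)
  have s: "set [1..<n] \<subseteq> {1..n}" by auto
  note p = pow[OF n1 x, of "k n"]
  show "tuple_monomial n T k x \<in> M" using gm[OF conjunct1[OF p] s] by (simp add: tm)
  have "g (k(n := Suc (k n))) [1..<n] = g k [1..<n]"
    unfolding g_def by (rule foldr_cong) auto
  then show "T n (tuple_monomial n T k x) = tuple_monomial n T (k(n := Suc (k n))) x"
    using gm[OF conjunct1[OF p] s] by (simp add: tm)
qed

text \<open>The vectors of L at which both sides agree form a closed subspace. It contains the
  monomials applied to J x, since one more factor Q n compresses to one more factor T n; by
  minimality these span a dense subspace of L.\<close>

lemma minimal_dilation_coextension:
  fixes M :: "'a::chilbert_space set" and L :: "'b::chilbert_space set"
  assumes dil: "minimal_Gamma_isometric_dilation TYPE('e::chilbert_space) n M T L Q J"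
    and T: "commuting_tuple n M T" and n: "n \<ge> 1" and v: "v \<in> L"
  shows "adjoint_on M J (Q n v) = T n (adjoint_on M J v)"
proof -
  have G: "Gamma_isometry TYPE('e) n L Q" and J: "isometric_op M L J"
    and d: "\<And>k x. x \<in> M \<Longrightarrow> adjoint_on M J (tuple_monomial n Q k (J x)) = tuple_monomial n T k x"
    and L: "L = closure (cspan {tuple_monomial n Q k (J x) | k x. x \<in> M})"
    using dil by (auto simp: minimal_Gamma_isometric_dilation_def Gamma_isometric_dilation_def)
  note Q = Gamma_isometry_commuting_tuple[OF G]
  have M: "closed_csubspace M" and LC: "closed_csubspace L" using T Q by (auto simp: commuting_tuple_def)
  have Jb: "bounded_op M L J" using J by (simp add: isometric_op_def)
  have Qn: "bounded_op L L (Q n)" and Tn: "bounded_op M M (T n)" using Q T n by (auto simp: commuting_tuple_def)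
  note Js = bounded_op_adjoint'[OF M Jb]
  let ?E = "\<lambda>v. adjoint_on M J (Q n v) - T n (adjoint_on M J v)"
  have E: "bounded_op L M ?E"
    by (intro bounded_op_diff bounded_op_comp[OF Qn Js] bounded_op_comp[OF Js Tn] closed_csubspaceD(1)[OF M])
  define Z where "Z = {v \<in> L. ?E v = 0}"
  have "csubspace Z"
    unfolding csubspace_def
  proof (intro conjI ballI allI)
    note LD = closed_csubspaceD[OF LC]
    show "0 \<in> Z" unfolding Z_def using bounded_opD(7)[OF E LD(1)] LD(3) by simp
    show "x + y \<in> Z" if "x \<in> Z" "y \<in> Z" for x y
    proof -
      have "x \<in> L" "y \<in> L" "?E x = 0" "?E y = 0" using that by (auto simp: Z_def)
      then show ?thesis unfolding Z_def using bounded_opD(2)[OF E, of x y] LD(4) by simp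
    qed
    show "c *\<^sub>C x \<in> Z" if "x \<in> Z" for c x
    proof -
      have "x \<in> L" "?E x = 0" using that by (auto simp: Z_def)
      then show ?thesis unfolding Z_def using bounded_opD(3)[OF E, of x c] LD(5) by simp
    qed
  qed
  moreover have "closed Z"
    unfolding closed_sequential_limits
  proof (intro allI impI)
    fix f l assume f: "(\<forall>k. f k \<in> Z) \<and> f \<longlonglongrightarrow> l"
    then have fL: "\<And>k. f k \<in> L" "\<And>k. ?E (f k) = 0" by (auto simp: Z_def)
    have l: "l \<in> L" using closed_sequentially[OF closed_csubspaceD(2)[OF LC], of f l] fL(1) f by blast
    have "(\<lambda>k. ?E (f k - l)) \<longlonglongrightarrow> 0"
      by (rule tendsto_bounded_op_zero[OF E]) (use f fL l closed_csubspaceD(7)[OF LC] in \<open>auto simp: LIM_zero\<close>)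
    moreover have "?E (f k - l) = - ?E l" for k
      using bounded_opD(5)[OF E closed_csubspaceD(1)[OF LC] fL(1) l, of k] fL(2)[of k] by simp
    ultimately have "(\<lambda>k::nat. - ?E l) \<longlonglongrightarrow> 0" by (simp only:)
    then have "?E l = 0" unfolding tendsto_const_iff[OF sequentially_bot] by simp
    then show "l \<in> Z" using l by (simp add: Z_def)
  qed
  moreover have "{tuple_monomial n Q k (J x) | k x. x \<in> M} \<subseteq> Z"
  proof
    fix w assume "w \<in> {tuple_monomial n Q k (J x) | k x. x \<in> M}"
    then obtain k x where w: "w = tuple_monomial n Q k (J x)" and x: "x \<in> M" by blast
    note q = tuple_monomial_last[OF Q n bounded_opD(1)[OF Jb x], of k]
    show "w \<in> Z"
      using q(1) d[OF x] tuple_monomial_last(2)[OF T n x, of k] by (simp add: Z_def w q(2))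
  qed
  ultimately have "closure (cspan {tuple_monomial n Q k (J x) | k x. x \<in> M}) \<subseteq> Z"
    by (intro closure_minimal cspan_minimal)
  then have "v \<in> Z" using v L by blast
  then show ?thesis by (simp add: Z_def)
qed

theorem theorem3p7:
  fixes n :: nat
    and P :: "'h::chilbert_space \<Rightarrow> 'h"
    and S A B C :: "nat \<Rightarrow> 'h \<Rightarrow> 'h"
    and DP DPs :: "'h set"
    and K K1 K2 DVs DV1s :: "'h ell2 set"
    and V :: "'h ell2 \<Rightarrow> 'h ell2"
    and R G :: "nat \<Rightarrow> 'h ell2 \<Rightarrow> 'h ell2"
    and U1 :: "'h \<Rightarrow> 'h ell2"
    and U2 :: "'h L2circle \<Rightarrow> 'h ell2"
    and X Y :: "nat \<Rightarrow> 'h \<Rightarrow> 'h"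
    and St1 :: "nat \<Rightarrow> 'h hardy \<Rightarrow> 'h hardy"
    and St2 :: "nat \<Rightarrow> 'h L2circle \<Rightarrow> 'h L2circle"
    and St :: "nat \<Rightarrow> 'h hardy \<times> 'h L2circle \<Rightarrow> 'h hardy \<times> 'h L2circle"
    and Pt :: "'h hardy \<times> 'h L2circle \<Rightarrow> 'h hardy \<times> 'h L2circle"
    and J :: "'h \<Rightarrow> 'h hardy \<times> 'h L2circle"
  assumes "n \<ge> 2"
    and "Gamma_contraction n UNIV (S(n := P))"
    and "cnu UNIV P"
    and DP: "DP = defect_space UNIV P"
    and DPs: "DPs = defect_space UNIV (adjoint_on UNIV P)"
    and "FO_tuple n UNIV (S(n := P)) A"
    and "FO_tuple n UNIV (adjoint_tuple UNIV (S(n := P))) B"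
    and Sigma1: "\<And>z. cmod z < 1 \<Longrightarrow> Gamma_contraction (n - 1) DP
      (\<lambda>i x. complex_of_real (real (n - i) / real n) *\<^sub>C
        (A i x + z *\<^sub>C adjoint_on DP (A (n - i)) x))"
    and Sigma2: "\<And>z. cmod z < 1 \<Longrightarrow> Gamma_contraction (n - 1) DPs
      (\<lambda>i x. complex_of_real (real (n - i) / real n) *\<^sub>C
        (adjoint_on DPs (B i) x + z *\<^sub>C B (n - i) x))"
    and K: "K = Schaffer_space UNIV P"
    and R: "R = Schaffer_R n UNIV S P A"
    and V: "V = Schaffer_V UNIV P"
    and Wold: "orthogonal_sum K K1 K2"
      "\<And>i. i \<in> {1..n} \<Longrightarrow> reducing K ((R(n := V)) i) K1"
      "\<And>i. i \<in> {1..n} \<Longrightarrow> reducing K ((R(n := V)) i) K2"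
      "pure_Gamma_isometry TYPE('e::chilbert_space) n K1 (R(n := V))"
      "Gamma_unitary n K2 (R(n := V))"
    and DVs: "DVs = defect_space K (adjoint_on K V)"
    and DV1s: "DV1s = defect_space K1 (adjoint_on K1 V)"
    and "FO_tuple n K1 (adjoint_tuple K1 (R(n := V))) G"
    and "unitary_op DPs DVs U1"
    and "unitary_op (Delta_L2 UNIV P) K2 U2"
    and X: "X = (\<lambda>i. adjoint_on DPs U1 \<circ> adjoint_on DV1s (G i) \<circ> U1)"
    and Y: "Y = (\<lambda>i. adjoint_on DPs U1 \<circ> G i \<circ> U1)"
    and St1: "St1 = (\<lambda>i f. hardy_map (X i) f + hardy_mult_z (hardy_map (Y (n - i)) f))"
    and St2: "St2 = (\<lambda>i. adjoint_on (Delta_L2 UNIV P) U2 \<circ> R i \<circ> U2)"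
    and St: "St = (\<lambda>i (f, g). (St1 i f, St2 i g))"
    and Pt: "Pt = (\<lambda>(f, g). (hardy_mult_z f, L2_mult_exp g))"
    and "minimal_Gamma_isometric_dilation TYPE('f::chilbert_space) n UNIV (S(n := P))
      (hardy_space DPs \<times> Delta_L2 UNIV P) (St(n := Pt)) J"
    and C: "C = (\<lambda>i x. adjoint_on UNIV J
      (case J x of (f, g) \<Rightarrow> (hardy_map (X i) f, (1 / 2) *\<^sub>C St2 i g)))"
  shows "\<forall>i\<in>{1..n - 1}. \<forall>x. S i x = C i x + P (adjoint_on UNIV (C (n - i)) x)"
proof (intro ballI allI)
  fix i x assume i': "i \<in> {1..n - 1}"
  have n: "n \<ge> 1" and i: "i \<in> {1..<n}" and ni: "n - i \<in> {1..<n}" "n - (n - i) = i" using \<open>n \<ge> 2\<close> i' by auto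
  note U = closed_csubspace_UNIV[where 'a = 'h]
  let ?E = "Delta_L2 UNIV P" and ?T = "S(n := P)" and ?Q = "St(n := Pt)"
  let ?L = "hardy_space DPs \<times> ?E"

  \<comment> \<open>Contractivity of P, the isometry V and the defect spaces\<close>
  have "Gamma_contraction n UNIV ?T" by fact
  then have Tct: "commuting_tuple n UNIV ?T" by (simp add: Gamma_contraction_def)
  have Pb: "bounded_op UNIV UNIV P" and Ple: "\<And>x. norm (P x) \<le> norm x"
    using Gamma_contraction_last[OF \<open>Gamma_contraction n UNIV ?T\<close> n] by simp_all
  have Sb: "bounded_op UNIV UNIV (S j)" if "j \<in> {1..<n}" for j
  proof -
    have "j \<in> {1..n}" "j \<noteq> n" using that by auto
    then show ?thesis using Tct unfolding commuting_tuple_def by (metis fun_upd_other)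
  qed
  note defP = defect_op_contraction[OF Pb Ple]
  have DPs_c: "closed_csubspace DPs"
    unfolding DPs by (rule defect_op_contraction(4)[OF bounded_op_adjoint[OF U Pb] norm_adjoint_on_contraction[OF Pb Ple]])
  have Kc: "closed_csubspace K" unfolding K by (rule closed_csubspace_Schaffer_space[OF defP(4)])
  have V_iso: "isometric_op K K V" unfolding K V by (rule isometric_op_Schaffer_V[OF Pb Ple])
  have K2U: "commuting_tuple n K2 (R(n := V))" "\<And>j. j \<in> {1..n} \<Longrightarrow> normal_op K2 ((R(n := V)) j)"
    using Wold(5) by (auto simp: Gamma_unitary_def)
  have nV: "normal_op K2 V" using K2U(2)[of n] n by simp
  have redV: "reducing K V K1" "reducing K V K2" using Wold(2)[of n] Wold(3)[of n] n by auto
  \<comment> \<open>Needed because \<open>X\<close> takes adjoints on \<open>DV1s\<close> whereas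
    \<open>U1\<close> maps onto \<open>DVs\<close>.\<close>
  have DV_eq: "DV1s = DVs"
    unfolding DVs DV1s by (rule defect_space_pure_part[OF Kc V_iso Wold(1) redV nV])
  have DVs_c: "closed_csubspace DVs" unfolding DVs by (rule defect_space_coisometry(2)[OF Kc V_iso])

  \<comment> \<open>The adjoint pairs \<open>X j\<close>, \<open>Y j\<close>\<close>
  have Gb: "bounded_op DVs DVs (G j)" if "j \<in> {1..<n}" for j
  proof -
    have "j \<in> {1..n - 1}" using that by auto
    with \<open>FO_tuple n K1 (adjoint_tuple K1 (R(n := V))) G\<close>
    have "bounded_op DV1s DV1s (G j)" by (simp add: FO_tuple_def adjoint_tuple_def DV1s)
    then show ?thesis by (simp add: DV_eq)
  qed
  have U1: "bounded_op DPs DVs U1" using \<open>unitary_op DPs DVs U1\<close> by (simp add: unitary_op_def isometric_op_def)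
  note U1s = bounded_op_adjoint'[OF DPs_c U1]
  have Xb: "bounded_op DPs DPs (X j)" if "j \<in> {1..<n}" for j
    unfolding X DV_eq o_def
    by (rule bounded_op_comp[OF bounded_op_comp[OF U1 bounded_op_adjoint'[OF DVs_c Gb[OF that]]] U1s])
  have Yb: "bounded_op DPs DPs (Y j)" if "j \<in> {1..<n}" for j
    unfolding Y o_def by (rule bounded_op_comp[OF bounded_op_comp[OF U1 Gb[OF that]] U1s])
  have XY: "inner (X j a) b = inner a (Y j b)" if j: "j \<in> {1..<n}" and ab: "a \<in> DPs" "b \<in> DPs" for j a b
  proof -
    note Ua = bounded_opD(1)[OF U1 ab(1)] and Ub = bounded_opD(1)[OF U1 ab(2)]
    let ?G' = "adjoint_on DVs (G j)"
    have "inner (X j a) b = inner (U1 b) (?G' (U1 a))"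
      using adjoint_on(2)[OF DPs_c U1 ab(2), of "?G' (U1 a)"] by (simp add: X DV_eq inner_commute)
    also have "\<dots> = inner (U1 a) (G j (U1 b))"
      using adjoint_on(2)[OF DVs_c Gb[OF j] Ub, of "U1 a"] by (simp add: inner_commute)
    also have "\<dots> = inner a (Y j b)"
      using adjoint_on(2)[OF DPs_c U1 ab(1), of "G j (U1 b)"] by (simp add: Y)
    finally show ?thesis .
  qed

  \<comment> \<open>The dilation space and its second summand\<close>
  have dil: "minimal_Gamma_isometric_dilation TYPE('f) n UNIV ?T ?L ?Q J" by fact
  then have GQ: "Gamma_isometry TYPE('f) n ?L ?Q" and J: "isometric_op UNIV ?L J"
    and dil': "\<And>k x. adjoint_on UNIV J (tuple_monomial n ?Q k (J x)) = tuple_monomial n ?T k x"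
    by (auto simp: minimal_Gamma_isometric_dilation_def Gamma_isometric_dilation_def)
  have Qct: "commuting_tuple n ?L ?Q" by (rule Gamma_isometry_commuting_tuple[OF GQ])
  then have Lc: "closed_csubspace ?L" and Qb: "\<And>j. j \<in> {1..n} \<Longrightarrow> bounded_op ?L ?L (?Q j)"
    by (auto simp: commuting_tuple_def)
  note LD = closed_csubspaceD[OF Lc]
  have H0: "0 \<in> hardy_space DPs" "0 \<in> ?E" using LD(3) by (auto simp: zero_prod_def)
  \<comment> \<open>Linearity of \<open>?E\<close> is read off from the dilation through vectors (0,
    g), and closedness is built into \<open>Delta_L2\<close>; this avoids a pointwise analysis of
    \<open>Delta\<close>.\<close>
  have Ec: "closed_csubspace ?E"
  proof -
    have "x + y \<in> ?E" if "x \<in> ?E" "y \<in> ?E" for x y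
      using LD(4)[of "(0, x)" "(0, y)"] that H0 by simp
    moreover have "c *\<^sub>C x \<in> ?E" if "x \<in> ?E" for c x
      using LD(5)[of "(0, x)" c] that H0 by (simp add: scaleC_prod_def)
    moreover have "closed ?E" by (simp add: Delta_L2_def)
    ultimately show ?thesis using H0 by (simp add: closed_csubspace_def csubspace_def)
  qed
  note ED = closed_csubspaceD[OF Ec]
  \<comment> \<open>This makes the Hardy component of the image of (0, g) vanish, so the entries act
    on such vectors within the second summand.\<close>
  have Q0: "?Q j (0, 0) = 0" if "j \<in> {1..n}" for j
    using bounded_opD(7)[OF Qb[OF that] LD(1)] by (simp add: zero_prod_def)
  have Qj: "?Q j (0, g) = (0, St2 j g)" if "j \<in> {1..<n}" for j g
    using Q0[of j] that by (auto simp: St zero_prod_def)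
  have Qn: "?Q n (0, g) = (0, L2_mult_exp g)" for g
    using Q0[of n] n by (auto simp: Pt zero_prod_def)
  have Meb: "bounded_op ?E ?E L2_mult_exp"
  proof (rule bounded_opI[where K = 1])
    note q = bounded_opD[OF Qb[of n]]
    have n1: "n \<in> {1..n}" using n by simp
    show "L2_mult_exp g \<in> ?E" if "g \<in> ?E" for g
      using q(1)[OF n1, of "(0, g)"] that H0 by (simp add: Qn del: fun_upd_apply)
    show "L2_mult_exp (g + h) = L2_mult_exp g + L2_mult_exp h" if "g \<in> ?E" "h \<in> ?E" for g h
      using q(2)[OF n1, of "(0, g)" "(0, h)"] that H0 by (simp add: Qn del: fun_upd_apply)
    show "L2_mult_exp (c *\<^sub>C g) = c *\<^sub>C L2_mult_exp g" if "g \<in> ?E" for c g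
      using q(3)[OF n1, of "(0, g)" c] that H0 by (simp add: Qn scaleC_prod_def del: fun_upd_apply)
  qed (simp add: norm_L2_mult_exp)

  \<comment> \<open>The operators on \<open>K2\<close>\<close>
  have U2: "bounded_op ?E K2 U2" "isometric_op ?E K2 U2" "U2 ` ?E = K2" and U2n: "\<And>g. g \<in> ?E \<Longrightarrow> norm (U2 g) = norm g"
    using \<open>unitary_op ?E K2 U2\<close> by (auto simp: unitary_op_def isometric_op_def)
  define W where "W = adjoint_on ?E U2"
  have Wb: "bounded_op K2 ?E W" unfolding W_def by (rule bounded_op_adjoint'[OF Ec U2(1)])
  have WU: "W (U2 g) = g" if "g \<in> ?E" for g unfolding W_def by (rule isometric_op_adjoint_cancel[OF U2(2) Ec that])
  have UW: "U2 (W y) = y" if "y \<in> K2" for y using that U2(3) WU by force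
  have Wn: "norm (W y) = norm y" if "y \<in> K2" for y using U2n[OF bounded_opD(1)[OF Wb that]] UW[OF that] by simp
  have Wadj: "inner (W y) g = inner y (U2 g)" if "g \<in> ?E" for y g
    using adjoint_on(2)[OF Ec U2(1) that, of y] by (simp add: W_def inner_commute)

  have K2c: "closed_csubspace K2" using K2U(1) by (simp add: commuting_tuple_def)
  have Rb: "bounded_op K2 K2 (R j)" if "j \<in> {1..<n}" for j
  proof -
    have "j \<in> {1..n}" "j \<noteq> n" using that by auto
    then show ?thesis using K2U(1) unfolding commuting_tuple_def by (metis fun_upd_other)
  qed
  have Rc: "R j (R k y) = R k (R j y)" "R j (V y) = V (R j y)" if "j \<in> {1..<n}" "k \<in> {1..<n}" "y \<in> K2" for j k y
  proof -
    have *: "j \<in> {1..n}" "k \<in> {1..n}" "n \<in> {1..n}" "j \<noteq> n" "k \<noteq> n" using that by auto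
    have c: "\<forall>i\<in>{1..n}. \<forall>j\<in>{1..n}. \<forall>x\<in>K2. (R(n := V)) i ((R(n := V)) j x) = (R(n := V)) j ((R(n := V)) i x)"
      using K2U(1) by (simp add: commuting_tuple_def)
    show "R j (R k y) = R k (R j y)" using c[rule_format, OF *(1,2) that(3)] *(4,5) by simp
    show "R j (V y) = V (R j y)" using c[rule_format, OF *(1,3) that(3)] *(4) by simp
  qed
  have K2K: "K2 \<subseteq> K" using redV(2) by (simp add: reducing_def)
  have V2: "isometric_op K2 K2 V" by (rule reducing_restrict(1)[OF Kc V_iso redV(2)])
  then have V2b: "bounded_op K2 K2 V" by (simp add: isometric_op_def)
  define V' where "V' = adjoint_on K2 V"
  note V'b = bounded_op_adjoint'[OF K2c V2b, folded V'_def]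
  have V'V: "V' (V y) = y" if "y \<in> K2" for y unfolding V'_def by (rule isometric_op_adjoint_cancel[OF V2 K2c that])
  have VV': "V (V' y) = y" if "y \<in> K2" for y
    using nV V'V[OF that] that by (simp add: normal_op_def V'_def)
  \<comment> \<open>R (n - j) is the adjoint of R j times V; as V is unitary on K2, this can be
    solved for the adjoint. Double commutation of the R j follows, since V' commutes with each of
    them.\<close>
  have rel: "adjoint_on K2 (R j) y = R (n - j) (V' y)" if j: "j \<in> {1..<n}" and y: "y \<in> K2" for j y
  proof (rule adjoint_on_eqI[OF K2c Rb[OF j]])
    have nj: "n - j \<in> {1..<n}" "n - (n - j) = j" using j by auto
    note Vy = bounded_opD(1)[OF V'b y]
    show "R (n - j) (V' y) \<in> K2" by (rule bounded_opD(1)[OF Rb[OF nj(1)] Vy])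
    fix m assume m: "m \<in> K2"
    have "V' y \<in> Schaffer_space UNIV P" "m \<in> Schaffer_space UNIV P" using Vy m K2K K by auto
    from Schaffer_R_V_relation[OF Pb Ple Sb \<open>FO_tuple n UNIV ?T A\<close> nj(1) this]
    have "inner (R (n - j) (V' y)) m = inner (V (V' y)) (R j m)" by (simp add: R V nj(2))
    then show "inner (R j m) y = inner m (R (n - j) (V' y))" by (simp add: VV'[OF y] inner_commute)
  qed
  have RV': "R j (V' y) = V' (R j y)" if j: "j \<in> {1..<n}" and y: "y \<in> K2" for j y
  proof -
    note Vy = bounded_opD(1)[OF V'b y]
    have "V' (R j y) = V' (R j (V (V' y)))" by (simp add: VV'[OF y])
    also have "\<dots> = V' (V (R j (V' y)))" using Rc(2)[OF j j Vy] by simp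
    also have "\<dots> = R j (V' y)" by (rule V'V[OF bounded_opD(1)[OF Rb[OF j] Vy]])
    finally show ?thesis ..
  qed

  \<comment> \<open>The relation for multiplication by the exponential\<close>
  obtain Lf :: "'f set" and N Jt where GN: "Gamma_unitary n Lf N" and Jt: "isometric_op ?L Lf Jt"
    and NJt: "\<And>j v. j \<in> {1..n} \<Longrightarrow> v \<in> ?L \<Longrightarrow> N j (Jt v) = Jt (?Q j v)"
    using GQ unfolding Gamma_isometry_def by blast
  have Jtb: "bounded_op ?L Lf Jt" and Jtn: "\<And>v. v \<in> ?L \<Longrightarrow> norm (Jt v) = norm v" using Jt by (auto simp: isometric_op_def)
  \<comment> \<open>Multiplication by the exponential, transported to K2. It is for this operator
    rather than for V that the relation is needed; the unitary extension of the dilation restricts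
    to R 1, ..., R (n - 1), M on K2.\<close>
  define M where "M y = U2 (L2_mult_exp (W y))" for y
  have inc: "bounded_op ?E ?L (\<lambda>g. (0, g))"
    by (rule bounded_opI[where K = 1]) (use H0 in \<open>auto simp: scaleC_prod_def norm_Pair\<close>)
  have key: "R i y = M (adjoint_on K2 (R (n - i)) y)" if y: "y \<in> K2" for y
  proof (rule Gamma_unitary_restriction_relation[OF GN K2c, where \<Phi> = "\<lambda>y. Jt (0, W y)"])
    show "isometric_op K2 Lf (\<lambda>y. Jt (0, W y))"
      unfolding isometric_op_def
      using bounded_op_comp[OF bounded_op_comp[OF Wb inc] Jtb] Jtn bounded_opD(1)[OF Wb] H0 Wn by (simp add: norm_Pair)
    show "bounded_op K2 K2 (R j)" if "j \<in> {1..<n}" for j by (rule Rb[OF that])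
    show "R j (R k y) = R k (R j y)" if "j \<in> {1..<n}" "k \<in> {1..<n}" "y \<in> K2" for j k y by (rule Rc(1)[OF that])
    show "R j (adjoint_on K2 (R k) y) = adjoint_on K2 (R k) (R j y)" if j: "j \<in> {1..<n}" and k: "k \<in> {1..<n}" and y: "y \<in> K2" for j k y
    proof -
      have nk: "n - k \<in> {1..<n}" using k by auto
      show ?thesis
        using rel[OF k y] rel[OF k bounded_opD(1)[OF Rb[OF j] y]] Rc(1)[OF j nk bounded_opD(1)[OF V'b y]] RV'[OF j y] by simp
    qed
    show "isometric_op K2 K2 M"
      unfolding isometric_op_def M_def
      using bounded_op_comp[OF bounded_op_comp[OF Wb Meb] U2(1)] bounded_opD(1)[OF Wb] bounded_opD(1)[OF Meb] Wn U2n
      by (simp add: norm_L2_mult_exp)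
    show "N j (Jt (0, W y)) = Jt (0, W (R j y))" if j: "j \<in> {1..<n}" and y: "y \<in> K2" for j y
    proof -
      have "(0, W y) \<in> ?L" "j \<in> {1..n}" using H0 bounded_opD(1)[OF Wb y] j by auto
      then show ?thesis using NJt[of j "(0, W y)"] Qj[OF j, of "W y"] UW[OF y] by (simp add: St2 flip: W_def)
    qed
    show "N n (Jt (0, W y)) = Jt (0, W (M y))" if y: "y \<in> K2" for y
    proof -
      have "(0, W y) \<in> ?L" "n \<in> {1..n}" using H0 bounded_opD(1)[OF Wb y] n by auto
      then show ?thesis
        using NJt[of n "(0, W y)"] Qn[of "W y"] WU[OF bounded_opD(1)[OF Meb bounded_opD(1)[OF Wb y]]] by (simp add: M_def)
    qed
  qed (rule i, rule y)

  define St2' where "St2' g = W (adjoint_on K2 (R (n - i)) (U2 g))" for g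
  have St2b: "bounded_op ?E ?E (St2 j)" if "j \<in> {1..<n}" for j
    unfolding St2 o_def W_def[symmetric] by (rule bounded_op_comp[OF bounded_op_comp[OF U2(1) Rb[OF that]] Wb])
  have St2'b: "bounded_op ?E ?E St2'"
    unfolding St2'_def
    by (rule bounded_op_comp[OF bounded_op_comp[OF U2(1) bounded_op_adjoint'[OF K2c Rb[OF ni(1)]]] Wb])
  have St2_adj: "inner (St2 (n - i) g) h = inner g (St2' h)" if g: "g \<in> ?E" and h: "h \<in> ?E" for g h
  proof -
    note Ug = bounded_opD(1)[OF U2(1) g]
    have "inner (St2 (n - i) g) h = inner (R (n - i) (U2 g)) (U2 h)"
      using Wadj[OF h] by (simp add: St2 W_def)
    also have "\<dots> = inner (U2 g) (adjoint_on K2 (R (n - i)) (U2 h))" by (rule adjoint_on(2)[OF K2c Rb[OF ni(1)] Ug])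
    also have "\<dots> = inner g (St2' h)" using Wadj[OF g] by (simp add: St2'_def inner_commute)
    finally show ?thesis .
  qed
  have St2_rel: "St2 i g = L2_mult_exp (St2' g)" if g: "g \<in> ?E" for g
  proof -
    note Ug = bounded_opD(1)[OF U2(1) g]
    have "St2' g \<in> ?E" by (rule bounded_opD(1)[OF St2'b g])
    then show ?thesis
      using key[OF Ug] WU[OF bounded_opD(1)[OF Meb]] by (simp add: St2 St2'_def M_def flip: W_def)
  qed

  \<comment> \<open>Compression to the original space\<close>
  define Js where "Js = adjoint_on UNIV J"
  have Jb: "bounded_op UNIV ?L J" using J by (simp add: isometric_op_def)
  note Jsb = bounded_op_adjoint[OF U Jb, folded Js_def]
  have Jadj: "inner (Js w) y = inner w (J y)" for w y
    using adjoint_on(2)[OF U Jb, of y w] by (simp add: Js_def inner_commute)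
  have n1: "n \<in> {1..n}" "i \<in> {1..n}" "i \<noteq> n" using i by auto
  have JsPt: "Js (Pt v) = P (Js v)" if "v \<in> ?L" for v
    using minimal_dilation_coextension[OF dil Tct n that] by (simp add: Js_def)
  have SJ: "S i y = Js (St i (J y))" for y
    using dil'[of "\<lambda>j. if j = i then 1 else 0" y] tuple_monomial_single[OF n1(2), of ?Q] tuple_monomial_single[OF n1(2), of ?T] n1(3)
    by (simp add: Js_def)

  \<comment> \<open>From here on \<open>B\<close> is the block operator whose compression is
    \<open>C\<close>; it shadows the tuple of the same name in the hypotheses.\<close>
  define B where "B j v = (hardy_map (X j) (fst v), (1/2) *\<^sub>C St2 j (snd v))" for j v
  have CB: "C j y = Js (B j (J y))" for j y by (simp add: C Js_def B_def case_prod_unfold)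
  have Bb: "bounded_op ?L ?L (B j)" if j: "j \<in> {1..<n}" for j
  proof -
    note h = bounded_op_hardy_map[OF DPs_c Xb[OF j]] and s = bounded_op_scaleC[OF St2b[OF j] ED(1), of "1/2"]
    obtain K1 where K1: "\<And>f. f \<in> hardy_space DPs \<Longrightarrow> norm (hardy_map (X j) f) \<le> K1 * norm f" "K1 > 0" using bounded_op_bound[OF h] by blast
    obtain K2 where K2: "\<And>g. g \<in> ?E \<Longrightarrow> norm ((1/2) *\<^sub>C St2 j g) \<le> K2 * norm g" "K2 > 0" using bounded_op_bound[OF s] by blast
    show ?thesis
    proof (rule bounded_opI[where K = "K1 + K2"])
      fix v assume v: "v \<in> ?L"
      then have v': "fst v \<in> hardy_space DPs" "snd v \<in> ?E" by auto
      show "B j v \<in> ?L" using bounded_opD(1)[OF h v'(1)] bounded_opD(1)[OF s v'(2)] by (simp add: B_def)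
      show "B j (c *\<^sub>C v) = c *\<^sub>C B j v" for c
        using bounded_opD(3)[OF h v'(1)] bounded_opD(3)[OF s v'(2)] by (simp add: B_def scaleC_prod_def)
      show "B j (v + w) = B j v + B j w" if "w \<in> ?L" for w
      proof -
        have w': "fst w \<in> hardy_space DPs" "snd w \<in> ?E" using that by auto
        show ?thesis using bounded_opD(2)[OF h v'(1) w'(1)] bounded_opD(2)[OF s v'(2) w'(2)] by (simp add: B_def)
      qed
      have "norm (B j v) \<le> norm (hardy_map (X j) (fst v)) + norm ((1/2) *\<^sub>C St2 j (snd v))"
        using norm_Pair_le by (simp add: B_def)
      also have "\<dots> \<le> K1 * norm v + K2 * norm v"
        using K1 K2 v' norm_fst_le[of "fst v" "snd v"] norm_snd_le[of "snd v" "fst v"]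
        by (intro add_mono order_trans[OF K1(1)] order_trans[OF K2(1)] mult_left_mono) auto
      finally show "norm (B j v) \<le> (K1 + K2) * norm v" by (simp add: algebra_simps)
    qed
  qed
  obtain f g where Jx: "J x = (f, g)" by (cases "J x")
  have fg: "f \<in> hardy_space DPs" "g \<in> ?E" using bounded_opD(1)[OF Jb, of x] by (auto simp: Jx)
  \<comment> \<open>The value at J x of the adjoint of \<open>B (n - i)\<close>: \<open>X\<close>
    turns into \<open>Y\<close>, and \<open>St2 (n - i)\<close> into \<open>St2'\<close>.\<close>
  define v where "v = (hardy_map (Y (n - i)) f, (1/2) *\<^sub>C St2' g)"
  have Yf: "hardy_map (Y (n - i)) f \<in> hardy_space DPs"
    by (rule bounded_opD(1)[OF bounded_op_hardy_map[OF DPs_c Yb[OF ni(1)]] fg(1)])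
  note Sg = bounded_opD(1)[OF St2'b fg(2)]
  have vL: "v \<in> ?L" using Yf ED(5)[OF Sg] by (simp add: v_def)
  have "adjoint_on UNIV (C (n - i)) x = Js v"
  proof (rule adjoint_on_eqI[OF U])
    have "bounded_op UNIV UNIV (\<lambda>y. Js (B (n - i) (J y)))"
      using bounded_op_comp[OF bounded_op_comp[OF Jb Bb[OF ni(1)]], of UNIV Js] bounded_op_mono[OF Jsb, of ?L UNIV] by simp
    then show "bounded_op UNIV UNIV (C (n - i))" by (simp add: CB[abs_def])
    show "inner (C (n - i) m) x = inner m (Js v)" for m
    proof -
      obtain f' g' where Jm: "J m = (f', g')" by (cases "J m")
      have fg': "f' \<in> hardy_space DPs" "g' \<in> ?E" using bounded_opD(1)[OF Jb, of m] by (auto simp: Jm)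
      have half: "(1/2) *\<^sub>C z = (1/2) *\<^sub>R z" for z :: "'h L2circle" using scaleC_of_real[of "1/2" z] by simp
      have "inner (C (n - i) m) x = inner (B (n - i) (J m)) (J x)" by (simp add: CB Jadj)
      also have "\<dots> = inner (hardy_map (X (n - i)) f') f + inner ((1/2) *\<^sub>C St2 (n - i) g') g"
        by (simp add: B_def Jm Jx inner_prod_def)
      also have "\<dots> = inner f' (hardy_map (Y (n - i)) f) + inner g' ((1/2) *\<^sub>C St2' g)"
        using inner_hardy_map[OF DPs_c Xb[OF ni(1)] Yb[OF ni(1)] XY[OF ni(1)] fg'(1) fg(1)] St2_adj[OF fg'(2) fg(2)]
        by (simp add: half)
      also have "\<dots> = inner m (Js v)"
        using Jadj[of v m] by (simp add: v_def Jm inner_prod_def inner_commute)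
      finally show ?thesis .
    qed
  qed simp
  then have "P (adjoint_on UNIV (C (n - i)) x) = Js (Pt v)" by (simp add: JsPt[OF vL])
  \<comment> \<open>On the Hardy space these are the two terms of \<open>St1\<close>; on
    \<open>?E\<close> the two halves agree by \<open>St2_rel\<close>.\<close>
  moreover have "B i (J x) + Pt v = St i (J x)"
  proof -
    have half: "(1/2) *\<^sub>C z + (1/2) *\<^sub>C z = z" for z :: "'h L2circle" by (simp flip: scaleC_add_left)
    show ?thesis
      using bounded_opD(3)[OF Meb Sg] St2_rel[OF fg(2)] half
      by (simp add: B_def Jx v_def Pt St St1)
  qed
  moreover have "Js (B i (J x) + Pt v) = Js (B i (J x)) + Js (Pt v)" by (rule bounded_opD(2)[OF Jsb]) simp_all
  ultimately show "S i x = C i x + P (adjoint_on UNIV (C (n - i)) x)" by (simp add: SJ CB)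
qed

end
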